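(* Let $T\in\mathcal{B}(\mathcal{H})$ be such that $\sigma_S(T)$ contains the axially symmetric completion $\tilde{\mathcal{C}}$ of an exposed arc $\mathcal{C}$, and let $k\in\mathbb{N}$. Suppose that for each sphere $[s_0]\subset\tilde{\mathcal{C}}$ and each axially symmetric completion $\tilde L$ of a closed line segment $L$ (lying in the slice of $\mathcal{C}$) which is not tangent to $\mathcal{C}$ and satisfies $\tilde L\cap\sigma_S(T)=[s_0]$, there exists a constant $K>0$ such that $$\|S_L^{-1}(s,T)\|\le \exp\left(K\,|[s]-[s_0]|^{-k}\right)\qquad\text{for all } s\in\tilde L\setminus[s_0].$$ Then $T$ has a non-trivial hyperinvariant subspace.
   Context: $\mathbb{H}$ denotes the quaternions, $\mathbb{S}$ the sphere of purely imaginary unit quaternions, and for $\mathbb{I}\in\mathbb{S}$ the slice is $\mathbb{C}_{\mathbb{I}}=\{u+\mathbb{I}v: u,v\in\mathbb{R}\}$. For $q=x_0+\mathrm{Im}(q)\in\mathbb{H}$, $[q]=\{x_0+\mathbb{J}|\mathrm{Im}(q)|:\mathbb{J}\in\mathbb{S}\}$. The axially symmetric completion of a subset $C$ of a slice is $\tilde C=\bigcup_{s\in C}[s]$. The distance between classes is $|[s]-[t]|=\inf\{|p-q|: p\in[s],\,q\in[t]\}$. $\mathcal{H}$ is a separable right Hilbert space over $\mathbb{H}$ and $\mathcal{B}(\mathcal{H})$ is the algebra of bounded right linear operators on $\mathcal{H}$, with identity $\mathcal{I}$. A Hilbert basis $(e_n)_{n}$ of $\mathcal{H}$ is fixed and left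 multiplication by $s\in\mathbb{H}$ is defined by $sv=\sum_n e_n s\langle e_n,v\rangle$; $s\mathcal{I}$ denotes the operator $v\mapsto sv$. For $T\in\mathcal{B}(\mathcal{H})$ the $S$-spectrum is $\sigma_S(T)=\{s\in\mathbb{H}: T^2-2\mathrm{Re}(s)T+|s|^2\mathcal{I}\text{ is not invertible}\}$ and $\rho_S(T)=\mathbb{H}\setminus\sigma_S(T)$. For $s\in\rho_S(T)$ the left $S$-resolvent operator is $S_L^{-1}(s,T)=-(T^2-2\mathrm{Re}(s)T+|s|^2\mathcal{I})^{-1}(T-\overline{s}\,\mathcal{I})$. Exposed arc: an exposed arc $\mathcal{C}$ in $\sigma_S(T)\cap\mathbb{C}_{\mathbb{I}}$ is a smooth Jordan arc in $\mathbb{C}_{\mathbb{I}}$ for which there exists an open disk $\mathbb{D}_{\mathbb{I}}\subset\mathbb{C}_{\mathbb{I}}$ with $\mathbb{D}_{\mathbb{I}}\cap\sigma_S(T)=\mathcal{C}$; by axial symmetry of $\sigma_S(T)$ this is considered in every slice, for all $\mathbb{I}\in\mathbb{S}$. A subspace means a closed right $\mathbb{H}$-linear subspace; non-trivial means different from $\{0\}$ and $\mathcal{H}$. A subspace $\mathcal{M}\subset\mathcal{H}$ is invariant under $T$ if $Tx\in\mathcal{M}$ for all $x\in\mathcal{M}$; it is hyperinvariant under $T$ if it is invariant under every $B\in\mathcal{B}(\mathcal{H})$ which commutes with $T$. *)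

theory Defs
  imports "HOL-Analysis.Analysis"
begin

section \<open>Quaternions\<close>

datatype quat = Quat (qRe: real) (qIm1: real) (qIm2: real) (qIm3: real)

lemma quat_eq_iff:
  "p = q \<longleftrightarrow> qRe p = qRe q \<and> qIm1 p = qIm1 q \<and> qIm2 p = qIm2 q \<and> qIm3 p = qIm3 q"
  by (cases p; cases q) auto

instantiation quat :: ab_group_add
begin

definition "0 = Quat 0 0 0 0"
definition "p + q = Quat (qRe p + qRe q) (qIm1 p + qIm1 q) (qIm2 p + qIm2 q) (qIm3 p + qIm3 q)"
definition "p - q = Quat (qRe p - qRe q) (qIm1 p - qIm1 q) (qIm2 p - qIm2 q) (qIm3 p - qIm3 q)"
definition "- q = Quat (- qRe q) (- qIm1 q) (- qIm2 q) (- qIm3 q)"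

instance
  by standard
    (simp_all add: quat_eq_iff zero_quat_def plus_quat_def minus_quat_def uminus_quat_def)

end

instantiation quat :: real_algebra_1
begin

definition "1 = Quat 1 0 0 0"

definition "p * q = Quat
  (qRe p * qRe q - qIm1 p * qIm1 q - qIm2 p * qIm2 q - qIm3 p * qIm3 q)
  (qRe p * qIm1 q + qIm1 p * qRe q + qIm2 p * qIm3 q - qIm3 p * qIm2 q)
  (qRe p * qIm2 q - qIm1 p * qIm3 q + qIm2 p * qRe q + qIm3 p * qIm1 q)
  (qRe p * qIm3 q + qIm1 p * qIm2 q - qIm2 p * qIm1 q + qIm3 p * qRe q)"

definition "r *\<^sub>R q = Quat (r * qRe q) (r * qIm1 q) (r * qIm2 q) (r * qIm3 q)"

instance
  by standard
    (simp_all add: quat_eq_iff zero_quat_def one_quat_def plus_quat_def times_quat_def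
      scaleR_quat_def algebra_simps)

end

instantiation quat :: real_inner
begin

definition "inner p q = qRe p * qRe q + qIm1 p * qIm1 q + qIm2 p * qIm2 q + qIm3 p * qIm3 q"
definition "norm (q::quat) = sqrt (inner q q)"
definition "sgn (q::quat) = q /\<^sub>R norm q"
definition "dist (p::quat) q = norm (p - q)"
definition "(uniformity :: (quat \<times> quat) filter) = (INF e\<in>{0<..}. principal {(x, y). dist x y < e})"
definition "open (U::quat set) \<longleftrightarrow> (\<forall>x\<in>U. \<forall>\<^sub>F (x', y) in uniformity. x' = x \<longrightarrow> y \<in> U)"

instance
proof
  fix p q r :: quat and a :: real
  show "inner p q = inner q p" "inner (p + q) r = inner p r + inner q r"
    "inner (a *\<^sub>R p) q = a * inner p q"
    by (simp_all add: inner_quat_def plus_quat_def scaleR_quat_def algebra_simps)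
  show "0 \<le> inner p p" by (simp add: inner_quat_def)
  have "a + b + c + d = 0 \<longleftrightarrow> a = 0 \<and> b = 0 \<and> c = 0 \<and> d = 0"
    if "a \<ge> 0" "b \<ge> 0" "c \<ge> 0" "d \<ge> 0" for a b c d :: real
    using that by linarith
  then show "inner p p = 0 \<longleftrightarrow> p = 0"
    by (simp add: inner_quat_def quat_eq_iff zero_quat_def)
qed (rule norm_quat_def sgn_quat_def dist_quat_def uniformity_quat_def open_quat_def)+

end

instance quat :: real_normed_algebra_1
proof
  fix p q :: quat
  have "inner (p * q) (p * q) = inner p p * inner q q"
    by (simp add: inner_quat_def times_quat_def algebra_simps)
  then show "norm (p * q) \<le> norm p * norm q"
    by (simp add: norm_quat_def real_sqrt_mult)
  show "norm (1::quat) = 1"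
    by (simp add: norm_quat_def inner_quat_def one_quat_def)
qed

definition qcnj :: "quat \<Rightarrow> quat" where
  "qcnj q = Quat (qRe q) (- qIm1 q) (- qIm2 q) (- qIm3 q)"

definition qIm :: "quat \<Rightarrow> quat" where
  "qIm q = Quat 0 (qIm1 q) (qIm2 q) (qIm3 q)"

definition imag_units :: "quat set" where
  "imag_units = {I. qRe I = 0 \<and> norm I = 1}"

definition slice :: "quat \<Rightarrow> quat set" where
  "slice I = {of_real u + I * of_real v | u v. True}"

definition qsphere :: "quat \<Rightarrow> quat set" where
  "qsphere q = {of_real (qRe q) + J * of_real (norm (qIm q)) | J. J \<in> imag_units}"

definition axial_completion :: "quat set \<Rightarrow> quat set" where
  "axial_completion C = (\<Union>s\<in>C. qsphere s)"

section \<open>Right quaternionic Hilbert spaces\<close>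

text \<open>
  The inner product is right linear in its second argument, as needed for the left
  multiplication below to be right linear. The real structure of the type is the one obtained
  by restricting the right scalars to the reals.
\<close>

class right_quat_hilbert = banach +
  fixes scaleQ :: "'a \<Rightarrow> quat \<Rightarrow> 'a" (infixl \<open>*\<^sub>Q\<close> 75)
    and qinner :: "'a \<Rightarrow> 'a \<Rightarrow> quat"
  assumes scaleQ_add_left: "(x + y) *\<^sub>Q p = x *\<^sub>Q p + y *\<^sub>Q p"
    and scaleQ_add_right: "x *\<^sub>Q (p + q) = x *\<^sub>Q p + x *\<^sub>Q q"
    and scaleQ_scaleQ: "x *\<^sub>Q p *\<^sub>Q q = x *\<^sub>Q (p * q)"
    and scaleQ_of_real: "x *\<^sub>Q of_real r = r *\<^sub>R x"
    and qinner_cnj: "qinner y x = qcnj (qinner x y)"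
    and qinner_add_right: "qinner x (y + z) = qinner x y + qinner x z"
    and qinner_scaleQ_right: "qinner x (y *\<^sub>Q p) = qinner x y * p"
    and qinner_self_nonneg: "0 \<le> qRe (qinner x x)"
    and qinner_self_eq_0: "qinner x x = 0 \<longleftrightarrow> x = 0"
    and norm_eq_sqrt_qinner: "norm x = sqrt (qRe (qinner x x))"

text \<open>
  A Hilbert basis is indexed by a set \<open>N\<close> of natural numbers, so that finite dimensional spaces
  are covered as well.
\<close>

definition hilbert_basis :: "(nat \<Rightarrow> 'h::right_quat_hilbert) \<Rightarrow> nat set \<Rightarrow> bool" where
  "hilbert_basis e N \<longleftrightarrow>
     (\<forall>m\<in>N. \<forall>n\<in>N. qinner (e m) (e n) = (if m = n then 1 else 0)) \<and>
     (\<forall>v. ((\<lambda>n. e n *\<^sub>Q qinner (e n) v) has_sum v) N)"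

definition left_mult ::
    "(nat \<Rightarrow> 'h::right_quat_hilbert) \<Rightarrow> nat set \<Rightarrow> quat \<Rightarrow> 'h \<Rightarrow> 'h" where
  "left_mult e N s v = (\<Sum>\<^sub>\<infinity>n\<in>N. e n *\<^sub>Q (s * qinner (e n) v))"

definition bounded_right_linear :: "('h::right_quat_hilbert \<Rightarrow> 'h) \<Rightarrow> bool" where
  "bounded_right_linear T \<longleftrightarrow> bounded_linear T \<and> (\<forall>x q. T (x *\<^sub>Q q) = T x *\<^sub>Q q)"

definition invertible_op :: "('h::right_quat_hilbert \<Rightarrow> 'h) \<Rightarrow> bool" where
  "invertible_op A \<longleftrightarrow> (\<exists>B. bounded_right_linear B \<and> B \<circ> A = id \<and> A \<circ> B = id)"

section \<open>S-spectrum and left S-resolvent operator\<close>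

definition Q_op :: "('h::right_quat_hilbert \<Rightarrow> 'h) \<Rightarrow> quat \<Rightarrow> 'h \<Rightarrow> 'h" where
  "Q_op T s = (\<lambda>v. T (T v) - (2 * qRe s) *\<^sub>R T v + (norm s)\<^sup>2 *\<^sub>R v)"

definition S_spectrum :: "('h::right_quat_hilbert \<Rightarrow> 'h) \<Rightarrow> quat set" where
  "S_spectrum T = {s. \<not> invertible_op (Q_op T s)}"

text \<open>Only meaningful for \<open>s\<close> outside the S-spectrum, where \<open>Q_op T s\<close> is a bijection.\<close>

definition S_L_resolvent ::
    "(nat \<Rightarrow> 'h::right_quat_hilbert) \<Rightarrow> nat set \<Rightarrow> ('h \<Rightarrow> 'h) \<Rightarrow> quat \<Rightarrow> 'h \<Rightarrow> 'h" where
  "S_L_resolvent e N T s = (\<lambda>v. - inv (Q_op T s) (T v - left_mult e N (qcnj s) v))"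

section \<open>Exposed arcs\<close>

text \<open>
  \<open>C\<close> is a homeomorphic image of a non-degenerate interval \<open>J\<close> under a regular \<open>C\<^sup>1\<close>
  parametrization \<open>g\<close> with derivative \<open>g'\<close>. The interval need not be closed: the arc that a
  disk cuts out of a longer curve in the spectrum, the main example of an exposed arc, is the
  image of an open interval.
\<close>

definition smooth_jordan_arc ::
    "(real \<Rightarrow> quat) \<Rightarrow> (real \<Rightarrow> quat) \<Rightarrow> real set \<Rightarrow> quat set \<Rightarrow> bool" where
  "smooth_jordan_arc g g' J C \<longleftrightarrow>
     is_interval J \<and> (\<exists>x\<in>J. \<exists>y\<in>J. x < y) \<and>
     (\<exists>h. homeomorphism J C g h) \<and>
     (\<forall>t\<in>J. (g has_vector_derivative g' t) (at t within J)) \<and>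
     continuous_on J g' \<and> (\<forall>t\<in>J. g' t \<noteq> 0)"

definition exposed_arc ::
    "('h::right_quat_hilbert \<Rightarrow> 'h) \<Rightarrow> quat \<Rightarrow>
     (real \<Rightarrow> quat) \<Rightarrow> (real \<Rightarrow> quat) \<Rightarrow> real set \<Rightarrow> quat set \<Rightarrow> bool" where
  "exposed_arc T I g g' J C \<longleftrightarrow>
     smooth_jordan_arc g g' J C \<and> C \<subseteq> slice I \<and>
     (\<exists>c\<in>slice I. \<exists>r>0. (ball c r \<inter> slice I) \<inter> S_spectrum T = C)"

definition tangent_segment ::
    "quat \<Rightarrow> quat \<Rightarrow> (real \<Rightarrow> quat) \<Rightarrow> (real \<Rightarrow> quat) \<Rightarrow> real set \<Rightarrow> bool" where
  "tangent_segment a b g g' J \<longleftrightarrow>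
     (\<exists>t\<in>J. g t \<in> closed_segment a b \<and> (\<exists>c. b - a = c *\<^sub>R g' t))"

text \<open>
  The arc is considered in every slice, and \<open>I\<close> and \<open>- I\<close> give the same plane, which therefore
  contains both the arc and its mirror image. Since a segment and its mirror image have the same
  axially symmetric completion, tangency has to be excluded for both.
\<close>

definition transversal_segment ::
    "quat \<Rightarrow> quat \<Rightarrow> (real \<Rightarrow> quat) \<Rightarrow> (real \<Rightarrow> quat) \<Rightarrow> real set \<Rightarrow> bool" where
  "transversal_segment a b g g' J \<longleftrightarrow>
     \<not> tangent_segment a b g g' J \<and>
     \<not> tangent_segment a b (\<lambda>t. qcnj (g t)) (\<lambda>t. qcnj (g' t)) J"

section \<open>Hyperinvariant subspaces\<close>

definition closed_right_subspace :: "'h::right_quat_hilbert set \<Rightarrow> bool" where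
  "closed_right_subspace M \<longleftrightarrow>
     closed M \<and> 0 \<in> M \<and> (\<forall>x\<in>M. \<forall>y\<in>M. x + y \<in> M) \<and> (\<forall>x\<in>M. \<forall>q. x *\<^sub>Q q \<in> M)"

definition invariant_under :: "'h set \<Rightarrow> ('h \<Rightarrow> 'h) \<Rightarrow> bool" where
  "invariant_under M T \<longleftrightarrow> (\<forall>x\<in>M. T x \<in> M)"

definition hyperinvariant_under ::
    "'h::right_quat_hilbert set \<Rightarrow> ('h \<Rightarrow> 'h) \<Rightarrow> bool" where
  "hyperinvariant_under M T \<longleftrightarrow>
     (\<forall>B. bounded_right_linear B \<and> B \<circ> T = T \<circ> B \<longrightarrow> invariant_under M B)"

end

theory Submission
  imports Defs "HOL-Complex_Analysis.Complex_Analysis"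
begin

text \<open>
  Restricting the right scalars to a slice turns \<open>T\<close> into a complex linear operator whose spectrum
  is the trace of the S-spectrum on the slice, and whose resolvent is controlled by the S-resolvents
  at \<open>s\<close> and its conjugate. A short piece of the arc is enclosed in a rhombus having two opposite
  vertices on the arc, with angles so small that there is a holomorphic function \<open>m\<close> of the form
  \<open>exp (- (1 + w)^-(k+1) - (1 - w)^-(k+1))\<close> decaying at both vertices faster than the resolvent grows
  along the sides. Let \<open>A\<close> be the integral of \<open>m(z) (z - T)^-1\<close> along the sides. It is not zero:
  otherwise, for a point \<open>l\<close> of the arc inside the rhombus, the integral of
  \<open>m(z) (z - l)^-1 (z - T)^-1\<close> would be a nonzero multiple of an inverse of \<open>l - T\<close>.
  Let \<open>B\<close> be obtained from a second rhombus, disjoint from the first one and from its mirror image.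
  By the resolvent equation and Cauchy's theorem, \<open>A X B = 0\<close> for every right multiplication \<open>X\<close>.
  So the vectors \<open>x\<close> with \<open>A (x q) = 0\<close> for all quaternions \<open>q\<close> form a proper subspace, which
  contains the range of \<open>B\<close> and is hyperinvariant because \<open>A\<close> commutes with the commutant of \<open>T\<close>.
\<close>

section \<open>Quaternions and slices\<close>

text \<open>The kernel of \<open>A\<close> is only a complex subspace: an integral built from right
  multiplications by one slice need not commute with the other quaternions. Passing to the largest
  right quaternionic subspace inside that kernel repairs this, at the price of requiring
  \<open>A X B = 0\<close> for every right multiplication \<open>X\<close>. A quaternion splits into
  a part commuting with \<open>I\<close> and a part anticommuting with it; the second part
  conjugates the scalars it passes, and this is why the mirror image of the first rhombus has to be
  avoided too. A contour around only a piece of the arc must cross the spectrum. The growth bound is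
  available only on segments that meet a single sphere of the spectrum and are not tangent to the
  arc, which dictates the shape: near the arc the spectrum runs inside a cone of slope \<tau>/2
  about the chord, while the sides leave the vertices with slope \<tau>. A small angle also keeps
  the real part of (1 + w)^-(k+1) comparable to its modulus. The exponent k+1 instead of k makes the
  decay win whatever the constant \<open>K\<close> is, which may change with the segment.\<close>

lemmas quat_simps = quat_eq_iff zero_quat_def one_quat_def plus_quat_def minus_quat_def
  uminus_quat_def times_quat_def scaleR_quat_def qcnj_def qIm_def

lemma quat_sel_simps [simp]:
  "qRe (p + q) = qRe p + qRe q" "qIm1 (p + q) = qIm1 p + qIm1 q"
  "qIm2 (p + q) = qIm2 p + qIm2 q" "qIm3 (p + q) = qIm3 p + qIm3 q"
  "qRe (p - q) = qRe p - qRe q" "qIm1 (p - q) = qIm1 p - qIm1 q"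
  "qIm2 (p - q) = qIm2 p - qIm2 q" "qIm3 (p - q) = qIm3 p - qIm3 q"
  "qRe (- q) = - qRe q" "qIm1 (- q) = - qIm1 q" "qIm2 (- q) = - qIm2 q" "qIm3 (- q) = - qIm3 q"
  "qRe (r *\<^sub>R q) = r * qRe q" "qIm1 (r *\<^sub>R q) = r * qIm1 q"
  "qIm2 (r *\<^sub>R q) = r * qIm2 q" "qIm3 (r *\<^sub>R q) = r * qIm3 q"
  "qRe 0 = 0" "qIm1 0 = 0" "qIm2 0 = 0" "qIm3 0 = 0"
  "qRe 1 = 1" "qIm1 1 = 0" "qIm2 1 = 0" "qIm3 1 = 0"
  "qRe (of_real r) = r" "qIm1 (of_real r) = 0" "qIm2 (of_real r) = 0" "qIm3 (of_real r) = 0"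
  "qRe (qcnj q) = qRe q" "qIm1 (qcnj q) = - qIm1 q" "qIm2 (qcnj q) = - qIm2 q" "qIm3 (qcnj q) = - qIm3 q"
  "qRe (qIm q) = 0" "qIm1 (qIm q) = qIm1 q" "qIm2 (qIm q) = qIm2 q" "qIm3 (qIm q) = qIm3 q"
  by (simp_all add: quat_simps of_real_def)

lemma quat_sel_times [simp]:
  "qRe (p * q) = qRe p * qRe q - qIm1 p * qIm1 q - qIm2 p * qIm2 q - qIm3 p * qIm3 q"
  "qIm1 (p * q) = qRe p * qIm1 q + qIm1 p * qRe q + qIm2 p * qIm3 q - qIm3 p * qIm2 q"
  "qIm2 (p * q) = qRe p * qIm2 q - qIm1 p * qIm3 q + qIm2 p * qRe q + qIm3 p * qIm1 q"
  "qIm3 (p * q) = qRe p * qIm3 q + qIm1 p * qIm2 q - qIm2 p * qIm1 q + qIm3 p * qRe q"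
  by (simp_all add: times_quat_def)

lemma norm_quat_sqr: "(norm (q::quat))\<^sup>2 = (qRe q)\<^sup>2 + (qIm1 q)\<^sup>2 + (qIm2 q)\<^sup>2 + (qIm3 q)\<^sup>2"
  by (simp add: norm_quat_def inner_quat_def power2_eq_square)

lemma norm_quat_mult: "norm (p * q) = norm p * norm (q::quat)"
proof -
  have "inner (p * q) (p * q) = inner p p * inner q q"
    by (simp add: inner_quat_def algebra_simps)
  then show ?thesis by (simp add: norm_quat_def real_sqrt_mult)
qed

lemma imag_unitsD:
  assumes "I \<in> imag_units"
  shows "qRe I = 0" "(qIm1 I)\<^sup>2 + (qIm2 I)\<^sup>2 + (qIm3 I)\<^sup>2 = 1" "norm I = 1"
  using assms norm_quat_sqr[of I] by (auto simp: imag_units_def)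

lemma imag_unit_sqr: "I \<in> imag_units \<Longrightarrow> I * I = -1"
  using imag_unitsD[of I] by (simp add: quat_eq_iff power2_eq_square)

lemma imag_unit_uminus: "I \<in> imag_units \<Longrightarrow> - I \<in> imag_units"
  by (simp add: imag_units_def)

text \<open>Imaginary quaternions anticommute when they are orthogonal as vectors of three-space.
  The witness turns the first two coordinates of \<open>I\<close> by a right angle; if both vanish,
  the first unit is already orthogonal.\<close>

lemma ex_anticommuting_imag_unit:
  assumes "I \<in> imag_units"
  obtains J where "J \<in> imag_units" "I * J = - (J * I)"
proof -
  define s where "s = sqrt ((qIm1 I)\<^sup>2 + (qIm2 I)\<^sup>2)"
  show thesis
  proof (cases "s = 0")
    case True
    then have z: "qIm1 I = 0" "qIm2 I = 0" by (simp_all add: s_def sum_power2_eq_zero_iff)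
    show thesis
      by (rule that[of "Quat 0 1 0 0"])
        (use z imag_unitsD(1)[OF assms] in
          \<open>simp_all add: imag_units_def quat_eq_iff norm_quat_def inner_quat_def\<close>)
  next
    case False
    have s2: "s * s = (qIm1 I)\<^sup>2 + (qIm2 I)\<^sup>2" by (simp add: s_def)
    let ?J = "Quat 0 (- qIm2 I / s) (qIm1 I / s) 0"
    have "(qIm2 I / s)\<^sup>2 + (qIm1 I / s)\<^sup>2 = ((qIm1 I)\<^sup>2 + (qIm2 I)\<^sup>2) / (s * s)"
      by (simp add: power_divide power2_eq_square add_divide_distrib)
    also have "\<dots> = 1" using False s2 by (metis divide_self mult_eq_0_iff)
    finally have "norm ?J = 1" by (simp add: norm_quat_def inner_quat_def power2_eq_square)
    then have J: "?J \<in> imag_units" by (simp add: imag_units_def)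
    show thesis
      by (rule that[OF J]) (use imag_unitsD(1)[OF assms] in \<open>simp add: quat_eq_iff\<close>)
  qed
qed

text \<open>For an imaginary unit \<open>I\<close> this is the isometric algebra isomorphism of the
  complex plane onto the slice, and the analysis is done on its domain.\<close>

definition qc :: "quat \<Rightarrow> complex \<Rightarrow> quat" where
  "qc I z = Re z *\<^sub>R 1 + Im z *\<^sub>R I"

lemma slice_eq_range: "slice I = range (qc I)"
proof -
  have "of_real u + I * of_real v = qc I (Complex u v)" for u v
    by (simp add: qc_def of_real_def)
  then have "slice I = {qc I (Complex u v) | u v. True}" by (simp add: slice_def)
  also have "\<dots> = range (qc I)" by (auto simp: image_def) (metis complex.collapse)
  finally show ?thesis .
qed

context
  fixes I assumes I: "I \<in> imag_units"
begin

lemma qc_mult: "qc I (z * w) = qc I z * qc I w"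
  by (simp add: qc_def algebra_simps imag_unit_sqr[OF I])

lemma qc_add: "qc I (z + w) = qc I z + qc I w"
  by (simp add: qc_def algebra_simps)

lemma qc_minus: "qc I (z - w) = qc I z - qc I w"
  by (simp add: qc_def algebra_simps)

lemma qc_scaleR: "qc I (r *\<^sub>R z) = r *\<^sub>R qc I z"
  by (simp add: qc_def algebra_simps)

lemma qc_of_real: "qc I (of_real r) = of_real r"
  by (simp add: qc_def of_real_def)

lemma qc_cnj: "qc I (cnj z) = qcnj (qc I z)"
  using imag_unitsD(1)[OF I] by (simp add: qc_def quat_eq_iff)

lemma qRe_qc: "qRe (qc I z) = Re z"
  using imag_unitsD(1)[OF I] by (simp add: qc_def)

lemma norm_qc: "norm (qc I z) = cmod z"
proof -
  have "(norm (qc I z))\<^sup>2 = (Re z)\<^sup>2 + (Im z)\<^sup>2 * ((qIm1 I)\<^sup>2 + (qIm2 I)\<^sup>2 + (qIm3 I)\<^sup>2)"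
    unfolding norm_quat_sqr using imag_unitsD(1)[OF I]
    by (simp add: qc_def power2_eq_square algebra_simps)
  then have "(norm (qc I z))\<^sup>2 = (cmod z)\<^sup>2"
    using imag_unitsD(2)[OF I] by (simp add: cmod_power2)
  then show ?thesis by simp
qed

lemma dist_qc: "dist (qc I z) (qc I w) = dist z w"
  by (metis dist_norm norm_qc qc_minus)

lemma inj_qc: "qc I z = qc I w \<longleftrightarrow> z = w"
  by (metis dist_qc dist_eq_0_iff)

lemma bounded_linear_qc: "bounded_linear (qc I)"
  by (rule bounded_linear_intro[where K=1]) (auto simp: qc_add qc_scaleR norm_qc)

lemma qIm_qc: "qIm (qc I z) = Im z *\<^sub>R I"
  using imag_unitsD(1)[OF I] by (simp add: qc_def quat_eq_iff)

lemma norm_qIm_qc: "norm (qIm (qc I z)) = \<bar>Im z\<bar>"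
  using imag_unitsD(3)[OF I] by (simp add: qIm_qc)

lemma qc_in_qsphere: "qc I z \<in> qsphere (qc I z)"
proof -
  have "\<exists>J\<in>imag_units. Im z *\<^sub>R I = \<bar>Im z\<bar> *\<^sub>R J"
  proof (cases "Im z \<ge> 0")
    case True then show ?thesis using I by auto
  next
    case False
    \<comment> \<open>The radius in \<open>qsphere\<close> is nonnegative, so a point of the lower
      half plane is reached with the unit \<open>- I\<close>.\<close>
    then have "Im z *\<^sub>R I = \<bar>Im z\<bar> *\<^sub>R (- I)" by simp
    then show ?thesis using imag_unit_uminus[OF I] by blast
  qed
  then show ?thesis
    by (auto simp: qsphere_def qRe_qc norm_qIm_qc) (auto simp: qc_def of_real_def)
qed

lemma qsphere_cnj: "qsphere (qc I (cnj z)) = qsphere (qc I z)"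
  by (simp add: qsphere_def qRe_qc norm_qIm_qc)

end

lemma qsphereD:
  assumes "p \<in> qsphere q"
  shows "qRe p = qRe q" "norm (qIm p) = norm (qIm q)" "norm p = norm q"
proof -
  obtain J where J: "J \<in> imag_units" "p = of_real (qRe q) + J * of_real (norm (qIm q))"
    using assms by (auto simp: qsphere_def)
  show 1: "qRe p = qRe q" using J imag_unitsD(1)[OF J(1)] by simp
  have "qIm p = norm (qIm q) *\<^sub>R J"
    using J(2) imag_unitsD(1)[OF J(1)] by (simp add: quat_eq_iff)
  then show 2: "norm (qIm p) = norm (qIm q)" using imag_unitsD(3)[OF J(1)] by simp
  have "(norm r)\<^sup>2 = (qRe r)\<^sup>2 + (norm (qIm r))\<^sup>2" for r by (simp add: norm_quat_sqr)
  then show "norm p = norm q" using 1 2 by (metis norm_ge_zero power2_eq_imp_eq)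
qed

text \<open>The operator \<open>Q_op T s\<close> sees \<open>s\<close> only through its real part
  and its norm, and both are constant on a sphere.\<close>

lemma S_spectrum_qsphere:
  assumes "p \<in> qsphere q" shows "p \<in> S_spectrum T \<longleftrightarrow> q \<in> S_spectrum T"
  using qsphereD[OF assms] by (simp add: S_spectrum_def Q_op_def)

text \<open>The distance to a sphere is attained in the slice, at one of two conjugate points.\<close>

lemma setdist_qsphere_ge:
  assumes I: "I \<in> imag_units"
  shows "min (dist z w) (dist z (cnj w)) \<le> setdist (qsphere (qc I z)) (qsphere (qc I w))"
proof (rule le_setdistI)
  show "qsphere (qc I z) \<noteq> {}" "qsphere (qc I w) \<noteq> {}" using qc_in_qsphere[OF I] by auto
next
  fix p q assume p: "p \<in> qsphere (qc I z)" and q: "q \<in> qsphere (qc I w)"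
  have 1: "(dist p q)\<^sup>2 = (Re z - Re w)\<^sup>2 + (norm (qIm p - qIm q))\<^sup>2"
    using qsphereD(1)[OF p] qsphereD(1)[OF q]
    by (simp add: dist_norm norm_quat_sqr qRe_qc[OF I])
  have "\<bar>\<bar>Im z\<bar> - \<bar>Im w\<bar>\<bar> \<le> norm (qIm p - qIm q)"
    using norm_triangle_ineq3[of "qIm p" "qIm q"] qsphereD(2)[OF p] qsphereD(2)[OF q]
    by (simp add: norm_qIm_qc[OF I])
  then have "(\<bar>Im z\<bar> - \<bar>Im w\<bar>)\<^sup>2 \<le> (norm (qIm p - qIm q))\<^sup>2"
    by (metis abs_le_square_iff abs_norm_cancel)
  \<comment> \<open>For imaginary parts of equal sign this is the squared vertical distance to
    \<open>w\<close>, for opposite signs the one to \<open>cnj w\<close>.\<close>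
  moreover have "(\<bar>Im z\<bar> - \<bar>Im w\<bar>)\<^sup>2 = (Im z - Im w)\<^sup>2 \<or> (\<bar>Im z\<bar> - \<bar>Im w\<bar>)\<^sup>2 = (Im z + Im w)\<^sup>2"
    by (auto simp: abs_if power2_eq_square algebra_simps)
  ultimately have "(dist z w)\<^sup>2 \<le> (dist p q)\<^sup>2 \<or> (dist z (cnj w))\<^sup>2 \<le> (dist p q)\<^sup>2"
    unfolding 1 by (auto simp: dist_norm cmod_power2)
  then show "min (dist z w) (dist z (cnj w)) \<le> dist p q"
    by (auto simp: min_le_iff_disj intro: power2_le_imp_le)
qed

section \<open>Right multiplications as bounded operators\<close>

lemma qcnj_mult: "qcnj (p * q) = qcnj q * qcnj p"
  by (simp add: quat_eq_iff)

lemma qinner_self: "qinner x x = of_real ((norm x)\<^sup>2)"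
proof -
  have "qinner x x = qcnj (qinner x x)" by (rule qinner_cnj)
  then have "qIm1 (qinner x x) = 0" "qIm2 (qinner x x) = 0" "qIm3 (qinner x x) = 0"
    by (simp_all add: quat_eq_iff)
  then show ?thesis
    by (simp add: quat_eq_iff norm_eq_sqrt_qinner qinner_self_nonneg del: of_real_power)
qed

lemma qinner_add_left: "qinner (x + y) z = qinner x z + qinner y z"
proof -
  have "qcnj (qinner z (x + y)) = qcnj (qinner z x) + qcnj (qinner z y)"
    by (simp add: qinner_add_right quat_eq_iff)
  then show ?thesis by (metis qinner_cnj)
qed

lemma qinner_scaleQ_left: "qinner (x *\<^sub>Q p) y = qcnj p * qinner x y"
  by (metis qcnj_mult qinner_cnj qinner_scaleQ_right)

lemma norm_scaleQ: "norm (x *\<^sub>Q q) = norm x * norm q"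
proof -
  have "qinner (x *\<^sub>Q q) (x *\<^sub>Q q) = qcnj q * of_real ((norm x)\<^sup>2) * q"
    by (simp only: qinner_scaleQ_right qinner_scaleQ_left) (simp only: qinner_self)
  also have "\<dots> = of_real ((norm x * norm q)\<^sup>2)"
    unfolding power_mult_distrib norm_quat_sqr[of q]
    by (simp add: quat_eq_iff del: of_real_power of_real_mult) (simp add: power2_eq_square algebra_simps)
  finally have "(norm (x *\<^sub>Q q))\<^sup>2 = (norm x * norm q)\<^sup>2"
    by (simp add: qinner_self del: of_real_power)
  then show ?thesis by simp
qed

lemma scaleQ_scaleR_left: "(r *\<^sub>R x) *\<^sub>Q q = r *\<^sub>R (x *\<^sub>Q q)"
proof -
  have "of_real r * q = q * of_real r" by (simp add: of_real_def)
  then show ?thesis by (metis scaleQ_of_real scaleQ_scaleQ)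
qed

lemma scaleQ_scaleR_right: "x *\<^sub>Q (r *\<^sub>R q) = r *\<^sub>R (x *\<^sub>Q q)"
  by (metis scaleQ_of_real scaleQ_scaleQ scaleQ_scaleR_left scaleR_conv_of_real)

lemma scaleQ_1 [simp]: "x *\<^sub>Q 1 = x"
  using scaleQ_of_real[of x 1] by simp

lemma bounded_bilinear_scaleQ: "bounded_bilinear (*\<^sub>Q)"
proof
  show "\<exists>K. \<forall>a b. norm (a *\<^sub>Q b) \<le> norm a * norm b * K"
    by (rule exI[of _ 1]) (simp add: norm_scaleQ)
qed (simp_all add: scaleQ_add_left scaleQ_add_right scaleQ_scaleR_left scaleQ_scaleR_right)

lift_definition rmul :: "quat \<Rightarrow> 'h::right_quat_hilbert \<Rightarrow>\<^sub>L 'h" is "\<lambda>q v. v *\<^sub>Q q"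
  by (rule bounded_bilinear.bounded_linear_left[OF bounded_bilinear_scaleQ])

lemma rmul_apply [simp]: "rmul q v = v *\<^sub>Q q"
  by transfer simp

text \<open>Acting on the right reverses products, which is harmless within a slice, where products
  commute.\<close>

lemma rmul_mult: "rmul (p * q) = rmul q o\<^sub>L rmul p"
  by (rule blinfun_eqI) (simp add: scaleQ_scaleQ)

lemma rmul_1: "rmul 1 = id_blinfun"
  by (rule blinfun_eqI) simp

lemma norm_rmul_le: "norm (rmul q) \<le> norm q"
  by (rule norm_blinfun_bound) (simp_all add: norm_scaleQ mult.commute)

lemma bounded_linear_rmul: "bounded_linear rmul"
proof (rule bounded_linear_intro[where K=1])
  show "rmul (p + q) = rmul p + rmul q" for p q
    by (rule blinfun_eqI) (simp add: scaleQ_add_right blinfun.bilinear_simps)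
  show "rmul (r *\<^sub>R q) = r *\<^sub>R rmul q" for r q
    by (rule blinfun_eqI) (simp add: scaleQ_scaleR_right blinfun.bilinear_simps)
  show "norm (rmul q) \<le> norm q * 1" for q using norm_rmul_le by simp
qed

section \<open>Operator-valued integrals along polygonal contours\<close>

interpretation blinfun_comp: bounded_bilinear "(o\<^sub>L)"
  by (rule bounded_bilinear_blinfun_compose)

lemma blinfun_compose_assoc: "(A o\<^sub>L B) o\<^sub>L C = A o\<^sub>L (B o\<^sub>L C)"
  by (rule blinfun_eqI) simp

lemma blinfun_compose_id: "id_blinfun o\<^sub>L A = A" "A o\<^sub>L id_blinfun = A"
  by (auto intro!: blinfun_eqI)

lemma integral_blinfun_compose_left:
  fixes f :: "'n::euclidean_space \<Rightarrow> 'a::real_normed_vector \<Rightarrow>\<^sub>L 'b::banach"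
  assumes "f integrable_on s"
  shows "integral s (\<lambda>t. X o\<^sub>L f t) = X o\<^sub>L integral s f"
  using integral_linear[OF assms blinfun_comp.bounded_linear_right[of X]] by (simp add: o_def)

lemma integral_blinfun_compose_right:
  fixes f :: "'n::euclidean_space \<Rightarrow> 'b::real_normed_vector \<Rightarrow>\<^sub>L 'c::banach"
  assumes "f integrable_on s"
  shows "integral s (\<lambda>t. f t o\<^sub>L X) = integral s f o\<^sub>L X"
  using integral_linear[OF assms blinfun_comp.bounded_linear_left[of X]] by (simp add: o_def)

lemma continuous_on_linepath_segment:
  assumes "continuous_on (closed_segment a b) f"
  shows "continuous_on {0..1} (\<lambda>t. f (linepath a b t))"
  by (rule continuous_on_compose2[OF assms])
    (auto intro: continuous_on_linepath simp: linepath_in_path)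

text \<open>The type \<open>'h\<close> carries only real scalars, so a complex structure is encoded
  by an algebra homomorphism \<open>cm\<close> into the operators; \<open>cm z - T\<close> stands
  for z - T, and \<open>T_cm\<close> says that \<open>T\<close> is complex linear. Nothing
  quaternionic enters at this level.\<close>

locale complex_action =
  fixes cm :: "complex \<Rightarrow> 'h::banach \<Rightarrow>\<^sub>L 'h" and T :: "'h \<Rightarrow>\<^sub>L 'h"
  assumes bounded_linear_cm: "bounded_linear cm"
    and cm_1: "cm 1 = id_blinfun"
    and cm_mult: "cm (a * b) = cm a o\<^sub>L cm b"
    and T_cm: "T o\<^sub>L cm a = cm a o\<^sub>L T"
begin

lemmas cm_linear = bounded_linear_cm[THEN bounded_linear.linear]
lemmas cm_diff = linear_diff[OF cm_linear]
lemmas cm_0 = linear_0[OF cm_linear]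

lemma cm_commute: "cm a o\<^sub>L cm b = cm b o\<^sub>L cm a"
  by (metis cm_mult mult.commute)

text \<open>The commutant of \<open>T\<close> among the complex linear operators. It contains the
  scalars and \<open>T\<close>, as the resolvent equation requires, and later every right linear
  operator commuting with \<open>T\<close>, as hyperinvariance requires.\<close>

definition commuting :: "('h \<Rightarrow>\<^sub>L 'h) \<Rightarrow> bool" where
  "commuting X \<longleftrightarrow> X o\<^sub>L T = T o\<^sub>L X \<and> (\<forall>a. X o\<^sub>L cm a = cm a o\<^sub>L X)"

lemma commuting_T: "commuting T"
  by (simp add: commuting_def T_cm)

lemma commuting_cm: "commuting (cm a)"
  by (auto simp: commuting_def T_cm cm_commute)

text \<open>
  A contour is a finite set of oriented segments. On it, \<open>S z\<close> is the resolvent at \<open>z\<close> multiplied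
  by \<open>m z\<close>; stating this without a division admits points of the spectrum on the contour, where
  \<open>m\<close> and \<open>S\<close> vanish.
\<close>

definition spectral_contour ::
    "(complex \<times> complex) set \<Rightarrow> complex set \<Rightarrow> (complex \<Rightarrow> complex) \<Rightarrow> (complex \<Rightarrow> 'h \<Rightarrow>\<^sub>L 'h) \<Rightarrow> bool" where
  "spectral_contour E K m S \<longleftrightarrow> finite E \<and>
     (\<forall>a b. (a, b) \<in> E \<longrightarrow> closed_segment a b \<subseteq> K \<and>
        continuous_on (closed_segment a b) m \<and> continuous_on (closed_segment a b) S \<and>
        (\<forall>z\<in>closed_segment a b. (cm z - T) o\<^sub>L S z = cm (m z) \<and>
           (\<forall>X. commuting X \<longrightarrow> X o\<^sub>L S z = S z o\<^sub>L X))) \<and>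
     (\<forall>u. u \<notin> K \<longrightarrow> (\<Sum>(a, b)\<in>E. contour_integral (linepath a b) (\<lambda>z. m z / (z - u))) = 0)"

text \<open>The contour integral of \<open>S\<close>, where \<open>cm (b - a)\<close> is the
  derivative of the linear path. The factor 1 / (2 pi i) is left out, since only vanishing and
  commutation matter.\<close>

definition opint :: "(complex \<times> complex) set \<Rightarrow> (complex \<Rightarrow> 'h \<Rightarrow>\<^sub>L 'h) \<Rightarrow> 'h \<Rightarrow>\<^sub>L 'h" where
  "opint E S = (\<Sum>(a, b)\<in>E. integral {0..1} (\<lambda>t. S (linepath a b t) o\<^sub>L cm (b - a)))"

lemma integral_cm_linepath:
  assumes "continuous_on (closed_segment a b) f"
  shows "integral {0..1} (\<lambda>t. cm (f (linepath a b t) * (b - a))) = cm (contour_integral (linepath a b) f)"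
proof -
  have "(f has_contour_integral contour_integral (linepath a b) f) (linepath a b)"
    by (intro has_contour_integral_integral contour_integrable_continuous_linepath assms)
  then have "((\<lambda>t. f (linepath a b t) * (b - a)) has_integral contour_integral (linepath a b) f) {0..1}"
    by (simp only: has_contour_integral_linepath)
  from has_integral_linear[OF this bounded_linear_cm] show ?thesis
    by (simp add: o_def integral_unique)
qed

lemma opint_commute:
  assumes "\<And>a b. (a, b) \<in> E \<Longrightarrow> continuous_on (closed_segment a b) S"
    and "\<And>a b z. (a, b) \<in> E \<Longrightarrow> z \<in> closed_segment a b \<Longrightarrow> X o\<^sub>L S z = S z o\<^sub>L X"
    and X: "commuting X"
  shows "X o\<^sub>L opint E S = opint E S o\<^sub>L X"
proof -
  have "X o\<^sub>L integral {0..1} (\<lambda>t. S (linepath a b t) o\<^sub>L cm (b - a)) =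
      integral {0..1} (\<lambda>t. S (linepath a b t) o\<^sub>L cm (b - a)) o\<^sub>L X" if ab: "(a, b) \<in> E" for a b
  proof -
    have int: "(\<lambda>t. S (linepath a b t) o\<^sub>L cm (b - a)) integrable_on {0..1}"
      by (intro integrable_continuous_interval blinfun_comp.continuous_on
          continuous_on_linepath_segment assms(1) ab continuous_on_const)
    have "X o\<^sub>L (S (linepath a b t) o\<^sub>L cm (b - a)) = (S (linepath a b t) o\<^sub>L cm (b - a)) o\<^sub>L X"
      if "t \<in> {0..1}" for t
      using assms(2)[OF ab linepath_in_path[OF that]] X
      by (metis blinfun_compose_assoc commuting_def)
    then show ?thesis
      unfolding integral_blinfun_compose_left[OF int, symmetric]
        integral_blinfun_compose_right[OF int, symmetric]
      by (rule integral_cong)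
  qed
  then show ?thesis
    unfolding opint_def blinfun_comp.sum_right blinfun_comp.sum_left
    by (intro sum.cong) auto
qed

lemma spectral_contour_commute:
  assumes "spectral_contour E K m S" "commuting X"
  shows "X o\<^sub>L opint E S = opint E S o\<^sub>L X"
  by (rule opint_commute) (use assms in \<open>auto simp: spectral_contour_def\<close>)

text \<open>
  If the integral vanished, dividing the integrand by \<open>z - l\<close> would give, up to the nonzero
  scalar produced by Cauchy's formula, an inverse of \<open>l - T\<close>.
\<close>

lemma opint_eq_0_imp_invertible:
  assumes SC: "spectral_contour E K m S"
    and l: "\<And>a b. (a, b) \<in> E \<Longrightarrow> l \<notin> closed_segment a b"
    and c: "(\<Sum>(a, b)\<in>E. contour_integral (linepath a b) (\<lambda>z. m z / (z - l))) \<noteq> 0"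
    and 0: "opint E S = 0"
  obtains D where "(cm l - T) o\<^sub>L D = id_blinfun" "D o\<^sub>L (cm l - T) = id_blinfun"
proof -
  define c where "c = (\<Sum>(a, b)\<in>E. contour_integral (linepath a b) (\<lambda>z. m z / (z - l)))"
  define S' where "S' z = S z o\<^sub>L cm (1 / (z - l))" for z
  have cS': "continuous_on (closed_segment a b) S'"
    and cm': "continuous_on (closed_segment a b) (\<lambda>z. m z / (z - l))" if "(a, b) \<in> E" for a b
    unfolding S'_def using SC that l[OF that]
    by (auto simp: spectral_contour_def
        intro!: continuous_intros blinfun_comp.continuous_on bounded_linear.continuous_on[OF bounded_linear_cm])
  have comm: "X o\<^sub>L opint E S' = opint E S' o\<^sub>L X" if X: "commuting X" for X
  proof (rule opint_commute[OF _ _ X])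
    fix a b z assume ab: "(a, b) \<in> E" "z \<in> closed_segment a b"
    then have "X o\<^sub>L S z = S z o\<^sub>L X" using SC X by (auto simp: spectral_contour_def)
    moreover have "X o\<^sub>L cm (1 / (z - l)) = cm (1 / (z - l)) o\<^sub>L X" using X by (auto simp: commuting_def)
    ultimately show "X o\<^sub>L S' z = S' z o\<^sub>L X" unfolding S'_def by (metis blinfun_compose_assoc)
  qed (rule cS')
  \<comment> \<open>Write l - T as (z - T) - (z - l): the first term turns \<open>S z\<close> into
    the scalar \<open>m z\<close>, the second cancels the division in \<open>S'\<close>.\<close>
  have key: "(cm l - T) o\<^sub>L S' z = cm (m z / (z - l)) - S z"
    if ab: "(a, b) \<in> E" "z \<in> closed_segment a b" for a b z
  proof -
    have 1: "(cm z - T) o\<^sub>L S z = cm (m z)" using SC ab by (auto simp: spectral_contour_def)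
    have 2: "S z o\<^sub>L cm w = cm w o\<^sub>L S z" for w
      using SC ab commuting_cm[of w] by (auto simp: spectral_contour_def)
    have zl: "z \<noteq> l" using l ab by auto
    have "cm l = cm z - cm (z - l)" by (simp add: cm_diff)
    then have "(cm l - T) o\<^sub>L S' z =
      (((cm z - T) o\<^sub>L S z) o\<^sub>L cm (1 / (z - l))) - ((cm (z - l) o\<^sub>L S z) o\<^sub>L cm (1 / (z - l)))"
      unfolding S'_def by (simp add: blinfun_comp.diff_left blinfun_compose_assoc)
    also have "(cm (z - l) o\<^sub>L S z) o\<^sub>L cm (1 / (z - l)) = S z o\<^sub>L cm ((z - l) * (1 / (z - l)))"
      by (metis 2 blinfun_compose_assoc cm_mult)
    also have "\<dots> = S z" using zl by (intro blinfun_eqI) (simp add: cm_1)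
    finally show ?thesis unfolding 1 by (simp flip: cm_mult)
  qed
  have "(cm l - T) o\<^sub>L integral {0..1} (\<lambda>t. S' (linepath a b t) o\<^sub>L cm (b - a)) =
      cm (contour_integral (linepath a b) (\<lambda>z. m z / (z - l)))
      - integral {0..1} (\<lambda>t. S (linepath a b t) o\<^sub>L cm (b - a))" if ab: "(a, b) \<in> E" for a b
  proof -
    have int': "(\<lambda>t. S' (linepath a b t) o\<^sub>L cm (b - a)) integrable_on {0..1}"
      by (intro integrable_continuous_interval blinfun_comp.continuous_on
          continuous_on_linepath_segment cS' ab continuous_on_const)
    have int: "(\<lambda>t. S (linepath a b t) o\<^sub>L cm (b - a)) integrable_on {0..1}"
      by (intro integrable_continuous_interval blinfun_comp.continuous_on
          continuous_on_linepath_segment continuous_on_const) (use SC ab in \<open>auto simp: spectral_contour_def\<close>)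
    have intm: "(\<lambda>t. cm (m (linepath a b t) / (linepath a b t - l) * (b - a))) integrable_on {0..1}"
      by (intro integrable_continuous_interval bounded_linear.continuous_on[OF bounded_linear_cm]
          continuous_on_mult continuous_on_linepath_segment[OF cm'[OF ab]] continuous_on_const)
    have "(cm l - T) o\<^sub>L integral {0..1} (\<lambda>t. S' (linepath a b t) o\<^sub>L cm (b - a)) =
       integral {0..1} (\<lambda>t. (cm l - T) o\<^sub>L (S' (linepath a b t) o\<^sub>L cm (b - a)))"
      by (rule integral_blinfun_compose_left[OF int', symmetric])
    also have "\<dots> = integral {0..1} (\<lambda>t. cm (m (linepath a b t) / (linepath a b t - l) * (b - a))
        - (S (linepath a b t) o\<^sub>L cm (b - a)))"
    proof (rule integral_cong)
      fix t :: real assume "t \<in> {0..1}"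
      from key[OF ab linepath_in_path[OF this]]
      show "(cm l - T) o\<^sub>L (S' (linepath a b t) o\<^sub>L cm (b - a)) =
          cm (m (linepath a b t) / (linepath a b t - l) * (b - a)) - (S (linepath a b t) o\<^sub>L cm (b - a))"
        by (simp only: blinfun_compose_assoc[symmetric]) (simp only: cm_mult blinfun_comp.diff_left)
    qed
    also have "\<dots> = cm (contour_integral (linepath a b) (\<lambda>z. m z / (z - l)))
        - integral {0..1} (\<lambda>t. S (linepath a b t) o\<^sub>L cm (b - a))"
      unfolding integral_cm_linepath[OF cm'[OF ab], symmetric] by (rule integral_diff[OF intm int])
    finally show ?thesis .
  qed
  then have "(cm l - T) o\<^sub>L opint E S' = cm c - opint E S"
    unfolding opint_def c_def linear_sum[OF cm_linear] blinfun_comp.sum_right sum_subtractf[symmetric]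
    by (intro sum.cong) auto
  then have D: "(cm l - T) o\<^sub>L opint E S' = cm c" using 0 by simp
  have "c \<noteq> 0" using c by (simp add: c_def)
  define D where "D = opint E S' o\<^sub>L cm (1 / c)"
  have 1: "(cm l - T) o\<^sub>L D = id_blinfun"
    unfolding D_def blinfun_compose_assoc[symmetric] D using \<open>c \<noteq> 0\<close> by (simp flip: cm_mult cm_1)
  \<comment> \<open>The right inverse is two-sided, because the integral commutes with every member
    of the commutant.\<close>
  have "commuting (cm l - T)"
    by (simp add: commuting_def blinfun_comp.diff_left blinfun_comp.diff_right T_cm cm_commute)
  then have "(cm l - T) o\<^sub>L D = D o\<^sub>L (cm l - T)"
    unfolding D_def using comm[of "cm l - T"] by (metis blinfun_compose_assoc commuting_def)
  with 1 show thesis using that by metis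
qed

text \<open>
  With \<open>X\<close> the identity and \<open>\<theta>\<close> trivial this is the multiplicativity of the functional calculus for
  contours around disjoint regions; the twisted form is for antilinear \<open>X\<close>. By the resolvent
  equation the double integral splits into two, each having a vanishing inner integral.
\<close>

lemma opint_compose_eq_0:
  assumes SC1: "spectral_contour E1 K1 m1 S1" and SC2: "spectral_contour E2 K2 m2 S2"
    and XT: "X o\<^sub>L T = T o\<^sub>L X" and Xcm: "\<And>z. cm z o\<^sub>L X = X o\<^sub>L cm (\<theta> z)"
    and \<theta>: "bounded_linear \<theta>" "\<And>z w. \<theta> (z * w) = \<theta> z * \<theta> w" "\<And>z. \<theta> (\<theta> z) = z"
    and disj: "\<theta> ` K1 \<inter> K2 = {}"
  shows "opint E1 S1 o\<^sub>L X o\<^sub>L opint E2 S2 = 0"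
proof -
  have \<theta>_diff: "\<theta> (z - w) = \<theta> z - \<theta> w" for z w by (rule bounded_linear.linear[OF \<theta>(1), THEN linear_diff])
  have ne: "\<theta> z \<noteq> w" if "z \<in> K1" "w \<in> K2" for z w using that disj by auto
  have ne': "w \<noteq> \<theta> z" if "z \<in> K1" "w \<in> K2" for z w using that disj by auto
  define F where "F S p t = S (linepath (fst p) (snd p) t) o\<^sub>L cm (snd p - fst p)"
    for S :: "complex \<Rightarrow> 'h \<Rightarrow>\<^sub>L 'h" and p :: "complex \<times> complex" and t
  let ?l = "\<lambda>p t. linepath (fst p) (snd p) t" and ?d = "\<lambda>p. snd p - fst p"
  \<comment> \<open>\<open>G\<close> and \<open>H\<close> are the two halves of the resolvent
    equation. \<open>G\<close> keeps the first resolvent and has a scalar kernel in the second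
    variable. \<open>H\<close> keeps the second resolvent; its scalar kernel in the first variable
    has been moved through \<open>X\<close>, which applies \<theta>.\<close>
  define G where "G p q s t = F S1 p s o\<^sub>L X o\<^sub>L cm (m2 (?l q t) / (?l q t - \<theta> (?l p s)) * ?d q)"
    for p q s t
  define H where "H p q s t = X o\<^sub>L cm (\<theta> (m1 (?l p s) / (?l p s - \<theta> (?l q t)) * ?d p)) o\<^sub>L F S2 q t"
    for p q s t
  have inK1: "?l p s \<in> K1" if "p \<in> E1" "s \<in> {0..1}" for p s
    using SC1 that linepath_in_path[OF that(2), of "fst p" "snd p"] unfolding spectral_contour_def
    by (metis prod.collapse subsetD)
  have inK2: "?l p s \<in> K2" if "p \<in> E2" "s \<in> {0..1}" for p s
    using SC2 that linepath_in_path[OF that(2), of "fst p" "snd p"] unfolding spectral_contour_def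
    by (metis prod.collapse subsetD)
  have split: "F S1 p s o\<^sub>L X o\<^sub>L F S2 q t = G p q s t + H p q s t"
    if pq: "p \<in> E1" "q \<in> E2" "s \<in> {0..1}" "t \<in> {0..1}" for p q s t
  proof (rule blinfun_eqI)
    fix v
    let ?z = "?l p s" and ?w = "?l q t"
    have 1: "(cm ?z - T) o\<^sub>L S1 ?z = cm (m1 ?z)" "commuting Y \<Longrightarrow> Y o\<^sub>L S1 ?z = S1 ?z o\<^sub>L Y" for Y
      using SC1 linepath_in_path[OF pq(3)] pq(1) unfolding spectral_contour_def
      by (metis prod.collapse)+
    have 2: "(cm ?w - T) o\<^sub>L S2 ?w = cm (m2 ?w)" "commuting Y \<Longrightarrow> Y o\<^sub>L S2 ?w = S2 ?w o\<^sub>L Y" for Y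
      using SC2 linepath_in_path[OF pq(4)] pq(2) unfolding spectral_contour_def
      by (metis prod.collapse)+
    have S1c: "cm a (S1 ?z v) = S1 ?z (cm a v)" "T (S1 ?z v) = S1 ?z (T v)" for a v
      using 1(2)[OF commuting_cm] 1(2)[OF commuting_T] by (metis blinfun_apply_blinfun_compose)+
    have S2c: "cm a (S2 ?w v) = S2 ?w (cm a v)" "T (S2 ?w v) = S2 ?w (T v)" for a v
      using 2(2)[OF commuting_cm] 2(2)[OF commuting_T] by (metis blinfun_apply_blinfun_compose)+
    have Xc: "cm a (X v) = X (cm (\<theta> a) v)" "T (X v) = X (T v)" for a v
      using Xcm[of a] XT by (metis blinfun_apply_blinfun_compose)+
    have cmm: "cm a (cm b v) = cm (a * b) v" for a b v
      by (simp add: cm_mult)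
    have e1: "S1 ?z (cm ?z v) = S1 ?z (T v) + cm (m1 ?z) v" for v
      using 1(1)[symmetric] S1c by (simp add: blinfun.diff_left blinfun.diff_right)
    have e2: "S2 ?w (cm ?w v) = S2 ?w (T v) + cm (m2 ?w) v" for v
      using 2(1)[symmetric] S2c by (simp add: blinfun.diff_left blinfun.diff_right)
    define c where "c = ?w - \<theta> ?z"
    have c: "c \<noteq> 0" using ne[OF inK1[OF pq(1,3)] inK2[OF pq(2,4)]] by (auto simp: c_def)
    \<comment> \<open>The resolvent equation twisted by \<open>X\<close>: in the factor w - \<theta>
      z, let w act on \<open>S2\<close> and let \<theta> z pass through \<open>X\<close> to act as z
      on \<open>S1\<close>; the two terms containing \<open>T\<close> cancel. The factor sits in the
      argument, so no division occurs.\<close>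
    have main: "S1 ?z (X (S2 ?w (cm c u))) = S1 ?z (X (cm (m2 ?w) u)) - X (S2 ?w (cm (\<theta> (m1 ?z)) u))" for u
    proof -
      have "S1 ?z (X (S2 ?w (cm c u))) = S1 ?z (X (S2 ?w (cm ?w u))) - S1 ?z (X (S2 ?w (cm (\<theta> ?z) u)))"
        by (simp add: c_def cm_diff blinfun.diff_left blinfun.diff_right)
      also have "S1 ?z (X (S2 ?w (cm ?w u))) = S1 ?z (X (S2 ?w (T u))) + S1 ?z (X (cm (m2 ?w) u))"
        unfolding e2 by (simp add: blinfun.add_right)
      also have "S1 ?z (X (S2 ?w (cm (\<theta> ?z) u))) = S1 ?z (cm ?z (X (S2 ?w u)))"
        by (simp add: Xc S2c)
      also have "\<dots> = S1 ?z (X (S2 ?w (T u))) + X (S2 ?w (cm (\<theta> (m1 ?z)) u))"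
        unfolding e1 by (simp add: Xc S2c)
      finally show ?thesis by simp
    qed
    \<comment> \<open>Applying the involution to z - \<theta> w gives \<theta> z - w, the negative
      of \<open>c\<close>; this sign makes \<open>H\<close> enter with a plus.\<close>
    have "\<theta> (1 / (?z - \<theta> ?w)) * (\<theta> ?z - ?w) = 1"
    proof -
      have 0: "?z - \<theta> ?w \<noteq> 0" using ne[OF inK1[OF pq(1,3)] inK2[OF pq(2,4)]] \<theta>(3) by auto
      have "\<theta> 1 = 1" by (metis \<theta>(2,3) mult.left_neutral mult.right_neutral)
      have "\<theta> (1 / (?z - \<theta> ?w)) * (\<theta> ?z - ?w) = \<theta> (1 / (?z - \<theta> ?w) * (?z - \<theta> ?w))"
        by (simp only: \<theta>(2,3) \<theta>_diff)
      also have "\<dots> = 1" using 0 \<open>\<theta> 1 = 1\<close> by simp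
      finally show ?thesis .
    qed
    then have inv: "\<theta> (1 / (?z - \<theta> ?w)) = - (1 / c)"
      using c by (simp add: c_def field_simps)
    let ?u = "cm (\<theta> (?d p) * ?d q / c) v"
    have "(F S1 p s o\<^sub>L X o\<^sub>L F S2 q t) v = S1 ?z (X (S2 ?w (cm c ?u)))"
      using c by (simp add: F_def Xc S2c cmm)
    also have "\<dots> = S1 ?z (X (cm (m2 ?w) ?u)) - X (S2 ?w (cm (\<theta> (m1 ?z)) ?u))"
      by (rule main)
    also have "S1 ?z (X (cm (m2 ?w) ?u)) = G p q s t v"
      by (simp add: G_def F_def Xc S2c cmm c_def ac_simps)
    also have "X (S2 ?w (cm (\<theta> (m1 ?z)) ?u)) = - H p q s t v"
    proof -
      have "\<theta> (m1 ?z / (?z - \<theta> ?w) * ?d p) = - (\<theta> (m1 ?z) * \<theta> (?d p) / c)"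
        unfolding \<theta>(2) using inv \<theta>(2)[of "m1 ?z" "1 / (?z - \<theta> ?w)"] by simp
      then show ?thesis
        by (simp add: H_def F_def S2c cmm linear_neg[OF cm_linear] blinfun.minus_left blinfun.minus_right mult.assoc)
    qed
    finally show "(F S1 p s o\<^sub>L X o\<^sub>L F S2 q t) v = (G p q s t + H p q s t) v"
      by (simp add: blinfun.add_left)
  qed
  have cont1: "continuous_on {0..1} (\<lambda>t. S1 (?l p t))" "continuous_on {0..1} (\<lambda>t. m1 (?l p t))"
    if "p \<in> E1" for p
    using SC1 that unfolding spectral_contour_def
    by (metis prod.collapse continuous_on_linepath_segment)+
  have cont2: "continuous_on {0..1} (\<lambda>t. S2 (?l p t))" "continuous_on {0..1} (\<lambda>t. m2 (?l p t))"
    if "p \<in> E2" for p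
    using SC2 that unfolding spectral_contour_def
    by (metis prod.collapse continuous_on_linepath_segment)+
  have contF1: "continuous_on {0..1} (F S1 p)" if "p \<in> E1" for p
    unfolding F_def[abs_def] by (intro blinfun_comp.continuous_on cont1 that continuous_on_const)
  have contF2: "continuous_on {0..1} (F S2 p)" if "p \<in> E2" for p
    unfolding F_def[abs_def] by (intro blinfun_comp.continuous_on cont2 that continuous_on_const)
  have contm2: "continuous_on {0..1} (\<lambda>t. m2 (?l q t) / (?l q t - \<theta> (?l p s)))"
    if "p \<in> E1" "q \<in> E2" "s \<in> {0..1}" for p q s
    using ne'[OF inK1[OF that(1,3)] inK2[OF that(2)]]
    by (intro continuous_intros cont2 that continuous_on_linepath) auto
  have contG: "continuous_on {0..1} (G p q s)" if "p \<in> E1" "q \<in> E2" "s \<in> {0..1}" for p q s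
    unfolding G_def[abs_def]
    by (intro blinfun_comp.continuous_on bounded_linear.continuous_on[OF bounded_linear_cm]
        continuous_on_mult contm2 that continuous_on_const)
  \<comment> \<open>Joint continuity is for Fubini: the inner integral of \<open>H\<close> that
    vanishes runs over the first contour, so the order of integration has to be exchanged.\<close>
  have contH: "continuous_on ({0..1} \<times> {0..1}) (\<lambda>(s, t). H p q s t)" if "p \<in> E1" "q \<in> E2" for p q
  proof -
    have l: "continuous_on ({0..1} \<times> {0..1}) (\<lambda>x. ?l p (fst x))" "continuous_on ({0..1} \<times> {0..1}) (\<lambda>x. ?l q (snd x))"
      unfolding linepath_def by (intro continuous_intros)+
    have "continuous_on ({0..1} \<times> {0..1}) (\<lambda>x. m1 (?l p (fst x)))"
      "continuous_on ({0..1} \<times> {0..1}) (\<lambda>x. F S2 q (snd x))"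
      by (rule continuous_on_compose2[OF cont1(2)[OF that(1)]] continuous_on_compose2[OF contF2[OF that(2)]];
          auto intro!: continuous_intros)+
    moreover have "?l p (fst x) - \<theta> (?l q (snd x)) \<noteq> 0" if "x \<in> {0..1} \<times> {0..1}" for x
      using ne[OF inK1[OF \<open>p \<in> E1\<close>] inK2[OF \<open>q \<in> E2\<close>], of "fst x" "snd x"] that \<theta>(3) by auto
    ultimately show ?thesis unfolding H_def case_prod_unfold
      by (intro blinfun_comp.continuous_on bounded_linear.continuous_on[OF bounded_linear_cm]
          bounded_linear.continuous_on[OF \<theta>(1)] continuous_intros l) auto
  qed
  have contHt: "continuous_on {0..1} (H p q s)" if "p \<in> E1" "q \<in> E2" "s \<in> {0..1}" for p q s
  proof -
    have "continuous_on {0..1} (\<lambda>t. case (s, t) of (s, t) \<Rightarrow> H p q s t)"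
      by (rule continuous_on_compose2[OF contH[OF that(1,2)] continuous_on_Pair[OF continuous_on_const continuous_on_id]])
        (use that in auto)
    then show ?thesis by simp
  qed
  have contHs: "continuous_on {0..1} (\<lambda>s. H p q s t)" if "p \<in> E1" "q \<in> E2" "t \<in> {0..1}" for p q t
  proof -
    have "continuous_on {0..1} (\<lambda>s. case (s, t) of (s, t) \<Rightarrow> H p q s t)"
      by (rule continuous_on_compose2[OF contH[OF that(1,2)] continuous_on_Pair[OF continuous_on_id continuous_on_const]])
        (use that in auto)
    then show ?thesis by simp
  qed
  have contHi: "continuous_on {0..1} (\<lambda>s. integral {0..1} (H p q s))" if "p \<in> E1" "q \<in> E2" for p q
    using integral_continuous_on_param[of "{0..1}" 0 1 "\<lambda>s t. H p q s t"] contH[OF that] by simp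
  have contHi': "continuous_on {0..1} (\<lambda>t. integral {0..1} (\<lambda>s. H p q s t))" if "p \<in> E1" "q \<in> E2" for p q
    using integral_continuous_on_param[of "{0..1}" 0 1 "\<lambda>t s. H p q s t"]
      continuous_on_swap_args[OF contH[OF that]] by simp
  have swapH: "integral {0..1} (\<lambda>s. integral {0..1} (H p q s)) = integral {0..1} (\<lambda>t. integral {0..1} (\<lambda>s. H p q s t))"
    if "p \<in> E1" "q \<in> E2" for p q
    using integral_swap_continuous[of 0 0 1 1 "H p q"] contH[OF that]
    by (simp add: cbox_Pair_eq)
  note icont = integrable_continuous_interval
  have fin: "finite E1" "finite E2" using SC1 SC2 by (auto simp: spectral_contour_def)
  have op1: "opint E1 S1 = (\<Sum>p\<in>E1. integral {0..1} (F S1 p))"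
    and op2: "opint E2 S2 = (\<Sum>p\<in>E2. integral {0..1} (F S2 p))"
    unfolding opint_def F_def[abs_def] by (simp_all add: case_prod_unfold)
  \<comment> \<open>For fixed z the kernel has its pole at \<theta> z, outside \<open>K2\<close>, so
    the contour condition makes the integral over the second contour vanish.\<close>
  have G0: "(\<Sum>q\<in>E2. integral {0..1} (G p q s)) = 0" if p: "p \<in> E1" and s: "s \<in> {0..1}" for p s
  proof -
    let ?u = "\<theta> (?l p s)"
    have u: "?u \<notin> K2" using disj inK1[OF p s] by auto
    have "integral {0..1} (G p q s) = F S1 p s o\<^sub>L X o\<^sub>L
        cm (contour_integral (linepath (fst q) (snd q)) (\<lambda>w. m2 w / (w - ?u)))" if q: "q \<in> E2" for q
    proof -
      have "continuous_on (closed_segment (fst q) (snd q)) (\<lambda>w. m2 w / (w - ?u))"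
        using SC2 q u unfolding spectral_contour_def
        by (intro continuous_intros) (metis prod.collapse, metis prod.collapse right_minus_eq subsetD)
      note i = integral_cm_linepath[OF this]
      have "(\<lambda>t. cm (m2 (?l q t) / (?l q t - ?u) * ?d q)) integrable_on {0..1}"
        by (intro icont bounded_linear.continuous_on[OF bounded_linear_cm]
            continuous_on_mult contm2 p q s continuous_on_const)
      from integral_blinfun_compose_left[OF this] show ?thesis
        unfolding G_def i .
    qed
    then have "(\<Sum>q\<in>E2. integral {0..1} (G p q s)) = F S1 p s o\<^sub>L X o\<^sub>L
        cm (\<Sum>q\<in>E2. contour_integral (linepath (fst q) (snd q)) (\<lambda>w. m2 w / (w - ?u)))"
      by (simp add: linear_sum[OF cm_linear] blinfun_comp.sum_right)
    then show ?thesis using SC2 u by (simp add: spectral_contour_def case_prod_unfold cm_0)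
  qed
  \<comment> \<open>Now the pole is \<theta> w, which is outside \<open>K1\<close> because \<theta>
    is an involution.\<close>
  have H0: "(\<Sum>p\<in>E1. integral {0..1} (\<lambda>s. H p q s t)) = 0" if q: "q \<in> E2" and t: "t \<in> {0..1}" for q t
  proof -
    let ?u = "\<theta> (?l q t)"
    have u: "?u \<notin> K1" using disj inK2[OF q t] \<theta>(3) by (metis IntI empty_iff image_eqI)
    have "integral {0..1} (\<lambda>s. H p q s t) = X o\<^sub>L
        cm (\<theta> (contour_integral (linepath (fst p) (snd p)) (\<lambda>w. m1 w / (w - ?u)))) o\<^sub>L F S2 q t" if p: "p \<in> E1" for p
    proof -
      have c: "continuous_on (closed_segment (fst p) (snd p)) (\<lambda>w. m1 w / (w - ?u))"
        using SC1 p u unfolding spectral_contour_def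
        by (intro continuous_intros) (metis prod.collapse, metis prod.collapse right_minus_eq subsetD)
      then have "((\<lambda>w. m1 w / (w - ?u)) has_contour_integral
          contour_integral (linepath (fst p) (snd p)) (\<lambda>w. m1 w / (w - ?u))) (linepath (fst p) (snd p))"
        by (intro has_contour_integral_integral contour_integrable_continuous_linepath)
      then have "((\<lambda>s. m1 (?l p s) / (?l p s - ?u) * ?d p) has_integral
          contour_integral (linepath (fst p) (snd p)) (\<lambda>w. m1 w / (w - ?u))) {0..1}"
        by (simp only: has_contour_integral_linepath)
      moreover have "bounded_linear (\<lambda>x. X o\<^sub>L cm (\<theta> x) o\<^sub>L F S2 q t)"
        by (intro bounded_linear_compose[OF blinfun_comp.bounded_linear_left]
            bounded_linear_compose[OF blinfun_comp.bounded_linear_right]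
            bounded_linear_compose[OF bounded_linear_cm] \<theta>(1))
      ultimately show ?thesis
        using integral_unique[OF has_integral_linear] unfolding H_def o_def by blast
    qed
    then have "(\<Sum>p\<in>E1. integral {0..1} (\<lambda>s. H p q s t)) = X o\<^sub>L
        cm (\<theta> (\<Sum>p\<in>E1. contour_integral (linepath (fst p) (snd p)) (\<lambda>w. m1 w / (w - ?u)))) o\<^sub>L F S2 q t"
      by (simp add: linear_sum[OF cm_linear] linear_sum[OF bounded_linear.linear[OF \<theta>(1)]]
          blinfun_comp.sum_right blinfun_comp.sum_left)
    then show ?thesis using SC1 u
      by (simp add: spectral_contour_def case_prod_unfold cm_0 linear_0[OF bounded_linear.linear[OF \<theta>(1)]])
  qed
  have "opint E1 S1 o\<^sub>L X o\<^sub>L opint E2 S2 = (\<Sum>p\<in>E1. integral {0..1} (\<lambda>s. \<Sum>q\<in>E2. integral {0..1} (H p q s)))"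
    unfolding op1 blinfun_comp.sum_left
  proof (rule sum.cong[OF refl])
    fix p assume p: "p \<in> E1"
    have "integral {0..1} (F S1 p) o\<^sub>L X o\<^sub>L opint E2 S2 = integral {0..1} (\<lambda>s. F S1 p s o\<^sub>L X o\<^sub>L opint E2 S2)"
      unfolding blinfun_compose_assoc
      by (rule integral_blinfun_compose_right[OF icont, symmetric]) (rule contF1[OF p])
    also have "\<dots> = integral {0..1} (\<lambda>s. \<Sum>q\<in>E2. integral {0..1} (H p q s))"
    proof (rule integral_cong)
      fix s :: real assume s: "s \<in> {0..1}"
      have "F S1 p s o\<^sub>L X o\<^sub>L opint E2 S2 = (\<Sum>q\<in>E2. integral {0..1} (\<lambda>t. F S1 p s o\<^sub>L X o\<^sub>L F S2 q t))"
        unfolding op2 blinfun_comp.sum_right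
        by (intro sum.cong refl integral_blinfun_compose_left[symmetric] icont contF2)
      also have "\<dots> = (\<Sum>q\<in>E2. integral {0..1} (\<lambda>t. G p q s t + H p q s t))"
        by (intro sum.cong refl integral_cong split p s)
      also have "\<dots> = (\<Sum>q\<in>E2. integral {0..1} (G p q s) + integral {0..1} (H p q s))"
        by (intro sum.cong refl integral_add icont contG contHt p s)
      also have "\<dots> = (\<Sum>q\<in>E2. integral {0..1} (H p q s))"
        using G0[OF p s] by (simp add: sum.distrib)
      finally show "F S1 p s o\<^sub>L X o\<^sub>L opint E2 S2 = (\<Sum>q\<in>E2. integral {0..1} (H p q s))" .
    qed
    finally show "integral {0..1} (F S1 p) o\<^sub>L X o\<^sub>L opint E2 S2 =
        integral {0..1} (\<lambda>s. \<Sum>q\<in>E2. integral {0..1} (H p q s))" .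
  qed
  also have "\<dots> = (\<Sum>p\<in>E1. \<Sum>q\<in>E2. integral {0..1} (\<lambda>s. integral {0..1} (H p q s)))"
    by (intro sum.cong refl integral_sum fin icont contHi)
  also have "\<dots> = (\<Sum>p\<in>E1. \<Sum>q\<in>E2. integral {0..1} (\<lambda>t. integral {0..1} (\<lambda>s. H p q s t)))"
    by (intro sum.cong refl swapH)
  also have "\<dots> = (\<Sum>q\<in>E2. \<Sum>p\<in>E1. integral {0..1} (\<lambda>t. integral {0..1} (\<lambda>s. H p q s t)))"
    by (rule sum.swap)
  also have "\<dots> = (\<Sum>q\<in>E2. integral {0..1} (\<lambda>t. \<Sum>p\<in>E1. integral {0..1} (\<lambda>s. H p q s t)))"
    by (intro sum.cong refl integral_sum[symmetric] fin icont contHi')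
  also have "\<dots> = (\<Sum>q\<in>E2. integral {0..1} (\<lambda>t::real. 0))"
    by (intro sum.cong refl integral_cong H0)
  finally show ?thesis by simp
qed

end

section \<open>Rhombi\<close>

text \<open>For positive \<tau>, the closed rhombus with vertices 1, -1, i \<tau> and -i \<tau>. It
  is written as the intersection of the sectors of slope \<tau> opening at -1 and at 1, so that a
  sector estimate applies to both 1 + w and 1 - w.\<close>

definition rhombus :: "real \<Rightarrow> complex set" where
  "rhombus \<tau> = {w. \<bar>Im w\<bar> \<le> \<tau> * (1 + Re w) \<and> \<bar>Im w\<bar> \<le> \<tau> * (1 - Re w)}"

lemma rhombus_eq:
  "rhombus \<tau> = {w. Im w - \<tau> * Re w \<le> \<tau>} \<inter> {w. - Im w - \<tau> * Re w \<le> \<tau>} \<inter>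
     {w. Im w + \<tau> * Re w \<le> \<tau>} \<inter> {w. - Im w + \<tau> * Re w \<le> \<tau>}"
  by (auto simp: rhombus_def abs_le_iff algebra_simps)

lemma linear_Re_Im: "linear (\<lambda>w. a * Im w + b * Re w)"
  by (rule linearI) (auto simp: algebra_simps)

lemma convex_halfplane: "convex {w. a * Im w + b * Re w \<le> c}"
  using convex_linear_vimage[OF linear_Re_Im[of a b], of "{..c}"] by (simp add: vimage_def)

lemma convex_rhombus: "convex (rhombus \<tau>)"
  unfolding rhombus_eq
  using convex_halfplane[of 1 "-\<tau>" \<tau>] convex_halfplane[of "-1" "-\<tau>" \<tau>]
    convex_halfplane[of 1 "\<tau>" \<tau>] convex_halfplane[of "-1" "\<tau>" \<tau>]
  by (intro convex_Int) auto

lemma rhombus_interiorI: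
  assumes "\<bar>Im w\<bar> < \<tau> * (1 + Re w)" "\<bar>Im w\<bar> < \<tau> * (1 - Re w)"
  shows "w \<in> interior (rhombus \<tau>)"
proof (rule interiorI)
  show "open {w. \<bar>Im w\<bar> < \<tau> * (1 + Re w) \<and> \<bar>Im w\<bar> < \<tau> * (1 - Re w)}"
    by (intro open_Collect_conj open_Collect_less continuous_intros)
qed (use assms in \<open>auto simp: rhombus_def\<close>)

lemma rhombus_cmod_le:
  assumes "w \<in> rhombus \<tau>" "0 < \<tau>" "\<tau> \<le> 1"
  shows "cmod w \<le> 2"
proof -
  have "0 \<le> \<tau> * (1 + Re w)" "0 \<le> \<tau> * (1 - Re w)" using assms(1) by (auto simp: rhombus_def)
  then have Re: "\<bar>Re w\<bar> \<le> 1" using assms(2) by (auto simp: zero_le_mult_iff abs_le_iff)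
  have "2 * \<bar>Im w\<bar> \<le> 2 * \<tau>" using assms(1) by (auto simp: rhombus_def algebra_simps)
  then show ?thesis using Re assms(3) cmod_le[of w] by linarith
qed

section \<open>A rapidly decaying holomorphic function on a rhombus\<close>

text \<open>At the vertices the formula alone would give a nonzero value by the convention 1 / 0 =
  0. For positive \<open>n\<close>, zero is the continuous extension from within a thin
  rhombus.\<close>

definition decay :: "nat \<Rightarrow> complex \<Rightarrow> complex" where
  "decay n w = (if w = 1 \<or> w = -1 then 0 else exp (- (1 / (1 + w) ^ n) - 1 / (1 - w) ^ n))"

text \<open>By homogeneity in \<open>Re w\<close> only the slope y = Im w / Re w matters. At y = 0
  the real part equals the modulus, so by continuity it exceeds half of the modulus for small
  y.\<close>

lemma ex_thin_sector:
  obtains \<tau> :: real where "0 < \<tau>" "\<tau> \<le> 1"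
    "\<And>w. 0 < Re w \<Longrightarrow> \<bar>Im w\<bar> \<le> \<tau> * Re w \<Longrightarrow> 1 / (2 * cmod w ^ n) \<le> Re (1 / w ^ n)"
proof -
  let ?f = "\<lambda>y::real. Re (1 / (1 + \<i> * of_real y) ^ n) - cmod (1 / (1 + \<i> * of_real y) ^ n) / 2"
  have ne: "1 + \<i> * of_real y \<noteq> 0" for y :: real by (simp add: complex_eq_iff)
  have "isCont ?f 0" by (intro continuous_intros) simp_all
  then have "\<forall>\<^sub>F y in at 0. ?f y > 0"
    by (intro order_tendstoD(1)[of _ "?f 0"]) (auto simp: isCont_def)
  then obtain r where r: "r > 0" "\<And>y. y \<noteq> 0 \<Longrightarrow> \<bar>y\<bar> < r \<Longrightarrow> ?f y > 0"
    unfolding eventually_at by (auto simp: dist_real_def)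
  show thesis
  proof (rule that[of "min 1 (r / 2)"])
    fix w assume w: "0 < Re w" "\<bar>Im w\<bar> \<le> min 1 (r / 2) * Re w"
    define y where "y = Im w / Re w"
    have "\<bar>y\<bar> \<le> min 1 (r / 2)" unfolding y_def abs_divide abs_of_pos[OF w(1)] pos_divide_le_eq[OF w(1)] by (rule w(2))
    then have "\<bar>y\<bar> < r" using r(1) by auto
    then have f: "?f y > 0" using r(2)[of y] by (cases "y = 0") simp_all
    have wy: "w = of_real (Re w) * (1 + \<i> * of_real y)"
      using w(1) by (simp add: y_def complex_eq_iff)
    define u where "u = 1 / (1 + \<i> * of_real y) ^ n"
    define a where "a = 1 / Re w ^ n"
    have "1 / w ^ n = of_real a * u"
      by (subst wy) (simp add: power_mult_distrib u_def a_def)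
    moreover have "0 < a" "cmod u / 2 \<le> Re u" using w(1) f by (simp_all add: a_def u_def)
    ultimately have "cmod (1 / w ^ n) / 2 \<le> Re (1 / w ^ n)"
      by (simp only: norm_mult) simp
    then show "1 / (2 * cmod w ^ n) \<le> Re (1 / w ^ n)" by (simp add: norm_divide norm_power)
  qed (use r in auto)
qed

definition thin_sector :: "nat \<Rightarrow> real \<Rightarrow> bool" where
  "thin_sector n \<tau> \<longleftrightarrow> 0 < \<tau> \<and> \<tau> \<le> 1 \<and>
     (\<forall>w. 0 < Re w \<longrightarrow> \<bar>Im w\<bar> \<le> \<tau> * Re w \<longrightarrow> 1 / (2 * cmod w ^ n) \<le> Re (1 / w ^ n))"

lemma rhombus_Re_pos:
  assumes "w \<in> rhombus \<tau>" "0 < \<tau>" "w \<noteq> 1" "w \<noteq> -1"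
  shows "0 < Re (1 + w)" "0 < Re (1 - w)"
proof -
  have a: "0 \<le> \<tau> * (1 + Re w)" "0 \<le> \<tau> * (1 - Re w)" using assms(1) by (auto simp: rhombus_def)
  have "Re w \<noteq> -1" "Re w \<noteq> 1" using assms by (auto simp: rhombus_def complex_eq_iff)
  then show "0 < Re (1 + w)" "0 < Re (1 - w)"
    using a assms(2) by (auto simp: zero_le_mult_iff)
qed

text \<open>Both terms subtracted in the exponent have positive real part, so either one alone
  bounds the modulus.\<close>

lemma norm_decay_le:
  assumes "thin_sector n \<tau>" "w \<in> rhombus \<tau>" "w \<noteq> 1" "w \<noteq> -1"
  shows "cmod (decay n w) \<le> exp (- (1 / (2 * cmod (1 + w) ^ n)))"
    "cmod (decay n w) \<le> exp (- (1 / (2 * cmod (1 - w) ^ n)))"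
proof -
  have "0 < \<tau>" using assms by (simp add: thin_sector_def)
  note pos = rhombus_Re_pos[OF assms(2) this assms(3,4)]
  have 1: "1 / (2 * cmod (1 + w) ^ n) \<le> Re (1 / (1 + w) ^ n)"
    "1 / (2 * cmod (1 - w) ^ n) \<le> Re (1 / (1 - w) ^ n)"
    using assms(1,2) pos unfolding thin_sector_def rhombus_def by auto
  moreover have "0 \<le> 1 / (2 * cmod (1 + w) ^ n)" "0 \<le> 1 / (2 * cmod (1 - w) ^ n)" by auto
  moreover have "cmod (decay n w) = exp (- Re (1 / (1 + w) ^ n) - Re (1 / (1 - w) ^ n))"
    using assms(3,4) by (simp add: decay_def)
  ultimately show "cmod (decay n w) \<le> exp (- (1 / (2 * cmod (1 + w) ^ n)))"
    "cmod (decay n w) \<le> exp (- (1 / (2 * cmod (1 - w) ^ n)))" by (simp_all only: exp_le_cancel_iff)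
qed

lemma decay_differentiable:
  assumes "w \<noteq> 1" "w \<noteq> -1"
  shows "decay n field_differentiable at w"
proof -
  let ?e = "\<lambda>w. exp (- (1 / (1 + w) ^ n) - 1 / (1 - w) ^ n)"
  have "1 + w \<noteq> 0" using assms(2) by (metis add_eq_0_iff minus_minus)
  then have "?e holomorphic_on - {1, -1}"
    by (intro holomorphic_intros) (auto simp: add_eq_0_iff equation_minus_iff)
  then have "decay n holomorphic_on - {1, -1}"
    by (rule holomorphic_transform) (auto simp: decay_def)
  then show ?thesis
    using assms by (intro holomorphic_on_imp_differentiable_at[of _ "- {1, -1}"]) auto
qed

text \<open>The factor \<open>exp (K / r\<^sup>k)\<close> is the resolvent growth that the decay of order \<open>k + 1\<close> absorbs.\<close>

lemma tendsto_exp_growth_decay: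
  fixes K c :: real
  assumes "0 < c"
  shows "((\<lambda>r. exp (K / r ^ k) * exp (- (c / r ^ Suc k))) \<longlongrightarrow> 0) (at_right 0)"
proof -
  \<comment> \<open>Substitute x = 1 / r: the exponent becomes -x^k (c x - K), which tends to minus
    infinity for any \<open>K\<close>.\<close>
  have "filterlim (\<lambda>x::real. x ^ k * (c * x - K)) at_top at_top"
  proof -
    have "filterlim (\<lambda>x. - K + c * x) at_top at_top"
      by (intro filterlim_tendsto_add_at_top[OF tendsto_const]
          filterlim_tendsto_pos_mult_at_top[OF tendsto_const assms filterlim_ident])
    then have "filterlim (\<lambda>x. c * x - K) at_top at_top" by simp
    then show ?thesis
      by (cases "k = 0") (auto intro!: filterlim_at_top_mult_at_top filterlim_pow_at_top filterlim_ident)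
  qed
  then have "((\<lambda>x. exp (- (x ^ k * (c * x - K)))) \<longlongrightarrow> 0) at_top"
    by (intro filterlim_compose[OF exp_at_bot] filterlim_compose[OF filterlim_uminus_at_bot_at_top])
  then have "((\<lambda>x. exp (- (inverse x ^ k * (c * inverse x - K)))) \<longlongrightarrow> 0) (at_right 0)"
    by (rule filterlim_compose[OF _ filterlim_inverse_at_top_right])
  moreover have "- (inverse x ^ k * (c * inverse x - K)) = K / x ^ k + - (c / x ^ Suc k)" for x :: real
    by (simp add: divide_inverse power_inverse algebra_simps)
  then have "exp (- (inverse x ^ k * (c * inverse x - K))) = exp (K / x ^ k) * exp (- (c / x ^ Suc k))" for x :: real
    by (simp only: exp_add)
  ultimately show ?thesis by simp
qed

text \<open>Here \<open>p\<close> is the vertex approached. A general \<open>K\<close> serves the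
  resolvent growth, and \<open>K = 0\<close> gives the continuity of \<open>decay\<close> at the
  vertices.\<close>

lemma decay_tendsto_0:
  assumes "thin_sector (Suc k) \<tau>" "p = 1 \<or> p = -1"
  shows "((\<lambda>w. exp (K / cmod (w - p) ^ k) * cmod (decay (Suc k) w)) \<longlongrightarrow> 0) (at p within rhombus \<tau>)"
proof (rule Lim_null_comparison)
  let ?g = "\<lambda>w. exp (K / cmod (w - p) ^ k) * exp (- ((1/2) / cmod (w - p) ^ Suc k))"
  have "filterlim (\<lambda>w. cmod (w - p)) (at_right 0) (at p within rhombus \<tau>)"
    unfolding filterlim_at by (auto intro!: tendsto_eq_intros simp: eventually_at_filter)
  from filterlim_compose[OF tendsto_exp_growth_decay[of "1/2" K k] this]
  show "(?g \<longlongrightarrow> 0) (at p within rhombus \<tau>)" by simp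
  have "\<forall>\<^sub>F w in at p within rhombus \<tau>. w \<in> rhombus \<tau> \<and> w \<noteq> p \<and> dist w p < 1"
    using eventually_at[of "\<lambda>w. w \<in> rhombus \<tau> \<and> w \<noteq> p \<and> dist w p < 1"] zero_less_one by blast
  then show "\<forall>\<^sub>F w in at p within rhombus \<tau>. norm (exp (K / cmod (w - p) ^ k) * cmod (decay (Suc k) w)) \<le> ?g w"
  proof eventually_elim
    case (elim w)
    have w: "w \<noteq> 1" "w \<noteq> -1" using elim assms(2) by (auto simp: dist_norm)
    have "cmod (decay (Suc k) w) \<le> exp (- ((1/2) / cmod (w - p) ^ Suc k))"
      using norm_decay_le[OF assms(1) _ w] assms(2) elim
      by (auto simp: norm_minus_commute add.commute)
    then show ?case by (simp add: mult_left_mono)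
  qed
qed

lemma continuous_on_decay:
  assumes "thin_sector (Suc k) \<tau>"
  shows "continuous_on (rhombus \<tau>) (decay (Suc k))"
  unfolding continuous_on_eq_continuous_within
proof
  fix w assume "w \<in> rhombus \<tau>"
  show "continuous (at w within rhombus \<tau>) (decay (Suc k))"
  proof (cases "w = 1 \<or> w = -1")
    case True
    have "((\<lambda>w. cmod (decay (Suc k) w)) \<longlongrightarrow> 0) (at w within rhombus \<tau>)"
      using decay_tendsto_0[OF assms True, of 0] by simp
    then have "(decay (Suc k) \<longlongrightarrow> 0) (at w within rhombus \<tau>)" by (rule tendsto_norm_zero_cancel)
    then show ?thesis using True by (simp add: continuous_within decay_def)
  next
    case False
    then have "isCont (decay (Suc k)) w"
      by (intro field_differentiable_imp_continuous_at decay_differentiable) auto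
    then show ?thesis by (rule continuous_at_imp_continuous_at_within)
  qed
qed

section \<open>Chords and tangents of a smooth arc\<close>

text \<open>
  In the coordinates \<open>z = c + d w\<close> a short chord of the arc becomes the segment from \<open>-1\<close> to
  \<open>1\<close>, and near it the arc is nearly horizontal.
\<close>

lemma arc_chord_cone:
  fixes \<gamma> \<gamma>' :: "real \<Rightarrow> complex" and \<sigma> :: "complex set"
  assumes t0: "t0 \<in> {x<..<y}" and J: "{x<..<y} \<subseteq> J"
    and der: "\<And>t. t \<in> {x<..<y} \<Longrightarrow> (\<gamma> has_vector_derivative \<gamma>' t) (at t)"
    and cont: "continuous_on {x<..<y} \<gamma>'" and nz: "\<gamma>' t0 \<noteq> 0"
    and inj: "\<And>e. e > 0 \<Longrightarrow> \<exists>d>0. \<forall>s\<in>J. dist (\<gamma> s) (\<gamma> t0) < d \<longrightarrow> dist s t0 < e"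
    and \<sigma>: "\<gamma> ` J \<subseteq> \<sigma>" "r > 0" "\<sigma> \<inter> ball (\<gamma> t0) r \<subseteq> \<gamma> ` J"
    and \<tau>: "0 < \<tau>" "\<tau> \<le> 1" and \<rho>: "\<rho> > 0"
  obtains c d \<eta> l where "d \<noteq> 0" "0 < \<eta>" "\<eta> \<le> \<rho>"
    "\<And>w. w \<in> rhombus \<tau> \<Longrightarrow> c + d * w \<in> ball (\<gamma> t0) \<eta>"
    "c - d \<in> \<gamma> ` J" "c + d \<in> \<gamma> ` J" "c + d * l \<in> \<gamma> ` J"
    "\<bar>Im l\<bar> < \<tau> * (1 + Re l)" "\<bar>Im l\<bar> < \<tau> * (1 - Re l)"
    "\<And>z1 z2. z1 \<in> \<sigma> \<inter> ball (\<gamma> t0) \<eta> \<Longrightarrow> z2 \<in> \<sigma> \<inter> ball (\<gamma> t0) \<eta> \<Longrightarrow>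
       \<bar>Im ((z1 - z2) / d)\<bar> \<le> \<tau> / 2 * \<bar>Re ((z1 - z2) / d)\<bar>"
proof -
  define D where "D = \<gamma>' t0"
  have D: "cmod D > 0" using nz by (simp add: D_def)
  \<comment> \<open>The tolerance \<tau>/16 is spent twice in \<open>quot\<close>, once on the chord
    and once on \<open>d\<close>, and doubled by |d| >= \<delta> |D| / 2. The resulting \<tau>/4
    leaves room for the final slope \<tau>/2.\<close>
  have pos: "\<tau> / 16 * cmod D > 0" using \<tau> D by simp
  have "isCont \<gamma>' t0" using cont t0 by (simp add: continuous_on_eq_continuous_at)
  then have "(\<gamma>' \<longlongrightarrow> D) (at t0)" by (simp add: isCont_def D_def)
  from tendstoD[OF this pos] obtain e0 where e0: "e0 > 0" "\<And>t. t \<noteq> t0 \<Longrightarrow> dist t t0 < e0 \<Longrightarrow> dist (\<gamma>' t) D < \<tau> / 16 * cmod D"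
    unfolding eventually_at by auto
  obtain e1 where e1: "e1 > 0" "ball t0 e1 \<subseteq> {x<..<y}" 
    by (rule openE[OF open_greaterThanLessThan t0])
  define \<epsilon> where "\<epsilon> = min e0 e1"
  have \<epsilon>: "\<epsilon> > 0" using e0 e1 by (simp add: \<epsilon>_def)
  have sub: "ball t0 \<epsilon> \<subseteq> {x<..<y}"
    using subset_ball[of \<epsilon> e1 t0] e1(2) unfolding \<epsilon>_def by (meson min.cobounded2 order_trans)
  have lin: "cmod (\<gamma> s1 - \<gamma> s2 - of_real (s1 - s2) * D) \<le> \<bar>s1 - s2\<bar> * (\<tau> / 16 * cmod D)"
    if "s1 \<in> ball t0 \<epsilon>" "s2 \<in> ball t0 \<epsilon>" for s1 s2
  proof -
    have "norm (\<gamma> s1 - \<gamma> s2 - (s1 - s2) *\<^sub>R \<gamma>' t0) \<le> norm (s1 - s2) * (\<tau> / 16 * cmod D)"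
    proof (rule vector_differentiable_bound_linearization[where S = "ball t0 \<epsilon>" and f = \<gamma>
          and f' = \<gamma>' and ?x0.0 = t0 and a = s2 and b = s1])
      fix t assume t: "t \<in> ball t0 \<epsilon>"
      then show "(\<gamma> has_vector_derivative \<gamma>' t) (at t within ball t0 \<epsilon>)"
        using sub by (blast intro: has_vector_derivative_at_within der)
      show "norm (\<gamma>' t - \<gamma>' t0) \<le> \<tau> / 16 * cmod D"
        using e0(2)[of t] t pos by (cases "t = t0") (auto simp: \<epsilon>_def dist_commute[of t0 t] D_def dist_norm[of "\<gamma>' t"])
    next
      show "closed_segment s2 s1 \<subseteq> ball t0 \<epsilon>"
        by (rule closed_segment_subset[OF that(2,1) convex_ball])
    qed (use \<epsilon> in auto)
    then show ?thesis by (simp add: D_def scaleR_conv_of_real)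
  qed
  \<comment> \<open>A point of the arc close to \<open>\<gamma> t0\<close> has a parameter close to
    \<open>t0\<close>: the arc cannot return there from elsewhere.\<close>
  obtain \<eta>0 where \<eta>0: "\<eta>0 > 0" "\<And>s. s \<in> J \<Longrightarrow> dist (\<gamma> s) (\<gamma> t0) < \<eta>0 \<Longrightarrow> dist s t0 < \<epsilon>"
    using inj[OF \<epsilon>] by blast
  define \<eta> where "\<eta> = min \<rho> (min r \<eta>0)"
  have \<eta>: "\<eta> > 0" using \<rho> \<sigma>(2) \<eta>0 by (simp add: \<eta>_def)
  \<comment> \<open>The modulus of \<open>d\<close> will be at most 2 \<delta> |D|, and a point of
    the rhombus is at most 4 away from \<open>l\<close>; so the image of the rhombus stays within 8
    \<delta> |D| < \<eta> of \<open>\<gamma> t0\<close>. The bound \<epsilon>/2 keeps the end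
    parameters in the linearized range.\<close>
  define \<delta> where "\<delta> = min (\<epsilon> / 2) (\<eta> / (16 * cmod D))"
  have \<delta>: "\<delta> > 0" "\<delta> < \<epsilon>" "\<delta> * (16 * cmod D) \<le> \<eta>"
  proof -
    show "\<delta> > 0" "\<delta> < \<epsilon>" using \<epsilon> \<eta> D by (auto simp: \<delta>_def)
    have "\<delta> \<le> \<eta> / (16 * cmod D)" by (simp add: \<delta>_def)
    then show "\<delta> * (16 * cmod D) \<le> \<eta>" using D by (simp add: pos_le_divide_eq)
  qed
  have in\<epsilon>: "t0 + \<delta> \<in> ball t0 \<epsilon>" "t0 - \<delta> \<in> ball t0 \<epsilon>" "t0 \<in> ball t0 \<epsilon>"
    using \<delta> by (auto simp: dist_real_def)
  have inJ: "s \<in> J" if "s \<in> ball t0 \<epsilon>" for s using that sub J by blast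
  define c where "c = (\<gamma> (t0 + \<delta>) + \<gamma> (t0 - \<delta>)) / 2"
  define d where "d = (\<gamma> (t0 + \<delta>) - \<gamma> (t0 - \<delta>)) / 2"
  have ends: "c + d = \<gamma> (t0 + \<delta>)" "c - d = \<gamma> (t0 - \<delta>)" by (simp_all add: c_def d_def field_simps)
  have dD: "cmod (d - of_real \<delta> * D) \<le> \<delta> * (\<tau> / 16 * cmod D)"
  proof -
    have "cmod (\<gamma> (t0 + \<delta>) - \<gamma> (t0 - \<delta>) - of_real (2 * \<delta>) * D) \<le> 2 * \<delta> * (\<tau> / 16 * cmod D)"
      using lin[OF in\<epsilon>(1,2)] \<delta>(1) by simp
    moreover have "\<gamma> (t0 + \<delta>) - \<gamma> (t0 - \<delta>) - of_real (2 * \<delta>) * D = 2 * (d - of_real \<delta> * D)"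
      by (simp add: d_def algebra_simps)
    ultimately have "cmod (2 * (d - of_real \<delta> * D)) \<le> 2 * \<delta> * (\<tau> / 16 * cmod D)" by (simp only:)
    then show ?thesis by (simp only: norm_mult) simp
  qed
  have "cmod (of_real \<delta> * D) = \<delta> * cmod D" using \<delta> by (simp add: norm_mult)
  then have d_bounds: "cmod d \<le> \<delta> * cmod D + \<delta> * (\<tau> / 16 * cmod D)" "\<delta> * cmod D - \<delta> * (\<tau> / 16 * cmod D) \<le> cmod d"
    using dD norm_triangle_ineq2[of d "of_real \<delta> * D"] norm_triangle_ineq3[of "of_real \<delta> * D" d]
    by (auto simp: norm_minus_commute)
  have "\<delta> * (\<tau> / 16 * cmod D) \<le> \<delta> * (1 / 16 * cmod D)"
    using \<tau> \<delta> D by (intro mult_left_mono mult_right_mono) auto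
  then have d_le: "cmod d \<le> 2 * (\<delta> * cmod D)" and d_ge: "\<delta> * cmod D / 2 \<le> cmod d"
    using d_bounds mult_pos_pos[OF \<delta>(1) D] by linarith+
  have d_pos: "cmod d > 0" using d_ge \<delta>(1) D by (meson half_gt_zero less_le_trans mult_pos_pos)
  \<comment> \<open>In the coordinate w, differences along the arc are almost the real numbers (s1 -
    s2) / \<delta>, because \<open>d\<close> itself is nearly \<delta> D.\<close>
  have quot: "cmod ((\<gamma> s1 - \<gamma> s2) / d - of_real ((s1 - s2) / \<delta>)) \<le> \<tau> / 4 * (\<bar>s1 - s2\<bar> / \<delta>)"
    if s: "s1 \<in> ball t0 \<epsilon>" "s2 \<in> ball t0 \<epsilon>" for s1 s2
  proof -
    have "(\<gamma> s1 - \<gamma> s2) / d - of_real ((s1 - s2) / \<delta>) =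
        (of_real \<delta> * (\<gamma> s1 - \<gamma> s2 - of_real (s1 - s2) * D) - of_real (s1 - s2) * (d - of_real \<delta> * D)) / (d * of_real \<delta>)"
      using d_pos \<delta> by (auto simp: field_simps)
    also have "cmod \<dots> \<le> (\<delta> * (\<bar>s1 - s2\<bar> * (\<tau> / 16 * cmod D)) + \<bar>s1 - s2\<bar> * (\<delta> * (\<tau> / 16 * cmod D))) / (cmod d * \<delta>)"
      unfolding norm_divide norm_mult
    proof (rule frac_le)
      have "cmod (of_real \<delta> * (\<gamma> s1 - \<gamma> s2 - of_real (s1 - s2) * D)) \<le> \<delta> * (\<bar>s1 - s2\<bar> * (\<tau> / 16 * cmod D))"
        using lin[OF s] \<delta>(1) unfolding norm_mult by (simp add: mult_left_mono)
      moreover have "cmod (of_real (s1 - s2) * (d - of_real \<delta> * D)) \<le> \<bar>s1 - s2\<bar> * (\<delta> * (\<tau> / 16 * cmod D))"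
        using dD unfolding norm_mult norm_of_real by (intro mult_left_mono) auto
      ultimately show "cmod (of_real \<delta> * (\<gamma> s1 - \<gamma> s2 - of_real (s1 - s2) * D) - of_real (s1 - s2) * (d - of_real \<delta> * D))
          \<le> \<delta> * (\<bar>s1 - s2\<bar> * (\<tau> / 16 * cmod D)) + \<bar>s1 - s2\<bar> * (\<delta> * (\<tau> / 16 * cmod D))"
        by (rule norm_triangle_le_diff[OF add_mono])
    qed (use d_pos \<delta> \<tau> in auto)
    also have "\<dots> = (\<bar>s1 - s2\<bar> * \<tau> / 8) * (cmod D / cmod d)"
      using \<delta>(1) by (simp add: field_simps)
    also have "\<dots> \<le> (\<bar>s1 - s2\<bar> * \<tau> / 8) * (2 / \<delta>)"
      using d_ge d_pos \<delta>(1) \<tau> by (intro mult_left_mono) (auto simp: field_simps)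
    finally show ?thesis by (simp add: field_simps)
  qed
  have ReIm: "\<bar>Im ((\<gamma> s1 - \<gamma> s2) / d)\<bar> \<le> \<tau> / 4 * (\<bar>s1 - s2\<bar> / \<delta>)"
    "\<bar>Re ((\<gamma> s1 - \<gamma> s2) / d) - (s1 - s2) / \<delta>\<bar> \<le> \<tau> / 4 * (\<bar>s1 - s2\<bar> / \<delta>)"
    if s: "s1 \<in> ball t0 \<epsilon>" "s2 \<in> ball t0 \<epsilon>" for s1 s2
    using quot[OF s] abs_Im_le_cmod[of "(\<gamma> s1 - \<gamma> s2) / d - of_real ((s1 - s2) / \<delta>)"]
      abs_Re_le_cmod[of "(\<gamma> s1 - \<gamma> s2) / d - of_real ((s1 - s2) / \<delta>)"] by auto
  \<comment> \<open>The coordinate of \<open>\<gamma> t0\<close>, whose parameter is midway between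
    those of the vertices, so that it is close to 0; it is the spectral point inside the
    rhombus.\<close>
  define l where "l = (\<gamma> t0 - c) / d"
  have cl: "c + d * l = \<gamma> t0" using d_pos by (simp add: l_def)
  have "1 + l = (\<gamma> t0 - \<gamma> (t0 - \<delta>)) / d" "1 - l = (\<gamma> (t0 + \<delta>) - \<gamma> t0) / d"
    using d_pos unfolding ends[symmetric] l_def by (auto simp: field_simps)
  with ReIm[OF in\<epsilon>(3,2)] ReIm[OF in\<epsilon>(1,3)]
  have l: "\<bar>Im (1 + l)\<bar> \<le> \<tau> / 4" "\<bar>Re (1 + l) - 1\<bar> \<le> \<tau> / 4" "\<bar>Re (1 - l) - 1\<bar> \<le> \<tau> / 4"
    using \<delta>(1) by auto
  have tl: "\<tau> * (3/4) \<le> \<tau> * (1 + Re l)" "\<tau> * (3/4) \<le> \<tau> * (1 - Re l)"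
    using l \<tau> by (auto intro!: mult_left_mono)
  have "\<bar>Im l\<bar> \<le> \<tau> / 4" using l(1) by simp
  then have lt: "\<bar>Im l\<bar> < \<tau> * (1 + Re l)" "\<bar>Im l\<bar> < \<tau> * (1 - Re l)"
    using tl \<tau>(1) by linarith+
  have cone: "\<bar>Im ((z1 - z2) / d)\<bar> \<le> \<tau> / 2 * \<bar>Re ((z1 - z2) / d)\<bar>"
    if z: "z1 \<in> \<sigma> \<inter> ball (\<gamma> t0) \<eta>" "z2 \<in> \<sigma> \<inter> ball (\<gamma> t0) \<eta>" for z1 z2
  proof -
    have "\<exists>s\<in>ball t0 \<epsilon>. z = \<gamma> s" if "z \<in> \<sigma> \<inter> ball (\<gamma> t0) \<eta>" for z
    proof -
      from that \<sigma>(3) have "z \<in> \<gamma> ` J" by (auto simp: \<eta>_def)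
      then show ?thesis using \<eta>0(2) that by (auto simp: \<eta>_def dist_commute)
    qed
    with z obtain s1 s2 where s: "s1 \<in> ball t0 \<epsilon>" "s2 \<in> ball t0 \<epsilon>" "z1 = \<gamma> s1" "z2 = \<gamma> s2" by metis
    let ?A = "\<bar>s1 - s2\<bar> / \<delta>"
    have "\<bar>(s1 - s2) / \<delta>\<bar> = ?A" using \<delta>(1) by (simp add: abs_divide)
    then have "?A - \<tau> / 4 * ?A \<le> \<bar>Re ((z1 - z2) / d)\<bar>" 
      using ReIm(2)[OF s(1,2)] unfolding s(3,4) by linarith
    moreover have "\<tau> / 4 * ?A \<le> 1 / 4 * ?A" using \<tau> \<delta> by (intro mult_right_mono) auto
    ultimately have "?A / 2 \<le> \<bar>Re ((z1 - z2) / d)\<bar>" using \<delta>(1) by auto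
    then have "\<tau> / 2 * (?A / 2) \<le> \<tau> / 2 * \<bar>Re ((z1 - z2) / d)\<bar>" using \<tau> by (intro mult_left_mono) auto
    then show ?thesis using ReIm(1)[OF s(1,2)] s(3,4) by simp
  qed
  show thesis
  proof (rule that[of d \<eta> c l])
    show "d \<noteq> 0" "0 < \<eta>" "\<eta> \<le> \<rho>" using d_pos \<eta> by (auto simp: \<eta>_def)
    show "c - d \<in> \<gamma> ` J" "c + d \<in> \<gamma> ` J" "c + d * l \<in> \<gamma> ` J"
      unfolding ends cl using in\<epsilon> inJ by auto
    show "\<bar>Im l\<bar> < \<tau> * (1 + Re l)" "\<bar>Im l\<bar> < \<tau> * (1 - Re l)" by (fact lt)+
    fix w assume w: "w \<in> rhombus \<tau>"
    have "l \<in> rhombus \<tau>" using lt by (auto simp: rhombus_def)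
    then have "cmod (w - l) \<le> 4"
      using rhombus_cmod_le[OF w \<tau>] rhombus_cmod_le[OF _ \<tau>, of l] norm_triangle_ineq4[of w l] by linarith
    then have "cmod (d * (w - l)) \<le> 2 * (\<delta> * cmod D) * 4"
      unfolding norm_mult using d_le \<delta>(1) D by (intro mult_mono) auto
    also have "\<dots> < \<delta> * (16 * cmod D)" using \<delta>(1) D by simp
    also have "\<dots> \<le> \<eta>" by (rule \<delta>(3))
    finally have "cmod (d * (w - l)) < \<eta>" .
    moreover have "c + d * w = \<gamma> t0 + d * (w - l)" using cl by (simp add: algebra_simps)
    ultimately show "c + d * w \<in> ball (\<gamma> t0) \<eta>" by (simp add: dist_norm)
  qed (rule cone)
qed

text \<open>The cone condition is closed and invariant under real scaling, so it passes from chords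
  to the limit of the difference quotients. Limits within \<open>J\<close> cover end points of the
  arc, and \<open>f\<close> is left free so that the arc and its mirror image are treated
  alike.\<close>

lemma tangent_in_cone:
  fixes f :: "real \<Rightarrow> complex"
  assumes der: "(f has_vector_derivative f') (at t within J)" and "t islimpt J"
    and f: "f t \<in> U" "open U" "t \<in> J" "f ` J \<subseteq> \<sigma>"
    and cone: "\<And>z1 z2. z1 \<in> \<sigma> \<inter> U \<Longrightarrow> z2 \<in> \<sigma> \<inter> U \<Longrightarrow>
       \<bar>Im ((z1 - z2) / d)\<bar> \<le> \<epsilon> * \<bar>Re ((z1 - z2) / d)\<bar>"
  shows "\<bar>Im (f' / d)\<bar> \<le> \<epsilon> * \<bar>Re (f' / d)\<bar>"
proof -
  have "((\<lambda>s. (f s - f t) /\<^sub>R (s - t)) \<longlongrightarrow> f') (at t within J)"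
  proof (rule LIM_zero_cancel, rule tendsto_norm_zero_cancel)
    have "((\<lambda>s. norm (f s - f t - (s - t) *\<^sub>R f') / norm (s - t)) \<longlongrightarrow> 0) (at t within J)"
      using der by (simp add: has_vector_derivative_def has_derivative_iff_norm)
    moreover have "norm (f s - f t - (s - t) *\<^sub>R f') / norm (s - t) = norm ((f s - f t) /\<^sub>R (s - t) - f')"
      if "s \<noteq> t" for s
    proof -
      have "(f s - f t) /\<^sub>R (s - t) - f' = (f s - f t - (s - t) *\<^sub>R f') /\<^sub>R (s - t)"
        using that by (simp add: scaleR_diff_right)
      then show ?thesis by (simp add: divide_inverse_commute)
    qed
    ultimately show "((\<lambda>s. norm ((f s - f t) /\<^sub>R (s - t) - f')) \<longlongrightarrow> 0) (at t within J)"
      by (auto elim!: Lim_transform_eventually simp: eventually_at_filter)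
  qed
  then have lim: "((\<lambda>s. (f s - f t) /\<^sub>R (s - t) / d) \<longlongrightarrow> f' / d) (at t within J)"
    unfolding divide_inverse[of _ d] by (intro tendsto_intros)
  have "((\<lambda>s. \<bar>Im ((f s - f t) /\<^sub>R (s - t) / d)\<bar>) \<longlongrightarrow> \<bar>Im (f' / d)\<bar>) (at t within J)"
    and "((\<lambda>s. \<epsilon> * \<bar>Re ((f s - f t) /\<^sub>R (s - t) / d)\<bar>) \<longlongrightarrow> \<epsilon> * \<bar>Re (f' / d)\<bar>) (at t within J)"
    by (intro tendsto_intros lim)+
  moreover have "\<forall>\<^sub>F s in at t within J. \<bar>Im ((f s - f t) /\<^sub>R (s - t) / d)\<bar> \<le> \<epsilon> * \<bar>Re ((f s - f t) /\<^sub>R (s - t) / d)\<bar>"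
  proof -
    have "continuous (at t within J) f" by (rule has_vector_derivative_continuous[OF der])
    then have "\<forall>\<^sub>F s in at t within J. f s \<in> U"
      using f(1,2) by (auto simp: continuous_within intro: topological_tendstoD)
    moreover have "\<forall>\<^sub>F s in at t within J. s \<in> J" by (simp add: eventually_at_filter)
    ultimately show ?thesis
    proof eventually_elim
      case (elim s)
      have "\<bar>Im ((f s - f t) / d)\<bar> \<le> \<epsilon> * \<bar>Re ((f s - f t) / d)\<bar>"
        by (rule cone) (use elim f in auto)
      then have "\<bar>inverse (s - t)\<bar> * \<bar>Im ((f s - f t) / d)\<bar> \<le> \<bar>inverse (s - t)\<bar> * (\<epsilon> * \<bar>Re ((f s - f t) / d)\<bar>)"
        by (rule mult_left_mono) simp
      moreover have "(f s - f t) /\<^sub>R (s - t) / d = inverse (s - t) *\<^sub>R ((f s - f t) / d)"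
        by (simp add: scaleR_conv_of_real)
      ultimately show ?case by (simp only: abs_mult scaleR_complex.sel) (simp only: ac_simps)
    qed
  qed
  ultimately show ?thesis
    using assms(2) by (intro tendsto_le) (auto simp: trivial_limit_within)
qed

text \<open>A side leaves its vertex with slope \<tau> in the coordinate w, whereas a point in the
  cone is seen from that vertex under slope at most \<tau>/2.\<close>

lemma rhombus_side:
  fixes c d \<epsilon> \<zeta> :: complex
  assumes \<tau>: "0 < \<tau>" and d: "d \<noteq> 0" and \<epsilon>: "\<epsilon> = 1 \<or> \<epsilon> = -1" and \<zeta>: "\<zeta> = 1 \<or> \<zeta> = -1"
    and z: "z \<in> closed_segment (c + d * \<epsilon>) (c + d * (\<zeta> * (\<i> * of_real \<tau>)))"
    and cone: "\<bar>Im ((z - (c + d * \<epsilon>)) / d)\<bar> \<le> \<tau> / 2 * \<bar>Re ((z - (c + d * \<epsilon>)) / d)\<bar>"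
  shows "z = c + d * \<epsilon>"
proof -
  obtain u where u: "0 \<le> u" "z = (1 - u) *\<^sub>R (c + d * \<epsilon>) + u *\<^sub>R (c + d * (\<zeta> * (\<i> * of_real \<tau>)))"
    using z by (auto simp: closed_segment_def)
  have "z - (c + d * \<epsilon>) = d * (of_real u * (\<zeta> * (\<i> * of_real \<tau>) - \<epsilon>))"
    unfolding u(2) by (simp add: scaleR_conv_of_real algebra_simps)
  then have "(z - (c + d * \<epsilon>)) / d = of_real u * (\<zeta> * (\<i> * of_real \<tau>) - \<epsilon>)" using d by simp
  then have "\<bar>u * \<tau>\<bar> \<le> \<tau> / 2 * \<bar>u\<bar>" using cone \<epsilon> \<zeta> by auto
  then have "u * \<tau> \<le> u * (\<tau> / 2)" using u(1) \<tau> by (simp add: abs_mult mult.commute)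
  then have "u = 0" using u(1) \<tau> by (auto simp: mult_le_0_iff mult.commute[of \<tau>])
  then show ?thesis using u(2) by simp
qed

text \<open>The same comparison of slopes for directions. It excludes tangency anywhere on a side
  once tangents are known to lie in the cone.\<close>

lemma rhombus_side_direction:
  fixes c d \<epsilon> \<zeta> v :: complex
  assumes \<tau>: "0 < \<tau>" and d: "d \<noteq> 0" and \<epsilon>: "\<epsilon> = 1 \<or> \<epsilon> = -1" and \<zeta>: "\<zeta> = 1 \<or> \<zeta> = -1"
    and v: "\<bar>Im (v / d)\<bar> \<le> \<tau> / 2 * \<bar>Re (v / d)\<bar>"
  shows "c + d * (\<zeta> * (\<i> * of_real \<tau>)) - (c + d * \<epsilon>) \<noteq> x *\<^sub>R v"
proof
  assume "c + d * (\<zeta> * (\<i> * of_real \<tau>)) - (c + d * \<epsilon>) = x *\<^sub>R v"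
  then have "x *\<^sub>R (v / d) = \<zeta> * (\<i> * of_real \<tau>) - \<epsilon>" using d by (simp add: scaleR_conv_of_real field_simps)
  then have "x * Im (v / d) = Im (\<zeta> * (\<i> * of_real \<tau>) - \<epsilon>)" "x * Re (v / d) = Re (\<zeta> * (\<i> * of_real \<tau>) - \<epsilon>)"
    by (metis scaleR_complex.sel(2), metis scaleR_complex.sel(1))
  then have "\<bar>x\<bar> * \<bar>Im (v / d)\<bar> = \<tau>" "\<bar>x\<bar> * \<bar>Re (v / d)\<bar> = 1"
    using \<epsilon> \<zeta> \<tau> by (auto simp flip: abs_mult)
  moreover have "\<bar>x\<bar> * \<bar>Im (v / d)\<bar> \<le> \<tau> / 2 * (\<bar>x\<bar> * \<bar>Re (v / d)\<bar>)"
    using mult_left_mono[OF v, of "\<bar>x\<bar>"] by (simp add: ac_simps)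
  ultimately show False using \<tau> by simp
qed

section \<open>The spectral integral along a rhombus\<close>

lemma contour_integral_quadrilateral:
  assumes "continuous_on K f" "convex K" "p1 \<in> K" "p2 \<in> K" "p3 \<in> K" "p4 \<in> K"
  shows "contour_integral (linepath p1 p2 +++ linepath p2 p3 +++ linepath p3 p4 +++ linepath p4 p1) f =
    contour_integral (linepath p1 p2) f + contour_integral (linepath p2 p3) f +
    contour_integral (linepath p3 p4) f + contour_integral (linepath p4 p1) f"
proof -
  have "(f has_contour_integral contour_integral (linepath p q) f) (linepath p q)" if "p \<in> K" "q \<in> K" for p q
    using assms(1) closed_segment_subset[OF that assms(2)]
    by (intro has_contour_integral_integral contour_integrable_continuous_linepath) (rule continuous_on_subset)
  then have "(f has_contour_integral contour_integral (linepath p1 p2) f + (contour_integral (linepath p2 p3) f +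
     (contour_integral (linepath p3 p4) f + contour_integral (linepath p4 p1) f)))
     (linepath p1 p2 +++ linepath p2 p3 +++ linepath p3 p4 +++ linepath p4 p1)"
    using assms by (intro has_contour_integral_join valid_path_join) auto
  then show ?thesis by (simp add: contour_integral_unique add.assoc)
qed

text \<open>Every side turns counterclockwise around the point: Im ((b - a) * cnj (b - l)) is a
  signed area, which the affine map multiplies by |d|^2 > 0. So all four sides contribute positive
  real parts to the winding number.\<close>

lemma winding_number_rhombus:
  fixes c d l :: complex
  defines "Z \<equiv> \<lambda>w. c + d * w"
  assumes d: "d \<noteq> 0" and \<tau>: "0 < \<tau>" and l: "\<bar>Im l\<bar> < \<tau> * (1 + Re l)" "\<bar>Im l\<bar> < \<tau> * (1 - Re l)"
  defines "P \<equiv> linepath (Z (-1)) (Z (- \<i> * of_real \<tau>)) +++ linepath (Z (- \<i> * of_real \<tau>)) (Z 1) +++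
      linepath (Z 1) (Z (\<i> * of_real \<tau>)) +++ linepath (Z (\<i> * of_real \<tau>)) (Z (-1))"
  shows "winding_number P (Z l) \<noteq> 0" "Z l \<notin> path_image P"
proof -
  have pos: "0 < Re (winding_number (linepath (Z a) (Z b)) (Z l)) \<and> Z l \<notin> closed_segment (Z a) (Z b)"
    if "0 < Im ((b - a) * cnj (b - l))" for a b
  proof -
    have "(Z b - Z a) * cnj (Z b - Z l) = (d * cnj d) * ((b - a) * cnj (b - l))"
      by (simp add: Z_def algebra_simps)
    also have "\<dots> = of_real ((cmod d)\<^sup>2) * ((b - a) * cnj (b - l))"
      by (simp only: complex_norm_square)
    finally have "Im ((Z b - Z a) * cnj (Z b - Z l)) = (cmod d)\<^sup>2 * Im ((b - a) * cnj (b - l))"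
      by (simp del: of_real_power)
    then have *: "0 < Im ((Z b - Z a) * cnj (Z b - Z l))" using that d by simp
    moreover have "Z l \<notin> closed_segment (Z a) (Z b)"
    proof
      assume "Z l \<in> closed_segment (Z a) (Z b)"
      then obtain u where u: "0 \<le> u" "u \<le> 1" "Z l = (1 - u) *\<^sub>R Z a + u *\<^sub>R Z b" by (auto simp: closed_segment_def)
      have "Z b - Z l = (1 - u) *\<^sub>R (Z b - Z a)" unfolding u(3) by (simp add: algebra_simps)
      then have "(Z b - Z a) * cnj (Z b - Z l) = (1 - u) *\<^sub>R ((Z b - Z a) * cnj (Z b - Z a))" by simp
      moreover have "Im (r *\<^sub>R (w * cnj w)) = 0" for r w by (simp add: mult.commute)
      ultimately show False using * by (simp only: less_irrefl)
    qed
    ultimately show ?thesis using winding_number_linepath_pos_lt by blast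
  qed
  let ?i = "\<i> * of_real \<tau>"
  have e: "0 < Im (((- ?i) - (-1)) * cnj ((- ?i) - l))" "0 < Im ((1 - (- ?i)) * cnj (1 - l))"
    "0 < Im ((?i - 1) * cnj (?i - l))" "0 < Im ((-1 - ?i) * cnj (-1 - l))"
    using l \<tau> by (simp_all add: algebra_simps abs_less_iff)
  note p = pos[OF e(1)] pos[OF e(2)] pos[OF e(3)] pos[OF e(4)]
  have "valid_path P \<and> Z l \<notin> path_image P \<and> 0 < Re (winding_number P (Z l))"
    unfolding P_def using p by (simp add: path_image_join winding_number_join_pos_combined)
  then show "winding_number P (Z l) \<noteq> 0" "Z l \<notin> path_image P" by auto
qed

context complex_action
begin

section \<open>Commutation and continuity of the resolvent\<close>

lemma inverse_commuting:
  assumes R: "(cm z - T) o\<^sub>L R = id_blinfun" "R o\<^sub>L (cm z - T) = id_blinfun" and X: "commuting X"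
  shows "X o\<^sub>L R = R o\<^sub>L X"
proof -
  have "(cm z - T) o\<^sub>L X = X o\<^sub>L (cm z - T)"
    using X by (simp add: commuting_def blinfun_comp.diff_left blinfun_comp.diff_right)
  then have "R o\<^sub>L ((cm z - T) o\<^sub>L X) o\<^sub>L R = R o\<^sub>L (X o\<^sub>L (cm z - T)) o\<^sub>L R" by simp
  then have "(R o\<^sub>L (cm z - T)) o\<^sub>L (X o\<^sub>L R) = (R o\<^sub>L X) o\<^sub>L ((cm z - T) o\<^sub>L R)"
    by (simp only: blinfun_compose_assoc)
  then show ?thesis by (simp add: R blinfun_compose_id)
qed

text \<open>By the first resolvent identity, |R z| <= 2 |R w| for z near w, after which the
  difference is at most a constant times |w - z|.\<close>

lemma resolvent_continuous_on:
  assumes R: "\<And>z. z \<notin> \<sigma> \<Longrightarrow> (cm z - T) o\<^sub>L R z = id_blinfun" "\<And>z. z \<notin> \<sigma> \<Longrightarrow> R z o\<^sub>L (cm z - T) = id_blinfun"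
  shows "continuous_on (- \<sigma>) R"
  unfolding continuous_on_eq_continuous_within continuous_within
proof
  fix w assume w: "w \<in> - \<sigma>"
  obtain B where B: "B > 0" "\<And>z. norm (cm z) \<le> norm z * B"
    using bounded_linear.pos_bounded[OF bounded_linear_cm] by blast
  have diff: "norm (R z - R w) \<le> norm (R z) * (norm (w - z) * B * norm (R w))" if z: "z \<in> - \<sigma>" for z
  proof -
    have "R z - R w = R z o\<^sub>L (cm (w - z) o\<^sub>L R w)"
    proof (rule blinfun_eqI)
      fix v
      have "R z ((cm z - T) (R w v)) = R w v" "(cm w - T) (R w v) = v"
        using R(2)[of z] R(1)[of w] z w by (metis ComplD blinfun_apply_blinfun_compose id_blinfun.rep_eq id_apply)+
      then have "R z (cm z (R w v)) - R z (T (R w v)) = R w v" "R z (cm w (R w v)) - R z (T (R w v)) = R z v"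
        by (simp add: blinfun.diff_left blinfun.diff_right, metis blinfun.diff_left blinfun.diff_right)
      then show "(R z - R w) v = (R z o\<^sub>L (cm (w - z) o\<^sub>L R w)) v"
        by (simp add: blinfun.diff_left blinfun.diff_right cm_diff algebra_simps)
    qed
    then have "norm (R z - R w) \<le> norm (R z) * norm (cm (w - z) o\<^sub>L R w)"
      by (simp add: norm_blinfun_compose)
    also have "norm (cm (w - z) o\<^sub>L R w) \<le> norm (cm (w - z)) * norm (R w)" by (rule norm_blinfun_compose)
    also have "norm (cm (w - z)) \<le> norm (w - z) * B" by (rule B(2))
    finally show ?thesis by (simp add: mult_left_mono mult_right_mono)
  qed
  have "((\<lambda>z. R z - R w) \<longlongrightarrow> 0) (at w within - \<sigma>)"
  proof (rule Lim_null_comparison)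
    have "((\<lambda>z. norm (w - z) * B * norm (R w)) \<longlongrightarrow> norm (w - w) * B * norm (R w)) (at w within - \<sigma>)"
      by (intro tendsto_intros)
    then have lim: "((\<lambda>z. norm (w - z) * B * norm (R w)) \<longlongrightarrow> 0) (at w within - \<sigma>)" by simp
    then have "\<forall>\<^sub>F z in at w within - \<sigma>. norm (w - z) * B * norm (R w) < 1 / 2"
      by (rule order_tendstoD) simp
    moreover have "\<forall>\<^sub>F z in at w within - \<sigma>. z \<in> - \<sigma>" by (simp add: eventually_at_filter)
    ultimately show "\<forall>\<^sub>F z in at w within - \<sigma>. norm (R z - R w) \<le> 2 * norm (R w) * (norm (w - z) * B * norm (R w))"
    proof eventually_elim
      case (elim z)
      let ?e = "norm (w - z) * B * norm (R w)"
      have "norm (R z) * ?e \<le> norm (R z) * (1 / 2)" using elim(1) by (intro mult_left_mono) auto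
      then have "norm (R z) \<le> norm (R w) + norm (R z) * (1/2)"
        using diff[OF elim(2)] norm_triangle_ineq2[of "R z" "R w"] by linarith
      then have "norm (R z) * ?e \<le> 2 * norm (R w) * ?e" using B(1) by (intro mult_right_mono) auto
      then show ?case using diff[OF elim(2)] by linarith
    qed
    have "((\<lambda>z. 2 * norm (R w) * (norm (w - z) * B * norm (R w))) \<longlongrightarrow> 2 * norm (R w) * 0) (at w within - \<sigma>)"
      by (intro tendsto_mult tendsto_const lim)
    then show "((\<lambda>z. 2 * norm (R w) * (norm (w - z) * B * norm (R w))) \<longlongrightarrow> 0) (at w within - \<sigma>)" by simp
  qed
  then show "(R \<longlongrightarrow> R w) (at w within - \<sigma>)" by (rule LIM_zero_cancel)
qed

text \<open>The vertices c + d and c - d may be spectral points lying on the contour. The growth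
  along the sides is weaker than the decay of \<open>m\<close>, so \<open>S\<close> extends
  continuously by 0. And \<open>m\<close>, holomorphic away from these two points and continuous on
  the rhombus, still obeys Cauchy's theorem on a convex set.\<close>

lemma rhombus_contour:
  fixes c d l :: complex and R :: "complex \<Rightarrow> 'h \<Rightarrow>\<^sub>L 'h"
  assumes R: "\<And>z. z \<notin> \<sigma> \<Longrightarrow> (cm z - T) o\<^sub>L R z = id_blinfun" "\<And>z. z \<notin> \<sigma> \<Longrightarrow> R z o\<^sub>L (cm z - T) = id_blinfun"
    and \<tau>: "thin_sector (Suc k) \<tau>" and d: "d \<noteq> 0"
    and l: "\<bar>Im l\<bar> < \<tau> * (1 + Re l)" "\<bar>Im l\<bar> < \<tau> * (1 - Re l)"
    and side: "\<And>\<epsilon> \<zeta>. \<epsilon> = 1 \<or> \<epsilon> = -1 \<Longrightarrow> \<zeta> = 1 \<or> \<zeta> = -1 \<Longrightarrow> \<exists>A K. \<forall>z \<in>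
      closed_segment (c + d * \<epsilon>) (c + d * (\<zeta> * (\<i> * of_real \<tau>))) - {c + d * \<epsilon>}.
      z \<notin> \<sigma> \<and> norm (R z) \<le> A * exp (K / cmod (z - (c + d * \<epsilon>)) ^ k)"
  obtains E m S where "spectral_contour E ((\<lambda>w. c + d * w) ` rhombus \<tau>) m S"
    "\<And>a b. (a, b) \<in> E \<Longrightarrow> c + d * l \<notin> closed_segment a b"
    "(\<Sum>(a, b)\<in>E. contour_integral (linepath a b) (\<lambda>z. m z / (z - (c + d * l)))) \<noteq> 0"
proof -
  have \<tau>0: "0 < \<tau>" "\<tau> \<le> 1" using \<tau> by (auto simp: thin_sector_def)
  define Z where "Z w = c + d * w" for w
  define W where "W z = (z - c) / d" for z
  have WZ [simp]: "W (Z w) = w" "Z (W z) = z" for w z using d by (auto simp: Z_def W_def)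
  have contW: "continuous_on A W" for A unfolding W_def using d by (intro continuous_intros) auto
  define K where "K = Z ` rhombus \<tau>"
  have K_eq: "z \<in> K \<longleftrightarrow> W z \<in> rhombus \<tau>" for z unfolding K_def by (metis WZ image_iff)
  have convK: "convex K"
  proof -
    have "K = (\<lambda>x. c + x) ` ((\<lambda>x. d * x) ` rhombus \<tau>)" by (auto simp: K_def Z_def image_image)
    then show ?thesis
      by (simp only:) (intro convex_translation convex_linear_image convex_rhombus linear_times)
  qed
  define m where "m z = decay (Suc k) (W z)" for z
  define S where "S z = (if z = Z 1 \<or> z = Z (-1) then 0 else R z o\<^sub>L cm (m z))" for z
  let ?i = "\<i> * of_real \<tau>"
  define p1 p2 p3 p4 where "p1 = Z (-1)" and "p2 = Z (- ?i)" and "p3 = Z 1" and "p4 = Z ?i"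
  note p_defs = p1_def p2_def p3_def p4_def
  define E where "E = {(p1, p2), (p2, p3), (p3, p4), (p4, p1)}"
  have pK: "p1 \<in> K" "p2 \<in> K" "p3 \<in> K" "p4 \<in> K"
    using \<tau>0 by (auto simp: K_eq p_defs rhombus_def)
  have Z_inj: "Z a = Z b \<longleftrightarrow> a = b" for a b by (metis WZ(1))
  \<comment> \<open>The contour is a set of pairs, so distinct corners are needed for the sum to
    have one term for each side.\<close>
  have distinct: "p1 \<noteq> p2" "p1 \<noteq> p3" "p1 \<noteq> p4" "p2 \<noteq> p3" "p2 \<noteq> p4" "p3 \<noteq> p4"
    unfolding p_defs Z_inj using \<tau>0 by (auto simp: complex_eq_iff)
  have sumE: "(\<Sum>(a, b)\<in>E. f a b) = f p1 p2 + f p2 p3 + f p3 p4 + f p4 p1" for f :: "complex \<Rightarrow> complex \<Rightarrow> complex"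
    using distinct by (simp add: E_def add.assoc)
  have contm: "continuous_on K m" unfolding m_def
    by (rule continuous_on_compose2[OF continuous_on_decay[OF \<tau>] contW]) (auto simp: K_eq)
  have m0: "m z = 0 \<longleftrightarrow> z = Z 1 \<or> z = Z (-1)" for z
  proof -
    have "decay (Suc k) w = 0 \<longleftrightarrow> w = 1 \<or> w = -1" for w by (auto simp: decay_def)
    then show ?thesis unfolding m_def by (metis WZ)
  qed
  have diffm: "m field_differentiable at z" if "z \<notin> {p1, p3}" for z
  proof -
    have "W field_differentiable at z" unfolding W_def using d by (intro derivative_intros) auto
    moreover have "decay (Suc k) field_differentiable at (W z)"
    proof (rule decay_differentiable)
      show "W z \<noteq> 1" using that unfolding p_defs by (metis WZ(2) insertCI)
      show "W z \<noteq> -1" using that unfolding p_defs by (metis WZ(2) insertCI)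
    qed
    ultimately have "(decay (Suc k) \<circ> W) field_differentiable at z" by (rule field_differentiable_compose)
    then show ?thesis by (simp add: m_def[abs_def] o_def)
  qed
  \<comment> \<open>Each side is taken as starting at its vertex \<open>Z 1\<close> or
    \<open>Z (-1)\<close>; the conditions concern only the point set, so the orientation in
    \<open>E\<close> does not matter.\<close>
  have side': "closed_segment p q \<subseteq> K \<and> continuous_on (closed_segment p q) S \<and>
      (\<forall>z\<in>closed_segment p q. (cm z - T) o\<^sub>L S z = cm (m z) \<and> (\<forall>X. commuting X \<longrightarrow> X o\<^sub>L S z = S z o\<^sub>L X))"
    if \<epsilon>: "\<epsilon> = 1 \<or> \<epsilon> = -1" and \<zeta>: "\<zeta> = 1 \<or> \<zeta> = -1" and pq: "p = Z \<epsilon>" "q = Z (\<zeta> * ?i)" for p q \<epsilon> \<zeta>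
  proof -
    let ?L = "closed_segment p q"
    have LK: "?L \<subseteq> K" using \<tau>0 \<epsilon> \<zeta> by (intro closed_segment_subset convK) (auto simp: K_eq pq rhombus_def)
    have other: "z \<noteq> Z (- \<epsilon>)" if z: "z \<in> ?L" for z
    proof
      assume "z = Z (- \<epsilon>)"
      then obtain u where u: "0 \<le> u" "u \<le> 1" "Z (- \<epsilon>) = (1 - u) *\<^sub>R p + u *\<^sub>R q"
        using z by (auto simp: closed_segment_def)
      have "(1 - u) *\<^sub>R p + u *\<^sub>R q = Z ((1 - u) *\<^sub>R \<epsilon> + u *\<^sub>R (\<zeta> * ?i))"
        by (simp add: pq Z_def algebra_simps scaleR_conv_of_real)
      then have "- \<epsilon> = (1 - u) *\<^sub>R \<epsilon> + u *\<^sub>R (\<zeta> * ?i)" using u(3) by (simp only: Z_inj)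
      then have "Re (- \<epsilon>) = Re ((1 - u) *\<^sub>R \<epsilon> + u *\<^sub>R (\<zeta> * ?i))" by (rule arg_cong)
      then show False using \<epsilon> \<zeta> u by auto
    qed
    have vert: "z = Z 1 \<or> z = Z (-1) \<longleftrightarrow> z = p" if "z \<in> ?L" for z
      using other[OF that] \<epsilon> by (auto simp: pq)
    obtain A B where AB: "\<And>z. z \<in> ?L - {p} \<Longrightarrow> z \<notin> \<sigma>"
      "\<And>z. z \<in> ?L - {p} \<Longrightarrow> norm (R z) \<le> A * exp (B / cmod (z - p) ^ k)"
      using side[OF \<epsilon> \<zeta>] unfolding pq Z_def by blast
    have S_eq: "S z = R z o\<^sub>L cm (m z)" if "z \<in> ?L - {p}" for z
      using vert[of z] that by (auto simp: S_def)
    have Sp: "S p = 0" using \<epsilon> by (auto simp: S_def pq)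
    have alg: "(cm z - T) o\<^sub>L S z = cm (m z) \<and> (\<forall>X. commuting X \<longrightarrow> X o\<^sub>L S z = S z o\<^sub>L X)" if z: "z \<in> ?L" for z
    proof (cases "z = p")
      case True
      then have "m z = 0" using \<epsilon> by (auto simp: m0 pq)
      then show ?thesis using True by (simp add: Sp cm_0)
    next
      case False
      then have z\<sigma>: "z \<notin> \<sigma>" and Sz: "S z = R z o\<^sub>L cm (m z)" using AB(1) S_eq z by auto
      have "(cm z - T) o\<^sub>L S z = cm (m z)"
        unfolding Sz blinfun_compose_assoc[symmetric] R(1)[OF z\<sigma>] by (intro blinfun_eqI) simp
      moreover have "X o\<^sub>L S z = S z o\<^sub>L X" if X: "commuting X" for X
        using inverse_commuting[OF R[OF z\<sigma>] X] X unfolding Sz commuting_def by (metis blinfun_compose_assoc)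
      ultimately show ?thesis by blast
    qed
    have "continuous_on (?L - {p}) (\<lambda>z. R z o\<^sub>L cm (m z))"
      by (intro blinfun_comp.continuous_on bounded_linear.continuous_on[OF bounded_linear_cm]
          continuous_on_subset[OF resolvent_continuous_on[OF R]] continuous_on_subset[OF contm])
        (use AB(1) LK in auto)
    then have cont1: "continuous_on (?L - {p}) S"
      by (rule continuous_on_eq) (simp add: S_eq)
    obtain b where b: "b > 0" "\<And>z. norm (cm z) \<le> norm z * b"
      using bounded_linear.pos_bounded[OF bounded_linear_cm] by blast
    have lim: "(S \<longlongrightarrow> 0) (at p within ?L)"
    proof (rule Lim_null_comparison)
      have "filterlim W (at \<epsilon> within rhombus \<tau>) (at p within ?L)"
        unfolding filterlim_at
      proof
        have "isCont W p" using contW[of UNIV] by (simp add: continuous_on_eq_continuous_at)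
        then have "(W \<longlongrightarrow> W p) (at p within ?L)" unfolding isCont_def by (rule tendsto_within_subset) simp
        then show "(W \<longlongrightarrow> \<epsilon>) (at p within ?L)" by (simp add: pq)
        have "W z \<in> rhombus \<tau> \<and> W z \<noteq> \<epsilon>" if "z \<in> ?L" "z \<noteq> p" for z
          using that LK K_eq WZ(2)[of z] by (auto simp: pq)
        then show "\<forall>\<^sub>F z in at p within ?L. W z \<in> rhombus \<tau> \<and> W z \<noteq> \<epsilon>"
          by (auto simp: eventually_at_filter)
      qed
      \<comment> \<open>Passing to the coordinate w divides distances by |d|, hence the growth
        constant by |d|^k.\<close>
      from filterlim_compose[OF decay_tendsto_0[OF \<tau> \<epsilon>] this, of "B / cmod d ^ k"]
      have "((\<lambda>z. exp (B / cmod d ^ k / cmod (W z - \<epsilon>) ^ k) * cmod (m z)) \<longlongrightarrow> 0) (at p within ?L)"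
        by (simp add: m_def)
      from tendsto_mult[OF tendsto_const[of "A * b"] this]
      show "((\<lambda>z. A * b * (exp (B / cmod d ^ k / cmod (W z - \<epsilon>) ^ k) * cmod (m z))) \<longlongrightarrow> 0) (at p within ?L)" by simp
      have "norm (S z) \<le> A * b * (exp (B / cmod d ^ k / cmod (W z - \<epsilon>) ^ k) * cmod (m z))" if z: "z \<in> ?L" "z \<noteq> p" for z
      proof -
        have "z - p = d * (W z - \<epsilon>)" using WZ(2)[of z] unfolding pq Z_def by (simp add: algebra_simps)
        then have e: "B / cmod d ^ k / cmod (W z - \<epsilon>) ^ k = B / cmod (z - p) ^ k"
          by (simp add: norm_mult power_mult_distrib)
        have "norm (S z) \<le> norm (R z) * norm (cm (m z))"
          using S_eq[of z] z by (simp add: norm_blinfun_compose)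
        also have "\<dots> \<le> (A * exp (B / cmod (z - p) ^ k)) * (cmod (m z) * b)"
          using AB(2)[of z] z b by (intro mult_mono) (auto intro: order_trans[OF norm_ge_zero])
        finally show ?thesis unfolding e by (simp add: ac_simps)
      qed
      then show "\<forall>\<^sub>F z in at p within ?L. norm (S z) \<le> A * b * (exp (B / cmod d ^ k / cmod (W z - \<epsilon>) ^ k) * cmod (m z))"
        by (auto simp: eventually_at_filter)
    qed
    have "continuous_on ?L S"
      unfolding continuous_on_eq_continuous_within
    proof
      fix z assume z: "z \<in> ?L"
      show "continuous (at z within ?L) S"
      proof (cases "z = p")
        case True
        then show ?thesis using lim Sp by (simp add: continuous_within)
      next
        case False
        then have "continuous (at z within ?L - {p}) S"
          using cont1 z by (simp add: continuous_on_eq_continuous_within)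
        moreover have "at z within ?L - {p} = at z within ?L"
          by (rule at_within_nhd[of z "- {p}"]) (use False in auto)
        ultimately show ?thesis by simp
      qed
    qed
    with LK alg show ?thesis by blast
  qed
  have sideE: "closed_segment a b \<subseteq> K \<and> continuous_on (closed_segment a b) S \<and>
      (\<forall>z\<in>closed_segment a b. (cm z - T) o\<^sub>L S z = cm (m z) \<and> (\<forall>X. commuting X \<longrightarrow> X o\<^sub>L S z = S z o\<^sub>L X))"
    if "(a, b) \<in> E" for a b
    using that side'[of "-1" "-1" p1 p2] side'[of 1 "-1" p3 p2] side'[of 1 1 p3 p4] side'[of "-1" 1 p1 p4]
    unfolding E_def p_defs by (auto simp: closed_segment_commute)
  define P where "P = linepath p1 p2 +++ linepath p2 p3 +++ linepath p3 p4 +++ linepath p4 p1"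
  have P_path: "valid_path P" "pathfinish P = pathstart P" by (auto simp: P_def intro!: valid_path_join)
  have P_image: "path_image P = (\<Union>(a, b)\<in>E. closed_segment a b)"
    by (auto simp: P_def E_def path_image_join)
  then have PK: "path_image P \<subseteq> K" using sideE by fastforce
  have wind: "winding_number P (Z l) \<noteq> 0" "Z l \<notin> path_image P"
    using winding_number_rhombus[OF d \<tau>0(1) l, of c] unfolding P_def p_defs Z_def by simp_all
  have lint: "Z l \<in> interior K"
  proof (rule interiorI[of "W -` interior (rhombus \<tau>)"])
    show "open (W -` interior (rhombus \<tau>))"
      using contW[of UNIV] by (intro open_vimage) auto
    show "W -` interior (rhombus \<tau>) \<subseteq> K" using interior_subset[of "rhombus \<tau>"] by (auto simp: K_eq)
    show "Z l \<in> W -` interior (rhombus \<tau>)" using rhombus_interiorI[OF l] by simp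
  qed
  have ml: "m (Z l) \<noteq> 0"
    using l \<tau>0 by (auto simp: m0 Z_inj)
  have cl: "(\<Sum>(a, b)\<in>E. contour_integral (linepath a b) (\<lambda>z. m z / (z - Z l))) \<noteq> 0"
  proof -
    \<comment> \<open>Cauchy's formula is applied with the finite exceptional set of the two
      vertices at which \<open>m\<close> is only known to be continuous.\<close>
    have "((\<lambda>z. m z / (z - Z l)) has_contour_integral (2 * pi * \<i> * winding_number P (Z l) * m (Z l))) P"
      by (rule Cauchy_integral_formula_convex[OF convK, of "{p1, p3}"])
        (use contm diffm lint P_path PK wind in auto)
    moreover have "contour_integral P (\<lambda>z. m z / (z - Z l)) = (\<Sum>(a, b)\<in>E. contour_integral (linepath a b) (\<lambda>z. m z / (z - Z l)))"
    proof -
      have *: "(\<lambda>z. m z / (z - Z l)) contour_integrable_on linepath a b" if ab: "(a, b) \<in> E" for a b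
      proof (rule contour_integrable_continuous_linepath)
        have "Z l \<notin> closed_segment a b" using wind(2) ab unfolding P_image by auto
        then show "continuous_on (closed_segment a b) (\<lambda>z. m z / (z - Z l))"
          using sideE[OF ab] by (intro continuous_intros continuous_on_subset[OF contm]) auto
      qed
      then have "(\<lambda>z. m z / (z - Z l)) contour_integrable_on linepath p1 p2"
        "(\<lambda>z. m z / (z - Z l)) contour_integrable_on linepath p2 p3"
        "(\<lambda>z. m z / (z - Z l)) contour_integrable_on linepath p3 p4"
        "(\<lambda>z. m z / (z - Z l)) contour_integrable_on linepath p4 p1"
        by (auto simp: E_def)
      then show ?thesis unfolding sumE P_def by (simp add: add.assoc)
    qed
    ultimately have "(\<Sum>(a, b)\<in>E. contour_integral (linepath a b) (\<lambda>z. m z / (z - Z l)))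
        = 2 * pi * \<i> * winding_number P (Z l) * m (Z l)"
      by (metis contour_integral_unique)
    then show ?thesis using wind ml by simp
  qed
  have cu: "(\<Sum>(a, b)\<in>E. contour_integral (linepath a b) (\<lambda>z. m z / (z - u))) = 0" if u: "u \<notin> K" for u
  proof -
    have cont: "continuous_on K (\<lambda>z. m z / (z - u))" using u by (intro continuous_intros contm) auto
    have "((\<lambda>z. m z / (z - u)) has_contour_integral 0) P"
    proof (rule Cauchy_theorem_convex[OF cont convK, of "{p1, p3}"])
      fix z assume z: "z \<in> interior K - {p1, p3}"
      then have "z \<noteq> u" using u interior_subset[of K] by auto
      then show "(\<lambda>z. m z / (z - u)) field_differentiable at z"
        using z by (intro field_differentiable_divide diffm derivative_intros) auto
    qed (use P_path PK in auto)
    then show ?thesis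
      unfolding sumE contour_integral_quadrilateral[OF cont convK pK, symmetric] P_def
      by (rule contour_integral_unique)
  qed
  show thesis
  proof (rule that[of E m S])
    show "spectral_contour E ((\<lambda>w. c + d * w) ` rhombus \<tau>) m S"
      using sideE cu continuous_on_subset[OF contm]
      unfolding spectral_contour_def K_def Z_def[abs_def] by (auto simp: E_def)
    show "c + d * l \<notin> closed_segment a b" if "(a, b) \<in> E" for a b
      using wind(2) that unfolding P_image Z_def by auto
    show "(\<Sum>(a, b)\<in>E. contour_integral (linepath a b) (\<lambda>z. m z / (z - (c + d * l)))) \<noteq> 0"
      using cl unfolding Z_def .
  qed
qed

end

section \<open>Left multiplication in a Hilbert basis\<close>

lemma qinner_0_right [simp]: "qinner x 0 = 0"
  using qinner_add_right[of x 0 0] by simp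

lemma qinner_scaleR_right: "qinner x (r *\<^sub>R y) = r *\<^sub>R qinner x y"
  by (metis mult_scaleR_right mult.right_neutral of_real_def qinner_scaleQ_right scaleQ_of_real)

lemma qinner_sum_right: "qinner x (\<Sum>n\<in>F. f n) = (\<Sum>n\<in>F. qinner x (f n))"
  by (induction F rule: infinite_finite_induct) (simp_all add: qinner_add_right)

lemma qinner_minus_right: "qinner x (y - z) = qinner x y - qinner x z"
  by (metis add_diff_cancel_right' diff_add_cancel qinner_add_right)

lemma norm_add_orthogonal:
  assumes "qinner x y = 0"
  shows "(norm (x + y))\<^sup>2 = (norm x)\<^sup>2 + (norm y)\<^sup>2"
proof -
  have "qinner y x = 0" using qinner_cnj[of y x] assms by (simp add: quat_eq_iff)
  then have "qinner (x + y) (x + y) = qinner x x + qinner y y"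
    using assms by (simp add: qinner_add_left qinner_add_right)
  then show ?thesis by (simp add: quat_eq_iff qinner_self del: of_real_power)
qed

lemma norm_unit: "qinner u u = 1 \<Longrightarrow> norm u = 1"
  using power2_eq_imp_eq[of "norm u" 1] qinner_self[of u] by (simp add: quat_eq_iff del: of_real_power)

text \<open>Split \<open>y\<close> into its projection on \<open>u\<close> and an orthogonal rest.
  This case of Cauchy-Schwarz makes the coordinates in a basis continuous.\<close>

lemma norm_qinner_unit_le:
  assumes "qinner u u = 1"
  shows "norm (qinner u y) \<le> norm y"
proof -
  let ?p = "u *\<^sub>Q qinner u y"
  have "qinner u (y - ?p) = 0" using assms by (simp add: qinner_minus_right qinner_scaleQ_right)
  then have "qinner ?p (y - ?p) = 0" by (simp add: qinner_scaleQ_left)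
  from norm_add_orthogonal[OF this] have "(norm y)\<^sup>2 = (norm ?p)\<^sup>2 + (norm (y - ?p))\<^sup>2" by simp
  then have "(norm ?p)\<^sup>2 \<le> (norm y)\<^sup>2" by simp
  then have "norm ?p \<le> norm y" by (rule power2_le_imp_le) simp
  then show ?thesis using norm_unit[OF assms] by (simp add: norm_scaleQ)
qed

lemma bounded_linear_qinner_unit: "qinner u u = 1 \<Longrightarrow> bounded_linear (qinner u)"
  by (rule bounded_linear_intro[where K=1])
    (simp_all add: qinner_add_right qinner_scaleR_right norm_qinner_unit_le)

locale right_hilbert_basis =
  fixes e :: "nat \<Rightarrow> 'h::right_quat_hilbert" and N :: "nat set"
  assumes basis: "hilbert_basis e N"
begin

lemma orthonormal: "m \<in> N \<Longrightarrow> n \<in> N \<Longrightarrow> qinner (e m) (e n) = (if m = n then 1 else 0)"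
  using basis by (simp add: hilbert_basis_def)

lemma has_sum_expansion: "((\<lambda>n. e n *\<^sub>Q qinner (e n) v) has_sum v) N"
  using basis by (simp add: hilbert_basis_def)

lemma norm_basis: "n \<in> N \<Longrightarrow> norm (e n) = 1"
  using orthonormal[of n n] by (simp add: norm_unit)

lemma norm_finite_sum:
  assumes "finite F" "F \<subseteq> N"
  shows "(norm (\<Sum>n\<in>F. e n *\<^sub>Q c n))\<^sup>2 = (\<Sum>n\<in>F. (norm (c n))\<^sup>2)"
  using assms
proof (induction F)
  case (insert m F)
  have "qinner (e m *\<^sub>Q c m) (\<Sum>n\<in>F. e n *\<^sub>Q c n) = 0"
    unfolding qinner_sum_right
    by (rule sum.neutral) (use insert orthonormal in \<open>auto simp: qinner_scaleQ_left qinner_scaleQ_right\<close>)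
  from norm_add_orthogonal[OF this] insert show ?case by (simp add: norm_scaleQ norm_basis)
qed simp

text \<open>Left multiplication scales the norm of every coefficient by |s|, and orthonormality
  turns squared distances of partial sums into sums of squared coefficients. Hence the multiplied
  series is Cauchy as soon as the expansion of a vector is.\<close>

lemma dist_finite_sums:
  assumes "finite F" "F \<subseteq> N" "finite G" "G \<subseteq> N"
  shows "dist (\<Sum>n\<in>F. e n *\<^sub>Q (s * c n)) (\<Sum>n\<in>G. e n *\<^sub>Q (s * c n)) =
    norm s * dist (\<Sum>n\<in>F. e n *\<^sub>Q c n) (\<Sum>n\<in>G. e n *\<^sub>Q c n)"
proof -
  \<comment> \<open>The coefficient is 1, -1 or 0 according to the part of the union, so that the
    difference of two sums becomes a single sum.\<close>
  define k :: "nat \<Rightarrow> real" where "k n = (if n \<in> F then 1 else 0) - (if n \<in> G then 1 else 0)" for n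
  have diff: "(\<Sum>n\<in>F. e n *\<^sub>Q b n) - (\<Sum>n\<in>G. e n *\<^sub>Q b n) = (\<Sum>n\<in>F \<union> G. e n *\<^sub>Q (k n *\<^sub>R b n))" for b
  proof -
    have "(\<Sum>n\<in>F. e n *\<^sub>Q b n) = (\<Sum>n\<in>F \<union> G. (if n \<in> F then 1 else 0::real) *\<^sub>R (e n *\<^sub>Q b n))"
      "(\<Sum>n\<in>G. e n *\<^sub>Q b n) = (\<Sum>n\<in>F \<union> G. (if n \<in> G then 1 else 0::real) *\<^sub>R (e n *\<^sub>Q b n))"
      using assms by (auto intro!: sum.mono_neutral_cong_left)
    moreover have "e n *\<^sub>Q (k n *\<^sub>R b n) =
        (if n \<in> F then 1 else 0) *\<^sub>R (e n *\<^sub>Q b n) - (if n \<in> G then 1 else 0) *\<^sub>R (e n *\<^sub>Q b n)" for n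
      by (simp only: scaleQ_scaleR_right) (simp only: k_def scaleR_diff_left)
    ultimately show ?thesis by (simp only: sum_subtractf)
  qed
  have FG: "finite (F \<union> G)" "F \<union> G \<subseteq> N" using assms by auto
  have "(dist (\<Sum>n\<in>F. e n *\<^sub>Q (s * c n)) (\<Sum>n\<in>G. e n *\<^sub>Q (s * c n)))\<^sup>2 =
      (norm s * dist (\<Sum>n\<in>F. e n *\<^sub>Q c n) (\<Sum>n\<in>G. e n *\<^sub>Q c n))\<^sup>2"
    unfolding dist_norm power_mult_distrib diff norm_finite_sum[OF FG]
    by (simp add: norm_quat_mult power_mult_distrib sum_distrib_left ac_simps)
  then show ?thesis by (rule power2_eq_imp_eq) auto
qed

text \<open>Without convergence the infinite sum in \<open>left_mult\<close> would default to 0. The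
  partial sums are Cauchy like those of the expansion of \<open>v\<close>, and completeness supplies
  the limit.\<close>

lemma has_sum_left_mult: "((\<lambda>n. e n *\<^sub>Q (s * qinner (e n) v)) has_sum left_mult e N s v) N"
proof -
  let ?f = "\<lambda>n. e n *\<^sub>Q qinner (e n) v" and ?g = "\<lambda>n. e n *\<^sub>Q (s * qinner (e n) v)"
  have lim: "(sum ?f \<longlongrightarrow> v) (finite_subsets_at_top N)"
    using has_sum_expansion[of v] by (simp add: has_sum_def)
  have "\<exists>P. eventually P (finite_subsets_at_top N) \<and>
      (\<forall>F F'. P F \<and> P F' \<longrightarrow> dist (sum ?g F) (sum ?g F') < r)" if "r > 0" for r
  proof -
    define d where "d = r / (2 * (norm s + 1))"
    have d: "d > 0" using that by (simp add: d_def add_nonneg_pos)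
    define P where "P F \<longleftrightarrow> finite F \<and> F \<subseteq> N \<and> dist (sum ?f F) v < d" for F
    have "eventually P (finite_subsets_at_top N)"
      using tendstoD[OF lim d]
      by (auto simp: P_def[abs_def] eventually_conj_iff intro: eventually_finite_subsets_at_top_weakI)
    moreover have "dist (sum ?g F) (sum ?g G) < r" if "P F" "P G" for F G
    proof -
      have "dist (sum ?f F) (sum ?f G) < 2 * d"
        using that dist_triangle2[of "sum ?f F" "sum ?f G" v] by (simp add: P_def)
      have "dist (sum ?g F) (sum ?g G) \<le> norm s * (2 * d)"
        using that dist_finite_sums[of F G s "\<lambda>n. qinner (e n) v"] \<open>dist (sum ?f F) (sum ?f G) < 2 * d\<close>
        by (simp add: P_def mult_left_mono)
      also have "\<dots> < (norm s + 1) * (2 * d)" using d by (simp add: algebra_simps)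
      also have "\<dots> = r"
      proof -
        have "norm s + 1 > 0" by (simp add: add_nonneg_pos)
        then show ?thesis by (simp add: d_def field_simps)
      qed
      finally show ?thesis .
    qed
    ultimately show ?thesis by blast
  qed
  then have "cauchy_filter (filtermap (sum ?g) (finite_subsets_at_top N))"
    by (simp add: cauchy_filter_metric_filtermap)
  moreover have "complete (UNIV::'h set)"
    by (meson Cauchy_convergent UNIV_I complete_def convergent_def)
  ultimately obtain L where "(sum ?g \<longlongrightarrow> L) (finite_subsets_at_top N)"
    using complete_uniform[where S = "UNIV::'h set"] by (force simp add: filterlim_def)
  then have "?g summable_on N" using summable_on_def has_sum_def by blast
  then show ?thesis unfolding left_mult_def by simp
qed

lemma left_multI: "((\<lambda>n. e n *\<^sub>Q (s * qinner (e n) v)) has_sum w) N \<Longrightarrow> left_mult e N s v = w"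
  using has_sum_left_mult has_sum_unique by blast

lemma norm_left_mult: "norm (left_mult e N s v) = norm s * norm v"
proof -
  let ?f = "\<lambda>n. e n *\<^sub>Q qinner (e n) v" and ?g = "\<lambda>n. e n *\<^sub>Q (s * qinner (e n) v)"
  have lim: "(sum ?f \<longlongrightarrow> v) (finite_subsets_at_top N)"
    "(sum ?g \<longlongrightarrow> left_mult e N s v) (finite_subsets_at_top N)"
    using has_sum_expansion[of v] has_sum_left_mult[of s v] by (simp_all add: has_sum_def)
  have "((\<lambda>F. norm s * norm (sum ?f F)) \<longlongrightarrow> norm s * norm v) (finite_subsets_at_top N)"
    by (intro tendsto_intros lim)
  moreover have "\<forall>\<^sub>F F in finite_subsets_at_top N. norm s * norm (sum ?f F) = norm (sum ?g F)"
    by (rule eventually_finite_subsets_at_top_weakI)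
      (use dist_finite_sums[of _ "{}" s "\<lambda>n. qinner (e n) v"] in simp)
  ultimately have "((\<lambda>F. norm (sum ?g F)) \<longlongrightarrow> norm s * norm v) (finite_subsets_at_top N)"
    by (rule Lim_transform_eventually)
  from tendsto_unique[OF _ tendsto_norm[OF lim(2)] this] show ?thesis by simp
qed

lemma left_mult_add: "left_mult e N s (v + w) = left_mult e N s v + left_mult e N s w"
  by (rule left_multI)
    (use has_sum_add[OF has_sum_left_mult[of s v] has_sum_left_mult[of s w]] in
      \<open>simp add: qinner_add_right scaleQ_add_right distrib_left\<close>)

lemma left_mult_scaleQ: "left_mult e N s (v *\<^sub>Q q) = left_mult e N s v *\<^sub>Q q"
  by (rule left_multI)
    (use has_sum_bounded_linear[OF bounded_bilinear.bounded_linear_left[OF bounded_bilinear_scaleQ, of q]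
        has_sum_left_mult[of s v]] in \<open>simp add: qinner_scaleQ_right scaleQ_scaleQ mult.assoc\<close>)

lemma left_mult_scaleR: "left_mult e N s (r *\<^sub>R v) = r *\<^sub>R left_mult e N s v"
  using left_mult_scaleQ[of s v "of_real r"] by (simp add: scaleQ_of_real)

lemma bounded_linear_left_mult: "bounded_linear (left_mult e N s)"
  by (rule bounded_linear_intro[where K="norm s"])
    (simp_all add: left_mult_add left_mult_scaleR norm_left_mult)

lemma qinner_left_mult:
  assumes "m \<in> N" shows "qinner (e m) (left_mult e N s v) = s * qinner (e m) v"
proof (rule has_sum_unique)
  have "bounded_linear (qinner (e m))" using assms orthonormal by (intro bounded_linear_qinner_unit) simp
  from has_sum_bounded_linear[OF this has_sum_left_mult]
  show "((\<lambda>n. qinner (e m) (e n *\<^sub>Q (s * qinner (e n) v))) has_sum qinner (e m) (left_mult e N s v)) N" .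
  show "((\<lambda>n. qinner (e m) (e n *\<^sub>Q (s * qinner (e n) v))) has_sum s * qinner (e m) v) N"
    by (rule has_sum_finite_neutralI[of "{m}"]) (use assms orthonormal in \<open>auto simp: qinner_scaleQ_right\<close>)
qed

lemma left_mult_left_mult: "left_mult e N s (left_mult e N t v) = left_mult e N (s * t) v"
proof (rule left_multI)
  have "e n *\<^sub>Q (s * qinner (e n) (left_mult e N t v)) = e n *\<^sub>Q (s * t * qinner (e n) v)" if "n \<in> N" for n
    using that by (simp add: qinner_left_mult mult.assoc)
  then show "((\<lambda>n. e n *\<^sub>Q (s * qinner (e n) (left_mult e N t v))) has_sum left_mult e N (s * t) v) N"
    using has_sum_left_mult[of "s * t" v] by (simp cong: has_sum_cong)
qed

lemma left_mult_add_left: "left_mult e N (s + t) v = left_mult e N s v + left_mult e N t v"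
  by (rule left_multI)
    (use has_sum_add[OF has_sum_left_mult[of s v] has_sum_left_mult[of t v]] in
      \<open>simp add: scaleQ_add_right distrib_right\<close>)

lemma left_mult_scaleR_left: "left_mult e N (r *\<^sub>R s) v = r *\<^sub>R left_mult e N s v"
  by (rule left_multI)
    (use has_sum_bounded_linear[OF bounded_linear_scaleR_right[of r] has_sum_left_mult[of s v]] in
      \<open>simp add: scaleQ_scaleR_right\<close>)

lemma left_mult_1: "left_mult e N 1 v = v"
  by (rule left_multI) (use has_sum_expansion in simp)

text \<open>
  Left and right multiplication by the slice of \<open>I\<close> agree, possibly up to conjugation, on the
  eigenspaces of \<open>v \<mapsto> I v I\<close>.
\<close>

lemma left_mult_eigenspaces:
  assumes I: "I \<in> imag_units"
  obtains v1 v2 where "v = v1 + v2" "norm v1 \<le> norm v" "norm v2 \<le> norm v"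
    "\<And>z. left_mult e N (qc I z) v1 = v1 *\<^sub>Q qc I z"
    "\<And>z. left_mult e N (qc I z) v2 = v2 *\<^sub>Q qc I (cnj z)"
proof -
  let ?L = "left_mult e N I"
  have II: "I * I = -1" by (rule imag_unit_sqr[OF I])
  have nI: "norm I = 1" by (rule imag_unitsD(3)[OF I])
  have LL: "?L (?L v) = - v"
    unfolding left_mult_left_mult II using left_mult_scaleR_left[of "-1" 1 v] by (simp add: left_mult_1)
  have vII: "w *\<^sub>Q I *\<^sub>Q I = - w" for w :: 'h
    unfolding scaleQ_scaleQ II using scaleQ_scaleR_right[of w "-1" 1] by simp
  have neg: "(- w) *\<^sub>Q q = - (w *\<^sub>Q q)" for w :: 'h and q
    using scaleQ_scaleR_left[of "-1" w q] by simp
  have Lq: "left_mult e N (qc I z) w = Re z *\<^sub>R w + Im z *\<^sub>R ?L w" for z w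
    unfolding qc_def by (simp add: left_mult_add_left left_mult_scaleR_left left_mult_1)
  have wq: "w *\<^sub>Q qc I z = Re z *\<^sub>R w + Im z *\<^sub>R (w *\<^sub>Q I)" for z and w :: 'h
    unfolding qc_def by (simp add: scaleQ_add_right scaleQ_scaleR_right)
  \<comment> \<open>The map taking v to I v I is an isometric involution; \<open>v1\<close> and
    \<open>v2\<close> are the projections of \<open>v\<close> to its eigenvalues -1 and 1.\<close>
  define v1 where "v1 = (1/2) *\<^sub>R (v + (-1) *\<^sub>R (?L v *\<^sub>Q I))"
  define v2 where "v2 = (1/2) *\<^sub>R (v + ?L v *\<^sub>Q I)"
  have nL: "norm (?L v *\<^sub>Q I) = norm v" by (simp add: norm_scaleQ norm_left_mult nI)
  have "?L v1 = v1 *\<^sub>Q I"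
    unfolding v1_def left_mult_scaleR left_mult_add left_mult_scaleQ LL scaleQ_scaleR_left scaleQ_add_left vII
    by (simp add: neg add.commute)
  moreover have "?L v2 = - (v2 *\<^sub>Q I)"
    unfolding v2_def left_mult_scaleR left_mult_add left_mult_scaleQ LL scaleQ_scaleR_left scaleQ_add_left vII
    by (simp add: neg scaleR_diff_right)
  moreover have "v = v1 + v2" by (simp add: v1_def v2_def scaleR_add_right[symmetric] scaleR_2[symmetric])
  moreover have "norm v1 \<le> norm v" "norm v2 \<le> norm v"
    using norm_triangle_ineq[of v "(-1) *\<^sub>R (?L v *\<^sub>Q I)"] norm_triangle_ineq[of v "?L v *\<^sub>Q I"] nL
    unfolding v1_def v2_def by simp_all
  ultimately show thesis using that[of v1 v2] unfolding Lq wq by simp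
qed

end

section \<open>The S-resolvent and the resolvent on a slice\<close>

locale quat_operator = right_hilbert_basis e N for e :: "nat \<Rightarrow> 'h::right_quat_hilbert" and N +
  fixes T :: "'h \<Rightarrow> 'h" and I :: quat
  assumes brl: "bounded_right_linear T" and I: "I \<in> imag_units"
begin

lemma T_scaleQ: "T (x *\<^sub>Q q) = T x *\<^sub>Q q"
  using brl by (simp add: bounded_right_linear_def)

lemma bl_T: "bounded_linear T"
  using brl by (simp add: bounded_right_linear_def)

definition Tb :: "'h \<Rightarrow>\<^sub>L 'h" where "Tb = Blinfun T"

lemma Tb_apply [simp]: "Tb v = T v"
  unfolding Tb_def by (simp add: bounded_linear_Blinfun_apply bl_T)

definition cm :: "complex \<Rightarrow> 'h \<Rightarrow>\<^sub>L 'h" where "cm z = rmul (qc I z)"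

lemma cm_apply [simp]: "cm z v = v *\<^sub>Q qc I z"
  by (simp add: cm_def)

sublocale complex_action cm Tb
proof (rule complex_action.intro)
  show "bounded_linear cm"
    unfolding cm_def[abs_def] by (rule bounded_linear_compose[OF bounded_linear_rmul bounded_linear_qc[OF I]])
  show "cm 1 = id_blinfun" using qc_of_real[OF I, of 1] by (simp add: cm_def rmul_1)
  show "cm (a * b) = cm a o\<^sub>L cm b" for a b
    unfolding cm_def by (metis mult.commute qc_mult[OF I] rmul_mult)
  show "Tb o\<^sub>L cm a = cm a o\<^sub>L Tb" for a by (rule blinfun_eqI) (simp add: T_scaleQ)
qed

definition \<sigma> :: "complex set" where "\<sigma> = {z. qc I z \<in> S_spectrum T}"

text \<open>The inverse of z - T suggested by factoring \<open>Q_op\<close>. It differs from the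
  left S-resolvent in that the conjugate scalar acts from the right instead of from the
  left.\<close>

definition R :: "complex \<Rightarrow> 'h \<Rightarrow>\<^sub>L 'h" where
  "R z = Blinfun (inv (Q_op T (qc I z))) o\<^sub>L (cm (cnj z) - Tb)"

text \<open>Both z + cnj z and z * cnj z are real, so the real quadratic polynomial splits over the
  slice, where \<open>T\<close> commutes with the scalars.\<close>

lemma Q_op_factor:
  "Q_op T (qc I z) v = ((cm z - Tb) o\<^sub>L (cm (cnj z) - Tb)) v"
proof -
  have "qc I (cnj z) * qc I z = of_real ((cmod z)\<^sup>2)"
    by (metis complex_norm_square mult.commute qc_mult[OF I] qc_of_real[OF I])
  then have 1: "v *\<^sub>Q qc I (cnj z) *\<^sub>Q qc I z = (cmod z)\<^sup>2 *\<^sub>R v"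
    by (simp add: scaleQ_scaleQ scaleQ_of_real del: of_real_power)
  have "qc I z + qc I (cnj z) = of_real (2 * Re z)"
    by (metis complex_add_cnj qc_add[OF I] qc_of_real[OF I])
  then have 2: "T v *\<^sub>Q qc I z + T v *\<^sub>Q qc I (cnj z) = (2 * Re z) *\<^sub>R T v"
    by (metis scaleQ_add_right scaleQ_of_real)
  have "bounded_linear (\<lambda>x. x *\<^sub>Q qc I z)"
    by (rule bounded_bilinear.bounded_linear_left[OF bounded_bilinear_scaleQ])
  then have sub: "(x - y) *\<^sub>Q qc I z = x *\<^sub>Q qc I z - y *\<^sub>Q qc I z" for x y :: 'h
    by (rule linear_diff[OF bounded_linear.linear])
  have Tdiff: "T (x - y) = T x - T y" for x y
    by (rule linear_diff[OF bounded_linear.linear[OF bl_T]])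
  show ?thesis
    unfolding Q_op_def qRe_qc[OF I] norm_qc[OF I] 1[symmetric] 2[symmetric]
    by (simp add: Tdiff blinfun.diff_left sub T_scaleQ)
qed

lemma inv_Q_op:
  assumes "z \<notin> \<sigma>"
  shows "bounded_right_linear (inv (Q_op T (qc I z)))"
    "inv (Q_op T (qc I z)) (Q_op T (qc I z) v) = v" "Q_op T (qc I z) (inv (Q_op T (qc I z)) v) = v"
proof -
  obtain B where B: "bounded_right_linear B" "B \<circ> Q_op T (qc I z) = id" "Q_op T (qc I z) \<circ> B = id"
    using assms by (auto simp: \<sigma>_def S_spectrum_def invertible_op_def)
  have inv: "inv (Q_op T (qc I z)) = B" using B(3,2) by (rule inv_unique_comp)
  show "bounded_right_linear (inv (Q_op T (qc I z)))"
    "inv (Q_op T (qc I z)) (Q_op T (qc I z) v) = v" "Q_op T (qc I z) (inv (Q_op T (qc I z)) v) = v"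
    unfolding inv using B(1) fun_cong[OF B(2), of v] fun_cong[OF B(3), of v] by (simp_all only: o_apply id_apply)
qed

lemma R_inverse:
  assumes "z \<notin> \<sigma>"
  shows "(cm z - Tb) o\<^sub>L R z = id_blinfun" "R z o\<^sub>L (cm z - Tb) = id_blinfun"
proof -
  define B where "B = Blinfun (inv (Q_op T (qc I z)))"
  have B_apply: "B v = inv (Q_op T (qc I z)) v" for v
    using inv_Q_op(1)[OF assms] by (simp add: B_def bounded_linear_Blinfun_apply bounded_right_linear_def)
  let ?P = "cm z - Tb" and ?P' = "cm (cnj z) - Tb"
  have PP: "?P o\<^sub>L ?P' = ?P' o\<^sub>L ?P"
    by (simp add: blinfun_comp.diff_left blinfun_comp.diff_right T_cm cm_commute)
  have 1: "(?P o\<^sub>L ?P') o\<^sub>L B = id_blinfun" "B o\<^sub>L (?P o\<^sub>L ?P') = id_blinfun"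
  proof -
    have "((?P o\<^sub>L ?P') o\<^sub>L B) v = Q_op T (qc I z) (B v)" "(B o\<^sub>L (?P o\<^sub>L ?P')) v = B (Q_op T (qc I z) v)" for v
      by (simp_all only: Q_op_factor blinfun_apply_blinfun_compose)
    then show "(?P o\<^sub>L ?P') o\<^sub>L B = id_blinfun" "B o\<^sub>L (?P o\<^sub>L ?P') = id_blinfun"
      by (intro blinfun_eqI; simp only: B_apply inv_Q_op[OF assms] id_blinfun.rep_eq id_apply)+
  qed
  have PPX: "?P' o\<^sub>L (?P o\<^sub>L X) = ?P o\<^sub>L (?P' o\<^sub>L X)" for X
    by (simp only: blinfun_compose_assoc[symmetric] PP)
  \<comment> \<open>\<open>B\<close> inverts a product of commuting factors, so it commutes with
    them.\<close>
  have BP: "B o\<^sub>L ?P' = ?P' o\<^sub>L B"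
  proof -
    have "B o\<^sub>L ?P' = B o\<^sub>L ?P' o\<^sub>L ((?P o\<^sub>L ?P') o\<^sub>L B)" by (simp add: 1 blinfun_compose_id)
    also have "\<dots> = (B o\<^sub>L (?P o\<^sub>L ?P')) o\<^sub>L (?P' o\<^sub>L B)" by (simp only: blinfun_compose_assoc PPX)
    finally show ?thesis by (simp add: 1 blinfun_compose_id)
  qed
  show "?P o\<^sub>L R z = id_blinfun"
    unfolding R_def B_def[symmetric] BP using 1 by (simp add: blinfun_compose_assoc)
  show "R z o\<^sub>L ?P = id_blinfun"
    unfolding R_def B_def[symmetric] using 1(2) by (simp only: blinfun_compose_assoc PP[symmetric])
qed

text \<open>The resolvents differ only in the side on which cnj z acts. Where left and right
  multiplication agree, \<open>R z\<close> is the S-resolvent at z; where they agree up to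
  conjugation, it is the S-resolvent at cnj z, since both points share the same
  \<open>Q_op\<close>.\<close>

lemma norm_R_le:
  assumes z: "z \<notin> \<sigma>"
  shows "norm (R z) \<le> onorm (S_L_resolvent e N T (qc I z)) + onorm (S_L_resolvent e N T (qc I (cnj z)))"
proof -
  have Qc: "Q_op T (qc I (cnj z)) = Q_op T (qc I z)"
    by (simp add: Q_op_def norm_qc[OF I] qRe_qc[OF I])
  let ?Qi = "inv (Q_op T (qc I z))"
  have blQ: "bounded_linear ?Qi" using inv_Q_op(1)[OF z] by (simp add: bounded_right_linear_def)
  have R_apply: "R z v = - ?Qi (T v - v *\<^sub>Q qc I (cnj z))" for v
    using linear_diff[OF bounded_linear.linear[OF blQ]]
    by (simp add: R_def bounded_linear_Blinfun_apply[OF blQ] blinfun.diff_left)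
  let ?S = "\<lambda>w. S_L_resolvent e N T (qc I w)"
  have S_apply: "?S w v = - ?Qi (T v - left_mult e N (qc I (cnj w)) v)" if "w = z \<or> w = cnj z" for w v
    using that by (auto simp: S_L_resolvent_def Qc qc_cnj[OF I, symmetric])
  have blS: "bounded_linear (?S w)" if "w = z \<or> w = cnj z" for w
    unfolding S_apply[OF that]
    by (intro bounded_linear_minus bounded_linear_compose[OF blQ] bounded_linear_sub bl_T bounded_linear_left_mult)
  show ?thesis
  proof (rule norm_blinfun_bound)
    show "0 \<le> onorm (?S z) + onorm (?S (cnj z))" using blS by (simp add: onorm_pos_le)
    fix v
    obtain v1 v2 where v: "v = v1 + v2" "norm v1 \<le> norm v" "norm v2 \<le> norm v"
      "\<And>z. left_mult e N (qc I z) v1 = v1 *\<^sub>Q qc I z"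
      "\<And>z. left_mult e N (qc I z) v2 = v2 *\<^sub>Q qc I (cnj z)"
      by (rule left_mult_eigenspaces[OF I, of v]) (rule that; assumption)
    have "R z v1 = ?S z v1" "R z v2 = ?S (cnj z) v2"
      unfolding R_apply by (simp_all add: S_apply v(4,5))
    then have "norm (R z v) \<le> norm (?S z v1) + norm (?S (cnj z) v2)"
      by (simp add: v(1) blinfun.add_right norm_triangle_ineq)
    also have "\<dots> \<le> onorm (?S z) * norm v1 + onorm (?S (cnj z)) * norm v2"
      by (intro add_mono onorm blS) auto
    also have "\<dots> \<le> onorm (?S z) * norm v + onorm (?S (cnj z)) * norm v"
      by (intro add_mono mult_left_mono v onorm_pos_le blS) auto
    finally show "norm (R z v) \<le> (onorm (?S z) + onorm (?S (cnj z))) * norm v"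
      by (simp add: algebra_simps)
  qed
qed

text \<open>Conjugation by a unit anticommuting with \<open>I\<close> exchanges \<open>l - T\<close> and \<open>cnj l - T\<close>.\<close>

lemma invertible_imp_notin_spectrum:
  assumes D: "(cm l - Tb) o\<^sub>L D = id_blinfun" "D o\<^sub>L (cm l - Tb) = id_blinfun"
  shows "l \<notin> \<sigma>"
proof -
  obtain J where J: "J \<in> imag_units" "I * J = - (J * I)" by (rule ex_anticommuting_imag_unit[OF I])
  have zJ: "qc I z * J = J * qc I (cnj z)" for z
    using J(2) by (simp add: qc_def algebra_simps)
  have JJ: "rmul J o\<^sub>L rmul (- J) = id_blinfun" "rmul (- J) o\<^sub>L rmul J = id_blinfun"
    using imag_unit_sqr[OF J(1)] by (simp_all add: rmul_mult[symmetric] rmul_1)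
  let ?P = "cm l - Tb" and ?P' = "cm (cnj l) - Tb"
  have PJ: "?P' o\<^sub>L rmul J = rmul J o\<^sub>L ?P"
    by (rule blinfun_eqI) (simp add: blinfun.diff_left blinfun.diff_right scaleQ_scaleQ zJ T_scaleQ
        linear_diff[OF bounded_linear.linear[OF bounded_bilinear.bounded_linear_left[OF bounded_bilinear_scaleQ]]])
  define D' where "D' = rmul J o\<^sub>L D o\<^sub>L rmul (- J)"
  have D'1: "?P' o\<^sub>L D' = id_blinfun"
  proof -
    have "?P' o\<^sub>L D' = (?P' o\<^sub>L rmul J) o\<^sub>L (D o\<^sub>L rmul (- J))" by (simp add: D'_def blinfun_compose_assoc)
    also have "\<dots> = rmul J o\<^sub>L ((?P o\<^sub>L D) o\<^sub>L rmul (- J))" unfolding PJ by (simp add: blinfun_compose_assoc)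
    finally show ?thesis by (simp add: D blinfun_compose_id JJ)
  qed
  have D'2: "D' o\<^sub>L ?P' = id_blinfun"
  proof -
    have "?P' = ?P' o\<^sub>L (rmul J o\<^sub>L rmul (- J))" by (simp add: JJ blinfun_compose_id)
    then have P': "?P' = rmul J o\<^sub>L (?P o\<^sub>L rmul (- J))" by (metis PJ blinfun_compose_assoc)
    have "D' o\<^sub>L ?P' = rmul J o\<^sub>L (D o\<^sub>L ((rmul (- J) o\<^sub>L rmul J) o\<^sub>L (?P o\<^sub>L rmul (- J))))"
      unfolding D'_def P' by (simp add: blinfun_compose_assoc)
    also have "\<dots> = rmul J o\<^sub>L ((D o\<^sub>L ?P) o\<^sub>L rmul (- J))" by (simp add: JJ blinfun_compose_id blinfun_compose_assoc)
    finally show ?thesis by (simp add: D blinfun_compose_id JJ)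
  qed
  let ?Q = "Q_op T (qc I l)"
  define B where "B = D' o\<^sub>L D"
  have "(?P o\<^sub>L ?P') o\<^sub>L B = ?P o\<^sub>L ((?P' o\<^sub>L D') o\<^sub>L D)" "B o\<^sub>L (?P o\<^sub>L ?P') = D' o\<^sub>L ((D o\<^sub>L ?P) o\<^sub>L ?P')"
    by (simp_all add: B_def blinfun_compose_assoc)
  then have B: "(?P o\<^sub>L ?P') o\<^sub>L B = id_blinfun" "B o\<^sub>L (?P o\<^sub>L ?P') = id_blinfun"
    by (simp_all add: D D'1 D'2 blinfun_compose_id)
  have QB: "?Q (B v) = v" "B (?Q v) = v" for v
    using B[THEN arg_cong[of _ _ "\<lambda>X. blinfun_apply X v"]] unfolding Q_op_factor by simp_all
  have Q_scaleQ: "?Q (x *\<^sub>Q q) = ?Q x *\<^sub>Q q" for x q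
  proof -
    note lin = bounded_linear.linear[OF bounded_bilinear.bounded_linear_left[OF bounded_bilinear_scaleQ, of q]]
    show ?thesis
      by (simp add: Q_op_def T_scaleQ linear_add[OF lin] linear_diff[OF lin] scaleQ_scaleR_left)
  qed
  \<comment> \<open>\<open>D\<close> need not respect all right scalars; \<open>B\<close> does,
    being the inverse of the right linear \<open>Q_op\<close>.\<close>
  have "B (x *\<^sub>Q q) = B x *\<^sub>Q q" for x q
    by (metis QB Q_scaleQ)
  then have "bounded_right_linear B"
    by (simp add: bounded_right_linear_def blinfun.bounded_linear_right)
  then have "invertible_op ?Q"
    unfolding invertible_op_def using QB by (intro exI[of _ "blinfun_apply B"]) (auto simp: fun_eq_iff)
  then show ?thesis by (simp add: \<sigma>_def S_spectrum_def)
qed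

end

text \<open>For an imaginary unit \<open>I\<close>, the orthogonal projection to the slice in
  complex coordinates. Being linear on all quaternions, it carries derivatives of the arc to the
  plane.\<close>

definition prc :: "quat \<Rightarrow> quat \<Rightarrow> complex" where
  "prc I q = Complex (qRe q) (inner q I)"

lemma prc_qc: "I \<in> imag_units \<Longrightarrow> prc I (qc I z) = z"
proof -
  assume I: "I \<in> imag_units"
  have "inner I I = 1" using imag_unitsD(3)[OF I] by (simp add: dot_square_norm)
  moreover have "inner 1 I = 0" using imag_unitsD(1)[OF I] by (simp add: inner_quat_def)
  ultimately show ?thesis
    by (simp add: prc_def qRe_qc[OF I]) (simp add: qc_def inner_add_left)
qed

lemma bounded_linear_prc: "bounded_linear (prc I)"
proof -
  have "bounded_linear qRe"
  proof (rule bounded_linear_intro[where K=1])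
    show "norm (qRe q) \<le> norm q * 1" for q
      using abs_le_square_iff[of "qRe q" "norm q"] by (simp add: norm_quat_sqr)
  qed simp_all
  then have "bounded_linear (\<lambda>q. of_real (qRe q) + \<i> * of_real (inner q I))"
    by (intro bounded_linear_add bounded_linear_const_mult bounded_linear_compose[OF bounded_linear_of_real]
        bounded_linear_inner_left)
  moreover have "(\<lambda>q. of_real (qRe q) + \<i> * of_real (inner q I)) = prc I"
    by (auto simp: prc_def complex_eq_iff)
  ultimately show ?thesis by simp
qed

section \<open>Contours through an exposed arc and the hyperinvariant subspace\<close>

context quat_operator
begin

lemma cnj_\<sigma>: "cnj z \<in> \<sigma> \<longleftrightarrow> z \<in> \<sigma>"
  unfolding \<sigma>_def by (simp add: S_spectrum_def Q_op_def norm_qc[OF I] qRe_qc[OF I])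

lemma closed_segment_qc: "closed_segment (qc I a) (qc I b) = qc I ` closed_segment a b"
  by (rule closed_segment_linear_image[OF bounded_linear.linear[OF bounded_linear_qc[OF I]]])

text \<open>On a segment leaving the spectrum at \<open>a\<close>, distances to \<open>a\<close> and to its sphere are comparable.\<close>

lemma resolvent_growth_on_segment:
  fixes a b :: complex and k :: nat
  assumes "a \<noteq> b" and a: "a \<in> \<sigma>" and seg: "\<And>z. z \<in> closed_segment a b \<Longrightarrow> z \<in> \<sigma> \<Longrightarrow> z = a"
    and K: "K > 0" and bound: "\<And>s. s \<in> axial_completion (closed_segment (qc I a) (qc I b)) - qsphere (qc I a) \<Longrightarrow>
        onorm (S_L_resolvent e N T s) \<le> exp (K / setdist (qsphere s) (qsphere (qc I a)) ^ k)"
  shows "\<exists>A K. \<forall>z\<in>closed_segment a b - {a}. z \<notin> \<sigma> \<and> norm (R z) \<le> A * exp (K / cmod (z - a) ^ k)"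
proof -
  let ?L = "closed_segment a b"
  obtain c where c: "c > 0" "\<And>z. z \<in> ?L \<Longrightarrow> c * dist z a \<le> min (dist z a) (dist z (cnj a))"
  proof (cases "cnj a \<in> ?L")
    case True
    \<comment> \<open>The conjugate of \<open>a\<close> is spectral as well, and \<open>a\<close> is
      the only spectral point of the segment; so \<open>a\<close> is real.\<close>
    then have "cnj a = a" using seg a by (auto simp: cnj_\<sigma>)
    then show ?thesis by (intro that[of 1]) auto
  next
    case False
    define \<delta> where "\<delta> = infdist (cnj a) ?L"
    have \<delta>: "\<delta> > 0" using False infdist_pos_not_in_closed[of ?L "cnj a"] by (auto simp: \<delta>_def)
    have M: "dist a b > 0" using assms(1) by simp
    \<comment> \<open>The ratio compares the distance from \<open>cnj a\<close> to the segment with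
      the length of the segment, which is the largest distance to \<open>a\<close>.\<close>
    show ?thesis
    proof (rule that[of "min 1 (\<delta> / dist a b)"])
      fix z assume z: "z \<in> ?L"
      have "min 1 (\<delta> / dist a b) * dist z a \<le> 1 * dist z a" by (intro mult_right_mono) auto
      moreover have "min 1 (\<delta> / dist a b) * dist z a \<le> \<delta> / dist a b * dist a b"
        using dist_in_closed_segment(1)[OF z] \<delta> M by (intro mult_mono) (auto simp: dist_commute)
      moreover have "\<delta> / dist a b * dist a b = \<delta>" using M by simp
      moreover have "\<delta> \<le> dist z (cnj a)" unfolding \<delta>_def using infdist_le[OF z, of "cnj a"] by (simp add: dist_commute)
      ultimately show "min 1 (\<delta> / dist a b) * dist z a \<le> min (dist z a) (dist z (cnj a))" by simp
    qed (use \<delta> M in auto)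
  qed
  have main: "z \<notin> \<sigma> \<and> norm (R z) \<le> 2 * exp (K / c ^ k / cmod (z - a) ^ k)" if z: "z \<in> ?L - {a}" for z
  proof
    show z\<sigma>: "z \<notin> \<sigma>" using seg z by auto
    have nin: "qc I z \<notin> qsphere (qc I a)"
      using z\<sigma> a S_spectrum_qsphere[of "qc I z" "qc I a" T] by (auto simp: \<sigma>_def)
    have in1: "qc I z \<in> axial_completion (closed_segment (qc I a) (qc I b)) - qsphere (qc I a)"
      using z nin qc_in_qsphere[OF I, of z] by (auto simp: axial_completion_def closed_segment_qc)
    have nin2: "qc I (cnj z) \<notin> qsphere (qc I a)"
      using z\<sigma> cnj_\<sigma>[of z] a S_spectrum_qsphere[of "qc I (cnj z)" "qc I a" T] by (auto simp: \<sigma>_def)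
    then have in2: "qc I (cnj z) \<in> axial_completion (closed_segment (qc I a) (qc I b)) - qsphere (qc I a)"
      using z qc_in_qsphere[OF I, of "cnj z"] unfolding qsphere_cnj[OF I]
      by (auto simp: axial_completion_def closed_segment_qc)
    let ?s = "setdist (qsphere (qc I z)) (qsphere (qc I a))"
    have pos: "0 < c * dist z a" using c(1) z by simp
    have "c * dist z a \<le> ?s"
      using order_trans[OF c(2) setdist_qsphere_ge[OF I, of z a]] z by blast
    then have "(c * dist z a) ^ k \<le> ?s ^ k" "0 < ?s" using pos by (auto intro!: power_mono)
    then have "K / ?s ^ k \<le> K / (c * dist z a) ^ k" using K pos c(1) z
      by (intro divide_left_mono mult_pos_pos zero_less_power) auto
    also have "\<dots> = K / c ^ k / cmod (z - a) ^ k" by (simp add: power_mult_distrib dist_norm)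
    finally have le: "exp (K / ?s ^ k) \<le> exp (K / c ^ k / cmod (z - a) ^ k)" by simp
    \<comment> \<open>The points z and cnj z lie on the same sphere, so one bound serves both
      S-resolvents.\<close>
    have "norm (R z) \<le> exp (K / ?s ^ k) + exp (K / ?s ^ k)"
      using norm_R_le[OF z\<sigma>] bound[OF in1] bound[OF in2] unfolding qsphere_cnj[OF I] by linarith
    then show "norm (R z) \<le> 2 * exp (K / c ^ k / cmod (z - a) ^ k)" using le by linarith
  qed
  then show ?thesis by blast
qed

text \<open>The first integral being nonzero makes the subspace proper; the second being nonzero
  puts a nonzero vector into it.\<close>

lemma hyperinvariant_subspace_of_annihilating_pair:
  assumes SC1: "spectral_contour E1 K1 m1 S1" and SC2: "spectral_contour E2 K2 m2 S2"
    and disj: "K1 \<inter> K2 = {}" "cnj ` K1 \<inter> K2 = {}"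
    and nz: "opint E1 S1 \<noteq> 0" "opint E2 S2 \<noteq> 0"
  shows "\<exists>M. closed_right_subspace M \<and> M \<noteq> {0} \<and> M \<noteq> UNIV \<and> hyperinvariant_under M T"
proof -
  define A where "A = opint E1 S1"
  define B where "B = opint E2 S2"
  define M where "M = {x. \<forall>q. A (x *\<^sub>Q q) = 0}"
  have M1: "closed_right_subspace M"
  proof -
    have "closed {x. A (x *\<^sub>Q q) = 0}" for q
    proof -
      have "continuous_on UNIV (\<lambda>x. (A o\<^sub>L rmul q) x)"
        by (rule linear_continuous_on[OF blinfun.bounded_linear_right])
      then have "continuous_on UNIV (\<lambda>x. A (x *\<^sub>Q q))" by simp
      then show ?thesis by (intro closed_Collect_eq continuous_on_const)
    qed
    then have "closed M" unfolding M_def by (rule closed_Collect_all)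
    moreover have "(x + y) *\<^sub>Q q = x *\<^sub>Q q + y *\<^sub>Q q" for x y :: 'h and q by (rule scaleQ_add_left)
    moreover have "(0::'h) *\<^sub>Q q = 0" for q using norm_scaleQ[of 0 q] by simp
    ultimately show ?thesis
      by (auto simp: closed_right_subspace_def M_def blinfun.add_right blinfun.zero_right scaleQ_scaleQ)
  qed
  have M2: "M \<noteq> UNIV"
  proof
    assume "M = UNIV"
    then have "A (x *\<^sub>Q 1) = 0" for x unfolding M_def by blast
    then have "A = 0" by (intro blinfun_eqI) simp
    then show False using nz by (simp add: A_def)
  qed
  have M3: "M \<noteq> {0}"
  proof -
    have "B \<noteq> 0" using nz by (simp add: B_def)
    then obtain w where w: "B w \<noteq> 0" by (metis blinfun_eqI blinfun.zero_left)
    have "A (B w *\<^sub>Q q) = 0" for q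
    proof -
      text \<open>The parts of \<open>q\<close> commuting and anticommuting with \<open>I\<close> act linearly and antilinearly.\<close>
      define q1 where "q1 = (1/2) *\<^sub>R (q - I * q * I)"
      define q2 where "q2 = (1/2) *\<^sub>R (q + I * q * I)"
      have q: "q = q1 + q2" by (simp add: q1_def q2_def scaleR_add_right[symmetric] scaleR_2[symmetric])
      have II: "I * (I * x) = - x" "x * I * I = - x" for x
        using imag_unit_sqr[OF I] by (simp add: mult.assoc[symmetric], simp add: mult.assoc)
      have "I * q1 = q1 * I" "I * q2 = - (q2 * I)"
        by (simp_all add: q1_def q2_def algebra_simps II mult.assoc) (simp_all add: mult.assoc[symmetric] II)
      then have "qc I z * q1 = q1 * qc I z" "qc I z * q2 = q2 * qc I (cnj z)" for z
        by (simp_all add: qc_def algebra_simps)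
      then have cm: "cm z o\<^sub>L rmul q1 = rmul q1 o\<^sub>L cm z" "cm z o\<^sub>L rmul q2 = rmul q2 o\<^sub>L cm (cnj z)" for z
        unfolding cm_def by (metis rmul_mult, metis rmul_mult complex_cnj_cnj)
      have T: "rmul r o\<^sub>L Tb = Tb o\<^sub>L rmul r" for r by (rule blinfun_eqI) (simp add: T_scaleQ)
      have "A o\<^sub>L rmul q1 o\<^sub>L B = 0"
        unfolding A_def B_def
        by (rule opint_compose_eq_0[OF SC1 SC2 T, where \<theta> = "\<lambda>z. z"]) (use cm disj in \<open>auto intro: bounded_linear_ident\<close>)
      moreover have "A o\<^sub>L rmul q2 o\<^sub>L B = 0"
        unfolding A_def B_def
        by (rule opint_compose_eq_0[OF SC1 SC2 T, where \<theta> = cnj]) (use cm disj in \<open>auto intro: bounded_linear_cnj\<close>)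
      ultimately have "A (B w *\<^sub>Q q1) = 0" "A (B w *\<^sub>Q q2) = 0"
        by (metis blinfun_apply_blinfun_compose rmul_apply blinfun.zero_left)+
      then show ?thesis by (simp add: q scaleQ_add_right blinfun.add_right)
    qed
    then have "B w \<in> M" by (simp add: M_def)
    then show ?thesis using w by auto
  qed
  have "hyperinvariant_under M T"
    unfolding hyperinvariant_under_def invariant_under_def
  proof (intro allI impI ballI)
    fix X x assume X: "bounded_right_linear X \<and> X \<circ> T = T \<circ> X" and x: "x \<in> M"
    define Xb where "Xb = Blinfun X"
    have Xb: "Xb v = X v" for v
      using X by (simp add: Xb_def bounded_right_linear_def bounded_linear_Blinfun_apply)
    have XT: "X (T v) = T (X v)" for v using X by (metis comp_apply)
    have Xq: "X (v *\<^sub>Q q) = X v *\<^sub>Q q" for v q using X by (simp add: bounded_right_linear_def)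
    have "commuting Xb" unfolding commuting_def by (auto intro!: blinfun_eqI simp: Xb XT Xq)
    then have comm: "Xb o\<^sub>L A = A o\<^sub>L Xb" unfolding A_def by (rule spectral_contour_commute[OF SC1])
    have "A (X x *\<^sub>Q q) = 0" for q
    proof -
      have "A (X x *\<^sub>Q q) = (A o\<^sub>L Xb) (x *\<^sub>Q q)" by (simp add: Xb Xq)
      also have "\<dots> = Xb (A (x *\<^sub>Q q))" by (simp flip: comm)
      finally show ?thesis using x by (simp add: M_def blinfun.zero_right)
    qed
    then show "X x \<in> M" by (simp add: M_def)
  qed
  with M1 M2 M3 show ?thesis by blast
qed

text \<open>The radius \<rho> is free so that a second contour can be kept away from the first. The
  work lies in checking that every side of the rhombus is a segment to which the growth hypothesis
  applies.\<close>

lemma exposed_arc_contour: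
  assumes arc: "exposed_arc T I g g' J C"
    and growth: "\<And>s0 a b. \<lbrakk> qsphere s0 \<subseteq> axial_completion C;
        a \<in> slice I; b \<in> slice I; a \<noteq> b; transversal_segment a b g g' J;
        axial_completion (closed_segment a b) \<inter> S_spectrum T = qsphere s0 \<rbrakk> \<Longrightarrow>
      \<exists>K>0. \<forall>s \<in> axial_completion (closed_segment a b) - qsphere s0.
        onorm (S_L_resolvent e N T s) \<le> exp (K / setdist (qsphere s) (qsphere s0) ^ k)"
    and xy: "t0 \<in> {x<..<y}" "{x<..<y} \<subseteq> J" and \<rho>: "\<rho> > 0"
  obtains E K m S where "spectral_contour E K m S" "K \<subseteq> ball (prc I (g t0)) \<rho>" "opint E S \<noteq> 0"
proof -
  from arc obtain h c0 r0 where J: "is_interval J" and hom: "homeomorphism J C g h"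
    and der_g: "\<And>t. t \<in> J \<Longrightarrow> (g has_vector_derivative g' t) (at t within J)"
    and cont_g': "continuous_on J g'" and nz_g': "\<And>t. t \<in> J \<Longrightarrow> g' t \<noteq> 0"
    and C_slice: "C \<subseteq> slice I" and r0: "r0 > 0" and C_eq: "(ball c0 r0 \<inter> slice I) \<inter> S_spectrum T = C"
    unfolding exposed_arc_def smooth_jordan_arc_def by blast
  have C_image: "C = g ` J" using hom by (simp add: homeomorphism_def)
  define \<gamma> where "\<gamma> t = prc I (g t)" for t
  define \<gamma>' where "\<gamma>' t = prc I (g' t)" for t
  have g_eq: "g t = qc I (\<gamma> t)" if "t \<in> J" for t
    using that C_slice unfolding C_image slice_eq_range \<gamma>_def by (auto simp: prc_qc[OF I])
  have t0: "t0 \<in> J" using xy by auto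
  have der: "(\<gamma> has_vector_derivative \<gamma>' t) (at t within J)" if "t \<in> J" for t
    unfolding \<gamma>_def[abs_def] \<gamma>'_def by (rule bounded_linear.has_vector_derivative[OF bounded_linear_prc der_g[OF that]])
  have at: "at t within J = at t" if "t \<in> {x<..<y}" for t
    using that xy(2) by (intro at_within_interior interiorI[of "{x<..<y}"]) auto
  have der_at: "(\<gamma> has_vector_derivative \<gamma>' t) (at t)" if "t \<in> {x<..<y}" for t
    using der[of t] that xy(2) unfolding at[OF that] by blast
  have cont\<gamma>': "continuous_on {x<..<y} \<gamma>'"
    unfolding \<gamma>'_def[abs_def]
    by (intro bounded_linear.continuous_on[OF bounded_linear_prc] continuous_on_subset[OF cont_g' xy(2)])
  \<comment> \<open>A nonzero quaternion could project to 0; but the arc stays in the slice, so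
    \<open>g' t0\<close> is recovered from \<open>\<gamma>' t0\<close> through
    \<open>qc\<close>.\<close>
  have nz: "\<gamma>' t0 \<noteq> 0"
  proof
    assume "\<gamma>' t0 = 0"
    then have "((\<lambda>t. qc I (\<gamma> t)) has_vector_derivative qc I 0) (at t0)"
      using bounded_linear.has_vector_derivative[OF bounded_linear_qc[OF I] der_at[OF xy(1)]] by simp
    then have "(g has_vector_derivative qc I 0) (at t0)"
      by (rule has_vector_derivative_transform_within_open[of _ _ _ "{x<..<y}"]) (use xy g_eq in auto)
    moreover have "(g has_vector_derivative g' t0) (at t0)" using der_g[OF t0] unfolding at[OF xy(1)] .
    ultimately have "qc I 0 = g' t0" by (rule vector_derivative_unique_at)
    then show False using nz_g'[OF t0] by (simp add: qc_def)
  qed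
  have inj: "\<exists>d>0. \<forall>s\<in>J. dist (\<gamma> s) (\<gamma> t0) < d \<longrightarrow> dist s t0 < \<epsilon>" if "\<epsilon> > 0" for \<epsilon>
  proof -
    have h: "continuous_on C h" "\<And>s. s \<in> J \<Longrightarrow> h (g s) = s" using hom by (auto simp: homeomorphism_def)
    have "g t0 \<in> C" using t0 by (simp add: C_image)
    from h(1)[unfolded continuous_on_iff, rule_format, OF this that]
    obtain d where "d > 0" "\<And>q. q \<in> C \<Longrightarrow> dist q (g t0) < d \<Longrightarrow> dist (h q) (h (g t0)) < \<epsilon>"
      by blast
    then show ?thesis
      using h(2) t0 by (intro exI[of _ d]) (force simp: C_image g_eq dist_qc[OF I])
  qed
  have \<gamma>\<sigma>: "\<gamma> ` J \<subseteq> \<sigma>"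
  proof clarify
    fix t assume t: "t \<in> J"
    then have "g t \<in> S_spectrum T" using C_eq C_image by blast
    then show "\<gamma> t \<in> \<sigma>" unfolding g_eq[OF t] by (simp add: \<sigma>_def)
  qed
  \<comment> \<open>The ball of this radius about \<open>g t0\<close> lies in the exposing disk,
    where the arc is all of the spectrum in the slice.\<close>
  define r where "r = r0 - dist c0 (g t0)"
  have r: "r > 0" 
  proof -
    have "g t0 \<in> ball c0 r0" using C_eq C_image t0 by blast
    then show ?thesis by (simp add: r_def)
  qed
  have \<sigma>\<gamma>: "\<sigma> \<inter> ball (\<gamma> t0) r \<subseteq> \<gamma> ` J"
  proof
    fix z assume z: "z \<in> \<sigma> \<inter> ball (\<gamma> t0) r"
    then have "dist (g t0) (qc I z) < r" by (simp add: g_eq[OF t0] dist_qc[OF I])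
    then have "qc I z \<in> ball c0 r0"
      using dist_triangle[of c0 "qc I z" "g t0"] by (simp add: r_def)
    moreover have "qc I z \<in> slice I" "qc I z \<in> S_spectrum T" using z by (simp_all add: slice_eq_range \<sigma>_def)
    ultimately have "qc I z \<in> C" using C_eq by blast
    then obtain s where "s \<in> J" "qc I z = g s" using C_image by blast
    then show "z \<in> \<gamma> ` J" by (auto simp: g_eq inj_qc[OF I])
  qed
  obtain \<tau> where \<tau>: "thin_sector (Suc k) \<tau>" by (meson ex_thin_sector thin_sector_def)
  then have \<tau>0: "0 < \<tau>" "\<tau> \<le> 1" by (auto simp: thin_sector_def)
  obtain c d \<eta> l where d: "d \<noteq> 0" and \<eta>: "0 < \<eta>" "\<eta> \<le> \<rho>"
    and K_ball: "\<And>w. w \<in> rhombus \<tau> \<Longrightarrow> c + d * w \<in> ball (\<gamma> t0) \<eta>"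
    and ends: "c - d \<in> \<gamma> ` J" "c + d \<in> \<gamma> ` J" "c + d * l \<in> \<gamma> ` J"
    and l: "\<bar>Im l\<bar> < \<tau> * (1 + Re l)" "\<bar>Im l\<bar> < \<tau> * (1 - Re l)"
    and cone: "\<And>z1 z2. z1 \<in> \<sigma> \<inter> ball (\<gamma> t0) \<eta> \<Longrightarrow> z2 \<in> \<sigma> \<inter> ball (\<gamma> t0) \<eta> \<Longrightarrow>
       \<bar>Im ((z1 - z2) / d)\<bar> \<le> \<tau> / 2 * \<bar>Re ((z1 - z2) / d)\<bar>"
    by (rule arc_chord_cone[OF xy der_at cont\<gamma>' nz inj \<gamma>\<sigma> r \<sigma>\<gamma> \<tau>0 \<rho>])
      (assumption | (rule that; assumption))+
  have limpt: "t islimpt J" if "t \<in> J" for t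
  proof (rule connected_imp_perfect[OF is_interval_connected[OF J] that])
    have "t0 \<in> J" "(t0 + y) / 2 \<in> J" "t0 \<noteq> (t0 + y) / 2" using t0 xy by auto
    then show "J \<noteq> {u}" for u by auto
  qed
  have side: "\<exists>A K. \<forall>z \<in> closed_segment (c + d * \<epsilon>) (c + d * (\<zeta> * (\<i> * of_real \<tau>))) - {c + d * \<epsilon>}.
      z \<notin> \<sigma> \<and> norm (R z) \<le> A * exp (K / cmod (z - (c + d * \<epsilon>)) ^ k)"
    if \<epsilon>: "\<epsilon> = 1 \<or> \<epsilon> = -1" and \<zeta>: "\<zeta> = 1 \<or> \<zeta> = -1" for \<epsilon> \<zeta>
  proof -
    define a where "a = c + d * \<epsilon>"
    define b where "b = c + d * (\<zeta> * (\<i> * of_real \<tau>))"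
    have aJ: "a \<in> \<gamma> ` J" using \<epsilon> ends by (auto simp: a_def)
    then have a\<sigma>: "a \<in> \<sigma>" using \<gamma>\<sigma> by auto
    have ab_ball: "a \<in> ball (\<gamma> t0) \<eta>" "b \<in> ball (\<gamma> t0) \<eta>"
      unfolding a_def b_def by (rule K_ball; use \<epsilon> \<zeta> \<tau>0 in \<open>auto simp: rhombus_def\<close>)+
    have seg_ball: "closed_segment a b \<subseteq> ball (\<gamma> t0) \<eta>" by (rule closed_segment_subset[OF ab_ball convex_ball])
    have seg: "z = a" if z: "z \<in> closed_segment a b" "z \<in> \<sigma>" for z
      unfolding a_def
      by (rule rhombus_side[OF \<tau>0(1) d \<epsilon> \<zeta>]) (use z cone[of z a] a\<sigma> ab_ball seg_ball in \<open>auto simp: a_def b_def\<close>)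
    have "a \<noteq> b"
    proof
      assume "a = b"
      then have "\<epsilon> = \<zeta> * (\<i> * of_real \<tau>)" using d by (simp add: a_def b_def)
      then have "Re \<epsilon> = Re (\<zeta> * (\<i> * of_real \<tau>))" by (rule arg_cong)
      then show False using \<epsilon> \<zeta> by auto
    qed
    \<comment> \<open>Stated for any curve in the spectrum, because tangency has to be excluded for
      the arc and for its conjugate.\<close>
    have not_tangent: "b - a \<noteq> u *\<^sub>R f'"
      if "(f has_vector_derivative f') (at t within J)" "t \<in> J" "f t \<in> closed_segment a b" "f ` J \<subseteq> \<sigma>" for f f' t u
    proof -
      have "\<bar>Im (f' / d)\<bar> \<le> \<tau> / 2 * \<bar>Re (f' / d)\<bar>"
        by (rule tangent_in_cone[OF that(1) limpt[OF that(2)], of "ball (\<gamma> t0) \<eta>" \<sigma>])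
          (use that seg_ball cone in auto)
      then show ?thesis unfolding a_def b_def by (rule rhombus_side_direction[OF \<tau>0(1) d \<epsilon> \<zeta>])
    qed
    have diff: "b - a = u *\<^sub>R prc I q" if "qc I b - qc I a = u *\<^sub>R q" for u q
    proof -
      have "prc I (qc I (b - a)) = prc I (u *\<^sub>R q)" using that by (simp add: qc_minus[OF I])
      then show ?thesis
        by (simp add: prc_qc[OF I] linear_scale[OF bounded_linear.linear[OF bounded_linear_prc]])
    qed
    have prc_cnj: "prc I (qcnj q) = cnj (prc I q)" for q
      using imag_unitsD(1)[OF I] by (simp add: prc_def inner_quat_def complex_eq_iff)
    have "\<not> tangent_segment (qc I a) (qc I b) g g' J"
    proof
      assume "tangent_segment (qc I a) (qc I b) g g' J"
      then obtain t u where t: "t \<in> J" "g t \<in> qc I ` closed_segment a b" "qc I b - qc I a = u *\<^sub>R g' t"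
        unfolding tangent_segment_def closed_segment_qc by blast
      have "\<gamma> t \<in> closed_segment a b" using t(1,2) by (auto simp: g_eq inj_qc[OF I])
      from not_tangent[OF der[OF t(1)] t(1) this \<gamma>\<sigma>, of u] diff[OF t(3)] show False
        unfolding \<gamma>'_def by (rule notE)
    qed
    moreover have "\<not> tangent_segment (qc I a) (qc I b) (\<lambda>t. qcnj (g t)) (\<lambda>t. qcnj (g' t)) J"
    proof
      assume "tangent_segment (qc I a) (qc I b) (\<lambda>t. qcnj (g t)) (\<lambda>t. qcnj (g' t)) J"
      then obtain t u where t: "t \<in> J" "qcnj (g t) \<in> qc I ` closed_segment a b" "qc I b - qc I a = u *\<^sub>R qcnj (g' t)"
        unfolding tangent_segment_def closed_segment_qc by blast
      have 1: "cnj (\<gamma> t) \<in> closed_segment a b"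
        using t(1,2) by (auto simp: g_eq qc_cnj[OF I, symmetric] inj_qc[OF I])
      have 2: "((\<lambda>t. cnj (\<gamma> t)) has_vector_derivative cnj (\<gamma>' t)) (at t within J)"
        by (rule bounded_linear.has_vector_derivative[OF bounded_linear_cnj der[OF t(1)]])
      have 3: "(\<lambda>t. cnj (\<gamma> t)) ` J \<subseteq> \<sigma>" using \<gamma>\<sigma> by (auto simp: cnj_\<sigma>)
      from not_tangent[OF 2 t(1) 1 3, of u] diff[OF t(3)] show False
        unfolding \<gamma>'_def prc_cnj by (rule notE)
    qed
    ultimately have trans: "transversal_segment (qc I a) (qc I b) g g' J" by (simp add: transversal_segment_def)
    have inter: "axial_completion (closed_segment (qc I a) (qc I b)) \<inter> S_spectrum T = qsphere (qc I a)"
    proof (intro equalityI subsetI)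
      fix q assume q: "q \<in> axial_completion (closed_segment (qc I a) (qc I b)) \<inter> S_spectrum T"
      then obtain z where z: "z \<in> closed_segment a b" "q \<in> qsphere (qc I z)"
        by (auto simp: axial_completion_def closed_segment_qc)
      then have "z \<in> \<sigma>" using q S_spectrum_qsphere[OF z(2), of T] by (simp add: \<sigma>_def)
      then show "q \<in> qsphere (qc I a)" using seg[OF z(1)] z(2) by simp
    next
      fix q assume q: "q \<in> qsphere (qc I a)"
      then show "q \<in> axial_completion (closed_segment (qc I a) (qc I b)) \<inter> S_spectrum T"
        using S_spectrum_qsphere[OF q, of T] a\<sigma> by (auto simp: axial_completion_def \<sigma>_def)
    qed
    have "qsphere (qc I a) \<subseteq> axial_completion C"
    proof -
      have "qc I a \<in> C" using aJ by (auto simp: C_image g_eq)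
      then show ?thesis by (auto simp: axial_completion_def)
    qed
    from growth[OF this _ _ _ trans inter] \<open>a \<noteq> b\<close> obtain K where "K > 0"
      "\<And>s. s \<in> axial_completion (closed_segment (qc I a) (qc I b)) - qsphere (qc I a) \<Longrightarrow>
        onorm (S_L_resolvent e N T s) \<le> exp (K / setdist (qsphere s) (qsphere (qc I a)) ^ k)"
      by (auto simp: slice_eq_range inj_qc[OF I])
    from resolvent_growth_on_segment[OF \<open>a \<noteq> b\<close> a\<sigma> seg this] show ?thesis
      unfolding a_def b_def .
  qed
  obtain E m S where E: "spectral_contour E ((\<lambda>w. c + d * w) ` rhombus \<tau>) m S"
    "\<And>a b. (a, b) \<in> E \<Longrightarrow> c + d * l \<notin> closed_segment a b"
    "(\<Sum>(a, b)\<in>E. contour_integral (linepath a b) (\<lambda>z. m z / (z - (c + d * l)))) \<noteq> 0"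
    by (rule rhombus_contour[OF R_inverse \<tau> d l side])
      (assumption | (rule that; assumption))+
  have "opint E S \<noteq> 0"
  proof
    assume 0: "opint E S = 0"
    obtain D where "(cm (c + d * l) - Tb) o\<^sub>L D = id_blinfun" "D o\<^sub>L (cm (c + d * l) - Tb) = id_blinfun"
      by (rule opint_eq_0_imp_invertible[OF E(1) _ E(3) 0]) (erule E(2) | (rule that; assumption))+
    then have "c + d * l \<notin> \<sigma>" by (rule invertible_imp_notin_spectrum)
    then show False using ends(3) \<gamma>\<sigma> by auto
  qed
  moreover have "(\<lambda>w. c + d * w) ` rhombus \<tau> \<subseteq> ball (prc I (g t0)) \<rho>"
    using K_ball \<eta>(2) by (fastforce simp: \<gamma>_def)
  ultimately show thesis using that E(1) by blast
qed

end

section \<open>Two separated points of the arc\<close>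

theorem theorem5p2:
  fixes T :: "'h::right_quat_hilbert \<Rightarrow> 'h"
    and e :: "nat \<Rightarrow> 'h" and N :: "nat set"
    and I :: quat and C :: "quat set"
    and g g' :: "real \<Rightarrow> quat" and J :: "real set"
    and k :: nat
  assumes "separable_space (euclidean :: 'h topology)"
    and "hilbert_basis e N"
    and "bounded_right_linear T"
    and "I \<in> imag_units"
    and "exposed_arc T I g g' J C"
    and "axial_completion C \<subseteq> S_spectrum T"
    and growth: "\<And>s0 a b. \<lbrakk> qsphere s0 \<subseteq> axial_completion C;
        a \<in> slice I; b \<in> slice I; a \<noteq> b;
        transversal_segment a b g g' J;
        axial_completion (closed_segment a b) \<inter> S_spectrum T = qsphere s0 \<rbrakk> \<Longrightarrow>
      \<exists>K>0. \<forall>s \<in> axial_completion (closed_segment a b) - qsphere s0.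
        onorm (S_L_resolvent e N T s) \<le> exp (K / setdist (qsphere s) (qsphere s0) ^ k)"
  shows "\<exists>M. closed_right_subspace M \<and> M \<noteq> {0} \<and> M \<noteq> UNIV \<and> hyperinvariant_under M T"
proof -
  interpret quat_operator e N T I
    using assms(2-4) by unfold_locales
  from assms(5) obtain h x y where J: "is_interval J" "x \<in> J" "y \<in> J" "x < y" and hom: "homeomorphism J C g h"
    and C_slice: "C \<subseteq> slice I"
    unfolding exposed_arc_def smooth_jordan_arc_def by blast
  have sub: "{x<..<y} \<subseteq> J"
    using mem_is_interval_1_I[OF J(1-3)] by auto
  have inj: "t = s" if "prc I (g t) = prc I (g s)" "t \<in> J" "s \<in> J" for t s
  proof -
    have "g t \<in> slice I" "g s \<in> slice I" using that hom C_slice by (auto simp: homeomorphism_def)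
    then have "g t = g s" using that(1) by (auto simp: slice_eq_range prc_qc[OF I])
    then show ?thesis using hom that by (metis homeomorphism_apply1)
  qed
  define t1 where "t1 = x + (y - x) / 4"
  have t1: "t1 \<in> {x<..<y}" using J(4) by (auto simp: t1_def field_simps)
  define p1 where "p1 = prc I (g t1)"
  \<comment> \<open>By injectivity at most one of two further parameters can be sent to
    \<open>cnj p1\<close>, so the other one will do.\<close>
  have "\<exists>t2\<in>{x<..<y}. prc I (g t2) \<noteq> p1 \<and> prc I (g t2) \<noteq> cnj p1"
  proof -
    define s1 s2 where "s1 = x + (y - x) / 2" and "s2 = x + (y - x) * 3 / 4"
    have s: "s1 \<in> {x<..<y}" "s2 \<in> {x<..<y}" "s1 \<noteq> t1" "s2 \<noteq> t1" "s1 \<noteq> s2"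
      using J(4) by (auto simp: s1_def s2_def t1_def field_simps)
    then have "prc I (g s1) \<noteq> p1" "prc I (g s2) \<noteq> p1" "prc I (g s1) \<noteq> prc I (g s2)"
      using inj sub t1 unfolding p1_def by blast+
    then show ?thesis using s by metis
  qed
  then obtain t2 where t2: "t2 \<in> {x<..<y}" "prc I (g t2) \<noteq> p1" "prc I (g t2) \<noteq> cnj p1" by blast
  define p2 where "p2 = prc I (g t2)"
  \<comment> \<open>Half the smaller distance makes the ball about \<open>p2\<close> disjoint from
    those about \<open>p1\<close> and \<open>cnj p1\<close>, which conjugation exchanges.\<close>
  define \<rho> where "\<rho> = min (dist p1 p2) (dist (cnj p1) p2) / 2"
  have \<rho>: "\<rho> > 0" using t2 by (auto simp: \<rho>_def p2_def)
  obtain E1 K1 m1 S1 where 1: "spectral_contour E1 K1 m1 S1" "K1 \<subseteq> ball (prc I (g t1)) \<rho>" "opint E1 S1 \<noteq> 0"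
    by (rule exposed_arc_contour[OF assms(5) _ t1 sub \<rho>])
      ((rule growth; assumption) | (rule that; assumption))+
  note 1 = 1[folded p1_def]
  obtain E2 K2 m2 S2 where 2: "spectral_contour E2 K2 m2 S2" "K2 \<subseteq> ball (prc I (g t2)) \<rho>" "opint E2 S2 \<noteq> 0"
    by (rule exposed_arc_contour[OF assms(5) _ t2(1) sub \<rho>])
      ((rule growth; assumption) | (rule that; assumption))+
  note 2 = 2[folded p2_def]
  have "K1 \<inter> K2 = {}"
  proof -
    have "\<rho> + \<rho> \<le> dist p1 p2" by (simp add: \<rho>_def)
    then have "ball p1 \<rho> \<inter> ball p2 \<rho> = {}" by (rule disjoint_ballI)
    then show ?thesis using 1(2) 2(2) by blast
  qed
  moreover have "cnj ` K1 \<inter> K2 = {}"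
  proof -
    have "\<rho> + \<rho> \<le> dist (cnj p1) p2" by (simp add: \<rho>_def)
    then have "ball (cnj p1) \<rho> \<inter> ball p2 \<rho> = {}" by (rule disjoint_ballI)
    moreover have "cnj ` K1 \<subseteq> ball (cnj p1) \<rho>"
    proof clarify
      fix z assume "z \<in> K1"
      then have "dist p1 z < \<rho>" using 1(2) by auto
      moreover have "dist (cnj p1) (cnj z) = dist p1 z"
        by (metis complex_cnj_diff complex_mod_cnj dist_norm)
      ultimately show "cnj z \<in> ball (cnj p1) \<rho>" by simp
    qed
    ultimately show ?thesis using 2(2) by blast
  qed
  ultimately show ?thesis
    by (rule hyperinvariant_subspace_of_annihilating_pair[OF 1(1) 2(1) _ _ 1(3) 2(3)])
qed

end
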